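(* Let $a,b>0$, $I=[-a,b]$, and let $h:I\to(0,\infty)$ be a continuous function such that: (i) $x=0$ is the only point of global maximum of $h$ on $I$; (ii) $h$ is $C^1$ on $I\setminus\{0\}$, and in a neighborhood of $x=0$ it admits the expansion $$h(x)=\begin{cases} M-c_+x^m+O(x^{m+1}), & x>0,\\ M-c_-|x|^m+O(|x|^{m+1}), & x<0,\end{cases}$$ where $M,m,c_\pm$ are real numbers with $M>0$, $c_\pm>0$, $m\ge 1$. Let $\alpha=2(m+2)^{-1}$, and let $\widehat{\mathbf Q}_\epsilon$, $I_\epsilon$ and $\mathbf H$ be as defined in the context. Then $$\left\|\widehat{\mathbf Q}_\epsilon^{-1}\oplus\boldsymbol 0-\mathbf H^{-1}\right\|\to0,\qquad\epsilon\to0,$$ where $\boldsymbol 0$ is the zero operator on the subspace $L^2(\mathbb R\setminus I_\epsilon)$.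
   Context: For $\epsilon>0$, $\mathbf Q_\epsilon$ is the self-adjoint operator on $L^2(I)$ $$\mathbf Q_\epsilon u=-\frac{d^2u}{dx^2}+W_\epsilon(x)u,\qquad u(-a)=u(b)=0,$$ associated with the quadratic form $\mathbf q_\epsilon[\chi]=\int_I(\chi'(x)^2+W_\epsilon(x)\chi^2(x))\,dx$ defined on $H^1_0(I)$, where $$W_\epsilon(x)=\frac{\pi^2}{\epsilon^2}\left(\frac1{h^2(x)}-\frac1{M^2}\right)+v(x),\qquad v(x)=\left(\frac{\pi^2}{3}+\frac14\right)\frac{h'(x)^2}{h^2(x)}.$$ $I_\epsilon=(-a\epsilon^{-\alpha},b\epsilon^{-\alpha})$, and $\mathbf J_\epsilon:L^2(I)\to L^2(I_\epsilon)$ is the isometry generated by the dilation $x=t\epsilon^\alpha$, i.e. $(\mathbf J_\epsilon u)(t)=\epsilon^{\alpha/2}u(t\epsilon^\alpha)$. Then $\widehat{\mathbf Q}_\epsilon:=\epsilon^{2\alpha}\mathbf J_\epsilon\mathbf Q_\epsilon\mathbf J_\epsilon^{-1}$ is a self-adjoint operator in $L^2(I_\epsilon)$. The space $L^2(I_\epsilon)$ is identified with the subspace of functions in $L^2(\mathbb R)$ vanishing a.e. outside $I_\epsilon$, and $\oplus$ is with respect to $L^2(\mathbb R)=L^2(I_\epsilon)\oplus L^2(\mathbb R\setminus I_\epsilon)$. $\mathbf H=-\frac{d^2}{dx^2}+q(x)$ is the self-adjoint operator on $L^2(\mathbb R)$ with $q(x)=2\pi^2M^{-3}c_+x^m$ for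 $x>0$ and $q(x)=2\pi^2M^{-3}c_-|x|^m$ for $x<0$ (defined via its quadratic form). $\|\cdot\|$ is the operator norm on $L^2(\mathbb R)$.
   Formalization: The formal statement adds the explicit assumption that the quadratic form q_ε is finite on all of H^1_0(I) (equivalently h' is in L^2(I)), which (i)-(ii) do not imply and without which Q_ε is not defined as stated. *)

theory Defs
  imports "HOL-Analysis.Analysis" "HOL-Library.Landau_Symbols"
begin

section \<open>The real Hilbert space $L^2(\mathbb R)$\<close>

definition sq_int :: "(real \<Rightarrow> real) \<Rightarrow> bool" where
  "sq_int f \<longleftrightarrow> f \<in> borel_measurable lborel \<and> integrable lborel (\<lambda>x. (f x)\<^sup>2)"

definition sq_int_eq :: "(real \<Rightarrow> real) \<Rightarrow> (real \<Rightarrow> real) \<Rightarrow> bool" where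
  "sq_int_eq f g \<longleftrightarrow> sq_int f \<and> sq_int g \<and> (AE x in lborel. f x = g x)"

lemma sq_int_zero: "sq_int (\<lambda>_. 0)"
  by (simp add: sq_int_def)

lemma sq_int_mult:
  assumes "sq_int f" "sq_int g"
  shows "integrable lborel (\<lambda>x. f x * g x)"
proof (rule Bochner_Integration.integrable_bound)
  show "integrable lborel (\<lambda>x. (f x)\<^sup>2 + (g x)\<^sup>2)"
    using assms by (simp add: sq_int_def)
  show "(\<lambda>x. f x * g x) \<in> borel_measurable lborel"
    using assms by (auto simp: sq_int_def)
  have "\<bar>y * z\<bar> \<le> y\<^sup>2 + z\<^sup>2" for y z :: real
  proof -
    have "2 * (\<bar>y\<bar> * \<bar>z\<bar>) \<le> y\<^sup>2 + z\<^sup>2"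
      using sum_squares_bound[of "\<bar>y\<bar>" "\<bar>z\<bar>"] by simp
    moreover have "0 \<le> \<bar>y\<bar> * \<bar>z\<bar>" by simp
    ultimately show ?thesis unfolding abs_mult by linarith
  qed
  then show "AE x in lborel. norm (f x * g x) \<le> norm ((f x)\<^sup>2 + (g x)\<^sup>2)"
    by (intro AE_I2) (simp add: power2_eq_square)
qed

lemma sq_int_add:
  assumes "sq_int f" "sq_int g"
  shows "sq_int (\<lambda>x. f x + g x)"
proof -
  have "integrable lborel (\<lambda>x. (f x)\<^sup>2 + (g x)\<^sup>2 + 2 * (f x * g x))"
    using assms sq_int_mult[OF assms] by (simp add: sq_int_def)
  then have "integrable lborel (\<lambda>x. (f x + g x)\<^sup>2)"
    by (simp add: power2_sum algebra_simps)
  then show ?thesis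
    using assms by (auto simp: sq_int_def)
qed

lemma sq_int_cmult: "sq_int f \<Longrightarrow> sq_int (\<lambda>x. c * f x)"
  by (auto simp: sq_int_def power_mult_distrib)

quotient_type L2R = "real \<Rightarrow> real" / partial: sq_int_eq
proof (rule part_equivpI)
  show "\<exists>f. sq_int_eq f f"
    by (rule exI[of _ "\<lambda>_. 0"]) (simp add: sq_int_eq_def sq_int_zero)
  show "symp sq_int_eq"
    by (rule sympI) (auto simp: sq_int_eq_def)
  show "transp sq_int_eq"
    by (rule transpI) (auto simp: sq_int_eq_def)
qed

instantiation L2R :: real_vector
begin

lift_definition zero_L2R :: L2R is "\<lambda>_. 0"
  by (simp add: sq_int_eq_def sq_int_zero)

lift_definition plus_L2R :: "L2R \<Rightarrow> L2R \<Rightarrow> L2R" is "\<lambda>f g x. f x + g x"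
  by (auto simp: sq_int_eq_def sq_int_add)

lift_definition scaleR_L2R :: "real \<Rightarrow> L2R \<Rightarrow> L2R" is "\<lambda>c f x. c * f x"
  by (auto simp: sq_int_eq_def sq_int_cmult)

definition uminus_L2R :: "L2R \<Rightarrow> L2R" where
  "- u = (-1) *\<^sub>R u" for u :: L2R

definition minus_L2R :: "L2R \<Rightarrow> L2R \<Rightarrow> L2R" where
  "u - w = u + (- w)" for u w :: L2R

instance
proof
  fix u v w :: L2R and c d :: real
  show "u + v + w = u + (v + w)"
    by transfer (simp add: sq_int_eq_def sq_int_add add.assoc)
  show "u + v = v + u"
    by transfer (simp add: sq_int_eq_def sq_int_add add.commute)
  show "0 + u = u"
    by transfer (simp add: sq_int_eq_def)
  show "- u + u = 0"
    unfolding uminus_L2R_def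
    by transfer (simp add: sq_int_eq_def sq_int_zero)
  show "u - v = u + - v"
    by (rule minus_L2R_def)
  show "c *\<^sub>R (u + v) = c *\<^sub>R u + c *\<^sub>R v"
    by transfer (simp add: sq_int_eq_def sq_int_add sq_int_cmult distrib_left)
  show "(c + d) *\<^sub>R u = c *\<^sub>R u + d *\<^sub>R u"
    by transfer (simp add: sq_int_eq_def sq_int_add sq_int_cmult distrib_right)
  show "c *\<^sub>R d *\<^sub>R u = (c * d) *\<^sub>R u"
    by transfer (simp add: sq_int_eq_def sq_int_cmult mult.assoc)
  show "1 *\<^sub>R u = u"
    by transfer (simp add: sq_int_eq_def)
qed

end

instantiation L2R :: real_inner
begin

lift_definition inner_L2R :: "L2R \<Rightarrow> L2R \<Rightarrow> real" is "\<lambda>f g. \<integral>x. f x * g x \<partial>lborel"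
  by (rule integral_cong_AE) (auto simp: sq_int_eq_def sq_int_def)

definition norm_L2R :: "L2R \<Rightarrow> real" where
  "norm_L2R u = sqrt (inner u u)"

definition dist_L2R :: "L2R \<Rightarrow> L2R \<Rightarrow> real" where
  "dist_L2R u w = norm (u - w)"

definition sgn_L2R :: "L2R \<Rightarrow> L2R" where
  "sgn_L2R u = inverse (norm u) *\<^sub>R u"

definition uniformity_L2R :: "(L2R \<times> L2R) filter" where
  "uniformity_L2R = (INF e\<in>{0<..}. principal {(u, w). dist u w < e})"

definition open_L2R :: "L2R set \<Rightarrow> bool" where
  "open_L2R U \<longleftrightarrow> (\<forall>u\<in>U. \<forall>\<^sub>F (u', w) in uniformity. u' = u \<longrightarrow> w \<in> U)"

instance
proof
  fix u v w :: L2R and c :: real and U :: "L2R set"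
  show "dist u v = norm (u - v)" by (rule dist_L2R_def)
  show "sgn u = inverse (norm u) *\<^sub>R u" by (rule sgn_L2R_def)
  show "(uniformity :: (L2R \<times> L2R) filter) = (INF e\<in>{0<..}. principal {(u, w). dist u w < e})"
    by (rule uniformity_L2R_def)
  show "open U \<longleftrightarrow> (\<forall>u\<in>U. \<forall>\<^sub>F (u', w) in uniformity. u' = u \<longrightarrow> w \<in> U)"
    by (rule open_L2R_def)
  show "inner u v = inner v u"
    by transfer (simp add: mult.commute)
  show "inner (u + v) w = inner u w + inner v w"
    by transfer (auto simp: sq_int_eq_def sq_int_mult distrib_right
        intro!: Bochner_Integration.integral_add)
  show "inner (c *\<^sub>R u) v = c * inner u v"
    by transfer (simp add: mult.assoc)
  show "0 \<le> inner u u"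
    by transfer simp
  show "inner u u = 0 \<longleftrightarrow> u = 0"
  proof transfer
    fix f :: "real \<Rightarrow> real" assume "sq_int_eq f f"
    then have f: "sq_int f" by (simp add: sq_int_eq_def)
    have "(\<integral>x. f x * f x \<partial>lborel) = 0 \<longleftrightarrow> (AE x in lborel. f x * f x = 0)"
      using sq_int_mult[OF f f] by (intro integral_nonneg_eq_0_iff_AE) auto
    then show "(\<integral>x. f x * f x \<partial>lborel) = 0 \<longleftrightarrow> sq_int_eq f (\<lambda>_. 0)"
      using f by (simp add: sq_int_eq_def sq_int_zero)
  qed
  show "norm u = sqrt (inner u u)" by (rule norm_L2R_def)
qed

end

text \<open>\<open>rep_L2R u\<close> is some representative of the class \<open>u\<close> and \<open>abs_L2R f\<close> the class of \<open>f\<close>.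
  The space $L^2(A)$ is identified with the classes vanishing a.e. outside \<open>A\<close>.\<close>

definition L2_on :: "real set \<Rightarrow> L2R set" where
  "L2_on A = {u. AE x in lborel. x \<notin> A \<longrightarrow> rep_L2R u x = 0}"


section \<open>Sobolev spaces on an interval\<close>

text \<open>\<open>ac_rep J u g f\<close>: on the interval \<open>J\<close>, the function \<open>f\<close> is a representative of \<open>u\<close> which is
  (locally) absolutely continuous, i.e. an indefinite integral, with derivative \<open>g\<close> in $L^2(J)$.\<close>

definition ac_rep :: "real set \<Rightarrow> L2R \<Rightarrow> L2R \<Rightarrow> (real \<Rightarrow> real) \<Rightarrow> bool" where
  "ac_rep J u g f \<longleftrightarrow> u \<in> L2_on J \<and> g \<in> L2_on J \<and>
     (AE x in lborel. x \<in> J \<longrightarrow> rep_L2R u x = f x) \<and>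
     (\<forall>x\<in>J. \<forall>y\<in>J. x \<le> y \<longrightarrow> f y - f x = (LBINT t:{x..y}. rep_L2R g t))"

definition H1 :: "real set \<Rightarrow> L2R set" where
  "H1 J = {u. \<exists>g f. ac_rep J u g f}"

definition H10 :: "real \<Rightarrow> real \<Rightarrow> L2R set" where
  "H10 l r = {u. \<exists>g f. ac_rep {l..r} u g f \<and> f l = 0 \<and> f r = 0}"

text \<open>The derivative of a function in $H^1(J)$; it is unique for a nondegenerate interval \<open>J\<close>.\<close>

definition weak_deriv :: "real set \<Rightarrow> L2R \<Rightarrow> L2R" where
  "weak_deriv J u = (THE g. \<exists>f. ac_rep J u g f)"


section \<open>Linear operators, given by their graphs\<close>

type_synonym operator = "(L2R \<times> L2R) set"

text \<open>The operator in the closed subspace \<open>K\<close> associated with the quadratic form \<open>q\<close> with form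
  domain \<open>D\<close>: \<open>u\<close> is in the operator domain and is mapped to \<open>f\<close> iff
  \<open>q[u, w] = \<langle>f, w\<rangle>\<close> for all \<open>w \<in> D\<close>, where \<open>q[\<cdot>, \<cdot>]\<close> is obtained from \<open>q\<close> by polarization.\<close>

definition polar :: "(L2R \<Rightarrow> real) \<Rightarrow> L2R \<Rightarrow> L2R \<Rightarrow> real" where
  "polar q u w = (q (u + w) - q (u - w)) / 4"

definition form_operator :: "L2R set \<Rightarrow> L2R set \<Rightarrow> (L2R \<Rightarrow> real) \<Rightarrow> operator" where
  "form_operator K D q = {(u, f). u \<in> D \<and> f \<in> K \<and> (\<forall>w\<in>D. polar q u w = inner f w)}"

definition op_direct_sum :: "operator \<Rightarrow> operator \<Rightarrow> operator" where
  "op_direct_sum S T = {(u + w, f + g) | u w f g. (u, f) \<in> S \<and> (w, g) \<in> T}"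

definition zero_operator :: "L2R set \<Rightarrow> operator" where
  "zero_operator K = {(u, 0) | u. u \<in> K}"

text \<open>\<open>T\<^sup>-\<^sup>1 \<oplus> 0\<close> for an operator \<open>T\<close> in $L^2(A)$, with \<open>0\<close> acting in the complement $L^2(\mathbb R\setminus A)$.\<close>

definition inverse_plus_zero :: "real set \<Rightarrow> operator \<Rightarrow> operator" where
  "inverse_plus_zero A T = op_direct_sum (T\<inverse>) (zero_operator (L2_on (- A)))"

text \<open>An operator is bounded and defined on all of $L^2(\mathbb R)$ iff it is the graph of a
  (necessarily unique) element of the normed space of bounded linear maps, whose norm is the
  operator norm.\<close>

definition blinfun_graph :: "(L2R \<Rightarrow>\<^sub>L L2R) \<Rightarrow> operator" where
  "blinfun_graph A = {(u, blinfun_apply A u) | u. True}"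

definition everywhere_bounded :: "operator \<Rightarrow> bool" where
  "everywhere_bounded T \<longleftrightarrow> (\<exists>A. T = blinfun_graph A)"

definition the_blinfun :: "operator \<Rightarrow> (L2R \<Rightarrow>\<^sub>L L2R)" where
  "the_blinfun T = (THE A. T = blinfun_graph A)"

lemma the_blinfun_graph [simp]: "the_blinfun (blinfun_graph A) = A"
  unfolding the_blinfun_def
proof (rule the_equality)
  fix B assume eq: "blinfun_graph A = blinfun_graph B"
  show "B = A"
  proof (rule blinfun_eqI)
    fix u
    have "(u, blinfun_apply B u) \<in> blinfun_graph A"
      unfolding eq by (auto simp: blinfun_graph_def)
    then show "blinfun_apply B u = blinfun_apply A u"
      by (auto simp: blinfun_graph_def)
  qed
qed simp


section \<open>The operators of the theorem\<close>

text \<open>Here \<open>h'\<close> is the derivative of \<open>h\<close>; its value at \<open>0\<close> is irrelevant.\<close>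

definition W_pot :: "(real \<Rightarrow> real) \<Rightarrow> (real \<Rightarrow> real) \<Rightarrow> real \<Rightarrow> real \<Rightarrow> real \<Rightarrow> real" where
  "W_pot h h' M \<epsilon> x =
     pi\<^sup>2 / \<epsilon>\<^sup>2 * (1 / (h x)\<^sup>2 - 1 / M\<^sup>2) + (pi\<^sup>2 / 3 + 1 / 4) * ((h' x)\<^sup>2 / (h x)\<^sup>2)"

definition energy_density :: "real set \<Rightarrow> (real \<Rightarrow> real) \<Rightarrow> L2R \<Rightarrow> real \<Rightarrow> real" where
  "energy_density J V u x = (rep_L2R (weak_deriv J u) x)\<^sup>2 + V x * (rep_L2R u x)\<^sup>2"

definition energy_form :: "real set \<Rightarrow> (real \<Rightarrow> real) \<Rightarrow> L2R \<Rightarrow> real" where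
  "energy_form J V u = (LBINT x:J. energy_density J V u x)"

definition Q_op :: "real \<Rightarrow> real \<Rightarrow> (real \<Rightarrow> real) \<Rightarrow> (real \<Rightarrow> real) \<Rightarrow> real \<Rightarrow> real \<Rightarrow> operator" where
  "Q_op a b h h' M \<epsilon> =
     form_operator (L2_on {-a..b}) (H10 (-a) b) (energy_form {-a..b} (W_pot h h' M \<epsilon>))"

definition I_scaled :: "real \<Rightarrow> real \<Rightarrow> real \<Rightarrow> real \<Rightarrow> real set" where
  "I_scaled a b \<alpha> \<epsilon> = {-a * \<epsilon> powr (-\<alpha>) <..< b * \<epsilon> powr (-\<alpha>)}"

definition J_dil :: "real \<Rightarrow> real \<Rightarrow> L2R \<Rightarrow> L2R" where
  "J_dil \<alpha> \<epsilon> u = abs_L2R (\<lambda>t. \<epsilon> powr (\<alpha> / 2) * rep_L2R u (t * \<epsilon> powr \<alpha>))"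

text \<open>The graph of \<open>\<epsilon>\<^sup>2\<^sup>\<alpha> J Q J\<^sup>-\<^sup>1\<close>.\<close>

definition Q_hat :: "real \<Rightarrow> real \<Rightarrow> (real \<Rightarrow> real) \<Rightarrow> (real \<Rightarrow> real) \<Rightarrow> real \<Rightarrow> real \<Rightarrow> real \<Rightarrow> operator" where
  "Q_hat a b h h' M \<alpha> \<epsilon> =
     {(J_dil \<alpha> \<epsilon> u, \<epsilon> powr (2 * \<alpha>) *\<^sub>R J_dil \<alpha> \<epsilon> f) | u f. (u, f) \<in> Q_op a b h h' M \<epsilon>}"

definition q_pot :: "real \<Rightarrow> real \<Rightarrow> real \<Rightarrow> real \<Rightarrow> real \<Rightarrow> real" where
  "q_pot M m cp cm x =
     (if x > 0 then 2 * pi\<^sup>2 / M ^ 3 * cp * x powr m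
      else if x < 0 then 2 * pi\<^sup>2 / M ^ 3 * cm * \<bar>x\<bar> powr m
      else 0)"

definition H_form_domain :: "real \<Rightarrow> real \<Rightarrow> real \<Rightarrow> real \<Rightarrow> L2R set" where
  "H_form_domain M m cp cm =
     {u \<in> H1 UNIV. integrable lborel (\<lambda>x. q_pot M m cp cm x * (rep_L2R u x)\<^sup>2)}"

definition H_op :: "real \<Rightarrow> real \<Rightarrow> real \<Rightarrow> real \<Rightarrow> operator" where
  "H_op M m cp cm =
     form_operator UNIV (H_form_domain M m cp cm) (energy_form UNIV (q_pot M m cp cm))"

text \<open>The quadratic form of \<open>Q_op\<close> is defined (finite) on all of $H^1_0(-a, b)$.  This is not
  automatic: an expansion of \<open>h\<close> at \<open>0\<close> does not control \<open>h'\<close> near \<open>0\<close>.\<close>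

definition Q_form_defined :: "real \<Rightarrow> real \<Rightarrow> (real \<Rightarrow> real) \<Rightarrow> (real \<Rightarrow> real) \<Rightarrow> real \<Rightarrow> real \<Rightarrow> bool" where
  "Q_form_defined a b h h' M \<epsilon> \<longleftrightarrow>
     (\<forall>u\<in>H10 (-a) b. set_integrable lborel {-a..b} (energy_density {-a..b} (W_pot h h' M \<epsilon>) u))"

end

theory Submission
  imports Defs
begin

text \<open>Put \<open>s = \<epsilon>\<^sup>\<alpha>\<close>.  The dilation turns \<open>Q\<^sub>\<epsilon>\<close> into \<open>- d\<^sup>2/dt\<^sup>2 + V\<^sub>s\<close> on the rescaled interval, and
  \<open>2 \<alpha> - 2 = - \<alpha> m\<close> makes \<open>V\<^sub>s\<close> converge to \<open>q\<close> locally in \<open>L\<^sup>1\<close>; the term with \<open>h'\<close> only contributes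
  \<open>O(s)\<close> in \<open>L\<^sup>1\<close>.  Both potentials dominate \<open>\<kappa> \<bar>t\<bar>\<^sup>m\<close> with the same \<open>\<kappa> > 0\<close>, which bounds the \<open>L\<^sup>2\<close> and
  sup norms by the form norm, uniformly in \<open>\<epsilon>\<close>.  For \<open>u = H\<^sup>-\<^sup>1 F\<close>, \<open>w = Q\<^sub>\<epsilon>\<^sup>-\<^sup>1 G\<close> and a cutoff \<open>\<phi>\<close> at
  distance \<open>R\<close>, the difference \<open>\<langle>F, w\<rangle> - \<langle>u, G\<rangle>\<close> then splits into terms containing \<open>(1 - \<phi>) u\<close>, small in
  the form norm as \<open>R \<rightarrow> \<infinity>\<close>, and \<open>\<integral> (q - V\<^sub>s) \<phi> u w\<close>, small as \<open>\<epsilon> \<rightarrow> 0\<close> for fixed \<open>R\<close>.\<close>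

section \<open>Square-integrable functions\<close>

text \<open>The two inverses have different form domains, so \<open>u\<close> and \<open>w\<close>
  cannot simply be inserted into each other's equation. For \<open>w\<close> no cutoff is required:
  the lower bound on \<open>V\<^sub>s\<close> and an upper bound of \<open>q\<close> by a multiple
  of the same weight put it into the domain of \<open>q\<close>. Only \<open>u\<close> is localised,
  to a region inside the rescaled interval where the expansion of \<open>h\<close> holds. Near the
  origin \<open>h'\<close> is controlled only through integrability of its square, so
  \<open>V\<^sub>s\<close> is compared with \<open>q\<close> in L^1 and not uniformly; hence sup
  bounds on \<open>u\<close> and \<open>w\<close> are used next to L^2 bounds. The far part of
  \<open>u\<close> meets \<open>w\<close> inside the form, and Cauchy-Schwarz then asks for its form
  norm. That both inverses are bounded and everywhere defined is part of the claim; it rests on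
  Riesz representation in the form norm, whose completeness is reduced to pointwise limits and
  Fatou's lemma. The summand 0 on the complement comes for free: a weak equation tested only with
  functions supported in the interval, but posed for every right-hand side in L^2(R), ignores the
  outer component.\<close>

lemma sq_int_rep [simp]: "sq_int (rep_L2R u)"
  using Quotient3_rep_reflp[OF Quotient3_L2R, of u] by (simp add: sq_int_eq_def)

lemma abs_rep_L2R [simp]: "abs_L2R (rep_L2R u) = u"
  by (rule Quotient3_abs_rep[OF Quotient3_L2R])

lemma abs_L2R_eq_iff:
  assumes "sq_int f" "sq_int g"
  shows "abs_L2R f = abs_L2R g \<longleftrightarrow> (AE x in lborel. f x = g x)"
  using Quotient3_rel[OF Quotient3_L2R, of f g] assms by (simp add: sq_int_eq_def)

lemma rep_abs_AE:
  assumes "sq_int f"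
  shows "AE x in lborel. rep_L2R (abs_L2R f) x = f x"
  using abs_L2R_eq_iff[of "rep_L2R (abs_L2R f)" f] assms by simp

lemma L2R_eqI: "(AE x in lborel. rep_L2R u x = rep_L2R w x) \<Longrightarrow> u = w"
  using abs_L2R_eq_iff[of "rep_L2R u" "rep_L2R w"] by simp

lemma sq_int_measurable [measurable_dest]: "sq_int f \<Longrightarrow> f \<in> borel_measurable borel"
  by (simp add: sq_int_def)

lemma rep_L2R_measurable [measurable]: "rep_L2R u \<in> borel_measurable borel"
  using sq_int_rep by (rule sq_int_measurable)

lemma sq_int_integrable: "sq_int f \<Longrightarrow> integrable lborel (\<lambda>x. (f x)\<^sup>2)"
  by (simp add: sq_int_def)

lemma sq_int_diff:
  assumes "sq_int f" "sq_int g"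
  shows "sq_int (\<lambda>x. f x - g x)"
  using sq_int_add[OF assms(1) sq_int_cmult[OF assms(2), of "-1"]] by simp

lemma abs_L2R_add: "sq_int f \<Longrightarrow> sq_int g \<Longrightarrow> abs_L2R f + abs_L2R g = abs_L2R (\<lambda>x. f x + g x)"
  by (rule plus_L2R.abs_eq) (simp_all add: sq_int_eq_def)

lemma abs_L2R_scaleR: "sq_int f \<Longrightarrow> c *\<^sub>R abs_L2R f = abs_L2R (\<lambda>x. c * f x)"
  by (rule scaleR_L2R.abs_eq) (simp_all add: sq_int_eq_def)

lemma abs_L2R_diff: "sq_int f \<Longrightarrow> sq_int g \<Longrightarrow> abs_L2R f - abs_L2R g = abs_L2R (\<lambda>x. f x - g x)"
  using abs_L2R_add[of f "\<lambda>x. - 1 * g x"] abs_L2R_scaleR[of g "-1"] sq_int_cmult[of g "-1"]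
  by (simp only: diff_conv_add_uminus scaleR_minus1_left mult_minus1)

lemma inner_abs_L2R: "sq_int f \<Longrightarrow> sq_int g \<Longrightarrow> inner (abs_L2R f) (abs_L2R g) = (LBINT x. f x * g x)"
  by (rule inner_L2R.abs_eq) (simp_all add: sq_int_eq_def)

lemma norm_abs_L2R: "sq_int f \<Longrightarrow> (norm (abs_L2R f))\<^sup>2 = (LBINT x. (f x)\<^sup>2)"
  by (simp add: power2_norm_eq_inner inner_abs_L2R) (simp add: power2_eq_square)

lemma sq_int_cong_AE:
  assumes "sq_int f" "g \<in> borel_measurable borel" "AE x in lborel. f x = g x"
  shows "sq_int g"
proof -
  have [measurable]: "f \<in> borel_measurable borel" "g \<in> borel_measurable borel"
    using assms by (auto simp: sq_int_def)
  have "integrable lborel (\<lambda>x. (g x)\<^sup>2) \<longleftrightarrow> integrable lborel (\<lambda>x. (f x)\<^sup>2)"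
    using assms(3) by (intro integrable_cong_AE) auto
  then show ?thesis using assms by (simp add: sq_int_def)
qed

lemma sq_int_mult_bounded:
  assumes "sq_int f" and [measurable]: "\<phi> \<in> borel_measurable borel" and "\<And>x. \<bar>\<phi> x\<bar> \<le> K"
  shows "sq_int (\<lambda>x. \<phi> x * f x)"
proof -
  have [measurable]: "f \<in> borel_measurable borel" using assms by (simp add: sq_int_def)
  have "integrable lborel (\<lambda>x. (\<phi> x * f x)\<^sup>2)"
  proof (rule Bochner_Integration.integrable_bound)
    show "integrable lborel (\<lambda>x. K\<^sup>2 * (f x)\<^sup>2)" using assms by (simp add: sq_int_def)
    have "(\<phi> x)\<^sup>2 \<le> K\<^sup>2" for x
      using assms(3)[of x] by (metis abs_ge_zero power2_abs power_mono)
    then show "AE x in lborel. norm ((\<phi> x * f x)\<^sup>2) \<le> norm (K\<^sup>2 * (f x)\<^sup>2)"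
      by (intro AE_I2) (auto simp: power_mult_distrib intro!: mult_right_mono)
  qed simp
  then show ?thesis by (simp add: sq_int_def)
qed

lemma sq_int_indicator:
  assumes "sq_int f" "A \<in> sets borel"
  shows "sq_int (\<lambda>x. indicator A x * f x)"
  by (rule sq_int_mult_bounded[where K=1]) (use assms in \<open>auto split: split_indicator\<close>)

lemma sq_int_Cauchy_Schwarz:
  assumes "sq_int f" "sq_int g"
  shows "(LBINT x. f x * g x)\<^sup>2 \<le> (LBINT x. (f x)\<^sup>2) * (LBINT x. (g x)\<^sup>2)"
  using Cauchy_Schwarz_ineq[of "abs_L2R f" "abs_L2R g"] assms
  by (simp add: inner_abs_L2R power2_eq_square)

lemma sq_int_indicator_Icc: "sq_int (indicator {x..y::real})"
proof -
  have "integrable lborel (indicator {x..y} :: real \<Rightarrow> real)"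
    by (intro integrable_real_indicator) (auto simp: emeasure_lborel_Icc_eq)
  moreover have "(indicator {x..y} t)\<^sup>2 = (indicator {x..y} t :: real)" for t
    by (simp split: split_indicator)
  ultimately show ?thesis by (simp add: sq_int_def)
qed

lemma sq_int_set_integrable: "sq_int f \<Longrightarrow> set_integrable lborel {x..y} f"
  using sq_int_mult[OF sq_int_indicator_Icc[of x y]] by (simp add: set_integrable_def)

lemma set_integral_sq_le:
  assumes "sq_int f" "x \<le> y"
  shows "(LBINT t:{x..y}. f t)\<^sup>2 \<le> (y - x) * (LBINT t. (f t)\<^sup>2)"
proof -
  have "(indicator {x..y} t)\<^sup>2 = (indicator {x..y} t :: real)" for t
    by (simp split: split_indicator)
  then have "(LBINT t. (indicator {x..y} t :: real)\<^sup>2) = y - x" using assms(2) by simp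
  then show ?thesis
    using sq_int_Cauchy_Schwarz[OF sq_int_indicator_Icc[of x y] assms(1)]
    by (simp add: set_lebesgue_integral_def)
qed

section \<open>Fatou's lemma and completeness of L^2\<close>

lemma integral_Fatou:
  fixes F :: "nat \<Rightarrow> real \<Rightarrow> real"
  assumes int: "\<And>k. integrable lborel (F k)" and nn: "\<And>k x. F k x \<ge> 0"
    and [measurable]: "f \<in> borel_measurable borel"
    and lim: "AE x in lborel. (\<lambda>k. F k x) \<longlonglongrightarrow> f x"
    and bnd: "eventually (\<lambda>k. (LBINT x. F k x) \<le> c) sequentially"
  shows "integrable lborel f" and "(LBINT x. f x) \<le> c"
proof -
  have [measurable]: "F k \<in> borel_measurable borel" for k using int[of k] by auto
  have f_nn: "AE x in lborel. f x \<ge> 0"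
    using lim by eventually_elim (rule LIMSEQ_le_const, auto simp: nn)
  \<comment> \<open>Nonnegativity of \<open>c\<close> matters: \<open>ennreal\<close> sends negative
    reals to 0, so the final comparison could not be read back otherwise.\<close>
  from eventually_happens[OF bnd] obtain k where "(LBINT x. F k x) \<le> c" by auto
  moreover have "(LBINT x. F k x) \<ge> 0" by (simp add: nn)
  ultimately have c: "c \<ge> 0" by linarith
  have "(\<integral>\<^sup>+x. ennreal (f x) \<partial>lborel) = (\<integral>\<^sup>+x. liminf (\<lambda>k. ennreal (F k x)) \<partial>lborel)"
  proof (rule nn_integral_cong_AE)
    show "AE x in lborel. ennreal (f x) = liminf (\<lambda>k. ennreal (F k x))"
      using lim
    proof eventually_elim
      case (elim x)
      then have "(\<lambda>k. ennreal (F k x)) \<longlonglongrightarrow> ennreal (f x)" by (rule tendsto_ennrealI)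
      then show ?case by (simp add: lim_imp_Liminf)
    qed
  qed
  also have "\<dots> \<le> liminf (\<lambda>k. \<integral>\<^sup>+x. ennreal (F k x) \<partial>lborel)"
    by (rule nn_integral_liminf) simp
  also have "(\<lambda>k. \<integral>\<^sup>+x. ennreal (F k x) \<partial>lborel) = (\<lambda>k. ennreal (LBINT x. F k x))"
    by (intro ext nn_integral_eq_integral int AE_I2 nn)
  also have "liminf (\<lambda>k. ennreal (LBINT x. F k x)) \<le> liminf (\<lambda>k. ennreal c)"
    by (rule Liminf_mono) (use bnd in \<open>auto elim!: eventually_mono intro: ennreal_leI\<close>)
  also have "\<dots> = ennreal c" by (simp add: Liminf_const)
  finally have le: "(\<integral>\<^sup>+x. ennreal (f x) \<partial>lborel) \<le> ennreal c" .
  show i: "integrable lborel f"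
    by (rule integrableI_nonneg) (use f_nn le in \<open>auto simp: top_unique le_less_trans\<close>)
  have "ennreal (LBINT x. f x) \<le> ennreal c"
    using le nn_integral_eq_integral[OF i f_nn] by simp
  then show "(LBINT x. f x) \<le> c" using c by (simp add: ennreal_le_iff)
qed

lemma convergent_if_summable_increments:
  fixes a :: "nat \<Rightarrow> real"
  assumes "\<And>n. \<bar>a (Suc n) - a n\<bar> \<le> s n" "summable s"
  shows "convergent a"
proof -
  have "summable (\<lambda>k. a (Suc k) - a k)"
    by (rule summable_comparison_test'[OF assms(2), where N=0]) (use assms in auto)
  then have "convergent (\<lambda>n. (\<Sum>k<n. a (Suc k) - a k) + a 0)"
    by (intro convergent_add convergent_const) (simp add: summable_iff_convergent)
  then show ?thesis by (simp add: sum_lessThan_telescope)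
qed

text \<open>A geometric rate makes the sequence converge almost everywhere, because
  \<open>\<bar>y\<bar> \<le> 2\<^sup>k y\<^sup>2 + 2\<^sup>-\<^sup>k\<close>; the limit is then controlled by Fatou's lemma.\<close>

lemma sq_int_complete:
  fixes g :: "nat \<Rightarrow> real \<Rightarrow> real"
  assumes sq: "\<And>n. sq_int (g n)"
    and C: "\<And>n k. n \<le> k \<Longrightarrow> (LBINT x. (g n x - g k x)\<^sup>2) \<le> C * (1/4)^n"
  obtains l where "sq_int l" "\<And>n. (LBINT x. (g n x - l x)\<^sup>2) \<le> C * (1/4)^n"
proof -
  note [measurable] = sq_int_measurable[OF sq]
  define d where "d k x = 2^k * (g k x - g (Suc k) x)\<^sup>2" for k x
  have d_nn: "d k x \<ge> 0" for k x by (simp add: d_def)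
  have d_int: "integrable lborel (d k)" for k
    unfolding d_def by (intro integrable_mult_right sq_int_integrable sq_int_diff sq)
  have d_le: "(LBINT x. d k x) \<le> C * (1/2)^k" for k
  proof -
    have "(LBINT x. d k x) = 2^k * (LBINT x. (g k x - g (Suc k) x)\<^sup>2)"
      unfolding d_def by simp
    also have "\<dots> \<le> 2^k * (C * (1/4)^k)" using C[of k "Suc k"] by (intro mult_left_mono) auto
    also have "\<dots> = C * (2^k * (1/4)^k)" by simp
    also have "2^k * (1/4)^k = (1/2::real)^k" by (simp flip: power_mult_distrib)
    finally show ?thesis .
  qed
  have "C \<ge> 0" using C[of 0 0] by simp
  \<comment> \<open>The rate 1/4 beats the weight 2^k and leaves a geometric series of ratio 1/2;
    exchanging sum and integral then makes \<open>d k x\<close> summable in \<open>k\<close> for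
    almost every \<open>x\<close>.\<close>
  have "(\<integral>\<^sup>+x. (\<Sum>k. ennreal (d k x)) \<partial>lborel) = (\<Sum>k. \<integral>\<^sup>+x. ennreal (d k x) \<partial>lborel)"
    by (rule nn_integral_suminf) (simp add: d_def)
  also have "\<dots> = (\<Sum>k. ennreal (LBINT x. d k x))"
    using d_int d_nn by (simp add: nn_integral_eq_integral)
  also have "\<dots> \<le> (\<Sum>k. ennreal (C * (1/2)^k))"
    by (intro suminf_le ennreal_leI d_le) auto
  also have "\<dots> = ennreal (\<Sum>k. C * (1/2)^k)"
    using \<open>C \<ge> 0\<close> by (intro suminf_ennreal2 summable_mult summable_geometric) auto
  also have "\<dots> < \<infinity>" by simp
  finally have fin: "(\<integral>\<^sup>+x. (\<Sum>k. ennreal (d k x)) \<partial>lborel) < \<infinity>" .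
  have "AE x in lborel. (\<Sum>k. ennreal (d k x)) \<noteq> \<infinity>"
    by (rule nn_integral_PInf_AE) (use fin in \<open>auto simp: d_def\<close>)
  then have conv: "AE x in lborel. convergent (\<lambda>k. g k x)"
  proof eventually_elim
    case (elim x)
    have sd: "summable (\<lambda>k. d k x)"
      by (rule summable_suminf_not_top) (use elim d_nn in auto)
    have "\<bar>g (Suc k) x - g k x\<bar> \<le> d k x + (1/2)^k" for k
    proof -
      define y where "y = \<bar>g k x - g (Suc k) x\<bar>"
      define p where "p = (2::real)^k"
      have p: "p > 0" by (simp add: p_def)
      \<comment> \<open>Weighted AM-GM: the expanded square bounds \<open>p * y\<close>, and
        division by \<open>p\<close> leaves the summable error \<open>1 / p\<close>.\<close>
      have "0 \<le> (p * y - 1)\<^sup>2" by simp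
      then have "2 * (p * y) \<le> p * (p * y\<^sup>2) + 1" by (simp add: power2_eq_square algebra_simps)
      moreover have "p * y \<ge> 0" using p by (simp add: y_def)
      ultimately have "p * y \<le> p * (p * y\<^sup>2 + 1 / p)" using p by (simp add: algebra_simps)
      then have "y \<le> p * y\<^sup>2 + 1 / p" using p by simp
      then show ?thesis
        by (simp add: y_def p_def d_def power_one_over power2_abs abs_minus_commute)
    qed
    moreover have "summable (\<lambda>k. d k x + (1/2)^k)"
      by (intro summable_add sd summable_geometric) auto
    ultimately show ?case by (rule convergent_if_summable_increments)
  qed
  define l where "l x = lim (\<lambda>k. g k x)" for x
  have [measurable]: "l \<in> borel_measurable borel" unfolding l_def by measurable
  have lim: "AE x in lborel. (\<lambda>k. (g n x - g k x)\<^sup>2) \<longlonglongrightarrow> (g n x - l x)\<^sup>2" for n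
    using conv
    by eventually_elim (auto intro!: tendsto_intros simp: l_def convergent_LIMSEQ_iff)
  have F: "integrable lborel (\<lambda>x. (g n x - l x)\<^sup>2)" "(LBINT x. (g n x - l x)\<^sup>2) \<le> C * (1/4)^n" for n
    by (rule integral_Fatou[OF _ _ _ lim[of n]]; use sq C in
        \<open>auto intro!: sq_int_integrable sq_int_diff simp: eventually_sequentially\<close>)+
  have "sq_int (\<lambda>x. g 0 x - l x)" using F(1)[of 0] by (simp add: sq_int_def)
  from sq_int_diff[OF sq[of 0] this] have "sq_int l" by simp
  then show ?thesis using F(2) that by blast
qed

section \<open>Absolutely continuous functions and Sobolev bounds\<close>

text \<open>Function and derivative are plain functions rather than classes, so that values,
  products and dilations can be computed pointwise.\<close>

definition ac_on :: "real set \<Rightarrow> (real \<Rightarrow> real) \<Rightarrow> (real \<Rightarrow> real) \<Rightarrow> bool" where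
  "ac_on J f g \<longleftrightarrow> (\<forall>x\<in>J. \<forall>y\<in>J. x \<le> y \<longrightarrow> f y - f x = (LBINT t:{x..y}. g t))"

definition h1_fun :: "(real \<Rightarrow> real) \<Rightarrow> (real \<Rightarrow> real) \<Rightarrow> bool" where
  "h1_fun f g \<longleftrightarrow> sq_int f \<and> sq_int g \<and> ac_on UNIV f g"

lemma ac_on_subset: "ac_on J f g \<Longrightarrow> K \<subseteq> J \<Longrightarrow> ac_on K f g"
  unfolding ac_on_def by blast

lemma ac_on_add:
  assumes "ac_on J f g" "ac_on J f' g'" "sq_int g" "sq_int g'"
  shows "ac_on J (\<lambda>x. f x + f' x) (\<lambda>x. g x + g' x)"
  unfolding ac_on_def
proof (intro ballI impI)
  fix x y assume "x \<in> J" "y \<in> J" "x \<le> y"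
  then have "f y - f x = (LBINT t:{x..y}. g t)" "f' y - f' x = (LBINT t:{x..y}. g' t)"
    using assms by (auto simp: ac_on_def)
  then show "f y + f' y - (f x + f' x) = (LBINT t:{x..y}. g t + g' t)"
    by (subst set_integral_add(2)) (auto intro!: sq_int_set_integrable assms)
qed

lemma ac_on_cmult:
  assumes "ac_on J f g"
  shows "ac_on J (\<lambda>x. c * f x) (\<lambda>x. c * g x)"
  using assms by (auto simp: ac_on_def simp flip: right_diff_distrib)

lemma h1_fun_add: "h1_fun f g \<Longrightarrow> h1_fun f' g' \<Longrightarrow> h1_fun (\<lambda>x. f x + f' x) (\<lambda>x. g x + g' x)"
  by (auto simp: h1_fun_def intro: sq_int_add ac_on_add)

lemma h1_fun_cmult: "h1_fun f g \<Longrightarrow> h1_fun (\<lambda>x. c * f x) (\<lambda>x. c * g x)"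
  by (auto simp: h1_fun_def intro: sq_int_cmult ac_on_cmult)

text \<open>Cauchy-Schwarz for the derivative against the indicator of the interval between the two
  points. This Hoelder bound of order 1/2 is the source of continuity and of the sup
  estimates.\<close>

lemma ac_on_Holder:
  assumes "ac_on J f g" "sq_int g" "x \<in> J" "y \<in> J"
  shows "(f x - f y)\<^sup>2 \<le> \<bar>x - y\<bar> * (LBINT t. (g t)\<^sup>2)"
proof -
  have *: "(f y - f x)\<^sup>2 \<le> (y - x) * (LBINT t. (g t)\<^sup>2)" if "x \<le> y" "x \<in> J" "y \<in> J" for x y
  proof -
    have "f y - f x = (LBINT t:{x..y}. g t)" using assms that by (auto simp: ac_on_def)
    then show ?thesis using set_integral_sq_le[OF assms(2) that(1)] by simp
  qed
  show ?thesis
    using *[of x y] *[of y x] assms by (cases "x \<le> y") (auto simp: power2_commute)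
qed

lemma ac_on_continuous:
  assumes "ac_on J f g" "sq_int g"
  shows "continuous_on J f"
  unfolding continuous_on
proof
  fix x assume x: "x \<in> J"
  define G where "G = (LBINT t. (g t)\<^sup>2)"
  have "((\<lambda>y. sqrt (\<bar>y - x\<bar> * G)) \<longlongrightarrow> sqrt (\<bar>x - x\<bar> * G)) (at x within J)"
    by (intro tendsto_intros)
  then have lim: "((\<lambda>y. sqrt (\<bar>y - x\<bar> * G)) \<longlongrightarrow> 0) (at x within J)" by simp
  have "\<bar>f y - f x\<bar> \<le> sqrt (\<bar>y - x\<bar> * G)" if "y \<in> J" for y
    using ac_on_Holder[OF assms that x] unfolding G_def
    by (metis power2_abs real_le_rsqrt)
  then have "((\<lambda>y. f y - f x) \<longlongrightarrow> 0) (at x within J)"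
    by (intro Lim_null_comparison[OF _ lim]) (auto simp: eventually_at_filter)
  then show "(f \<longlongrightarrow> f x) (at x within J)" by (simp add: LIM_zero_iff)
qed

lemma h1_fun_continuous: "h1_fun f g \<Longrightarrow> continuous_on UNIV f"
  using ac_on_continuous by (auto simp: h1_fun_def)

text \<open>By the Hoelder bound, the value at \<open>x\<close> is controlled by each value on a
  unit interval within distance \<open>L\<close>; averaging over that interval introduces no factor
  because its length is 1.\<close>

lemma h1_fun_average:
  assumes h: "h1_fun f g" and "x - L \<le> c" "c + 1 \<le> x + L"
  shows "(f x)\<^sup>2 \<le> 2 * (LBINT t:{c..c+1}. (f t)\<^sup>2) + 2 * L * (LBINT t. (g t)\<^sup>2)"
proof -
  define G where "G = (LBINT t. (g t)\<^sup>2)"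
  have G: "G \<ge> 0" by (simp add: G_def)
  have pw: "(f x)\<^sup>2 \<le> 2 * (f y)\<^sup>2 + 2 * L * G" if "y \<in> {c..c+1}" for y
  proof -
    have "(f x - f y)\<^sup>2 \<le> \<bar>x - y\<bar> * G"
      using ac_on_Holder[of UNIV f g x y] h by (auto simp: h1_fun_def G_def)
    also have "\<dots> \<le> L * G" using that assms G by (intro mult_right_mono) auto
    finally have "(f x - f y)\<^sup>2 \<le> L * G" .
    moreover have "(f x)\<^sup>2 \<le> 2 * (f y)\<^sup>2 + 2 * (f x - f y)\<^sup>2"
      using zero_le_power2[of "f x - 2 * f y"] by (simp add: power2_eq_square algebra_simps)
    ultimately show ?thesis by linarith
  qed
  have cont: "continuous_on {c..c+1} f"
    using h1_fun_continuous[OF h] continuous_on_subset by blast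
  have "(LBINT t:{c..c+1}. (f x)\<^sup>2) \<le> (LBINT t:{c..c+1}. 2 * (f t)\<^sup>2 + 2 * L * G)"
    by (intro set_integral_mono borel_integrable_atLeastAtMost' continuous_intros cont pw)
  also have "(LBINT t:{c..c+1}. 2 * (f t)\<^sup>2 + 2 * L * G)
      = (LBINT t:{c..c+1}. 2 * (f t)\<^sup>2) + (LBINT t:{c..c+1}. 2 * L * G)"
    by (intro set_integral_add borel_integrable_atLeastAtMost' continuous_intros cont)
  also have "(LBINT t:{c..c+1}. 2 * L * G) = 2 * L * G"
    unfolding set_lebesgue_integral_def by simp
  also have "(LBINT t:{c..c+1}. (f x)\<^sup>2) = (f x)\<^sup>2"
    unfolding set_lebesgue_integral_def by simp
  finally show ?thesis by (simp add: G_def)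
qed

text \<open>Averaging over a unit interval on which \<open>\<bar>t\<bar> \<ge> 1\<close> lets the weight \<open>\<bar>t\<bar>\<^sup>m\<close> replace the
  constant weight; this is where the spectral gap of the confining operators comes from.\<close>

lemma h1_fun_weighted_sup:
  assumes h: "h1_fun f g" and i: "integrable lborel (\<lambda>t. \<bar>t\<bar> powr m * (f t)\<^sup>2)" and m: "m \<ge> 0"
  shows "(f x)\<^sup>2 \<le> 4 * ((LBINT t. (g t)\<^sup>2) + (LBINT t. \<bar>t\<bar> powr m * (f t)\<^sup>2))"
proof -
  \<comment> \<open>A unit interval on the same side of 0 as \<open>x\<close>, inside the region of
    absolute value at least 1 and within distance 2 of \<open>x\<close>; this 2 yields the constant
    4.\<close>
  define c where "c = (if x \<ge> 0 then max x 1 else min x (-1) - 1)"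
  have cont: "continuous_on {c..c+1} f"
    using h1_fun_continuous[OF h] continuous_on_subset by blast
  have "(f x)\<^sup>2 \<le> 2 * (LBINT t:{c..c+1}. (f t)\<^sup>2) + 2 * 2 * (LBINT t. (g t)\<^sup>2)"
    by (rule h1_fun_average[OF h]) (auto simp: c_def)
  also have "(LBINT t:{c..c+1}. (f t)\<^sup>2) \<le> (LBINT t. \<bar>t\<bar> powr m * (f t)\<^sup>2)"
    unfolding set_lebesgue_integral_def
  proof (rule integral_mono)
    show "integrable lborel (\<lambda>t. indicator {c..c+1} t *\<^sub>R (f t)\<^sup>2)"
      using borel_integrable_atLeastAtMost'[OF continuous_on_power[OF cont, of 2]]
      by (simp add: set_integrable_def)
    show "indicator {c..c+1} t *\<^sub>R (f t)\<^sup>2 \<le> \<bar>t\<bar> powr m * (f t)\<^sup>2" for t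
    proof (cases "t \<in> {c..c+1}")
      case True
      then have "\<bar>t\<bar> \<ge> 1" by (auto simp: c_def split: if_splits)
      then have "\<bar>t\<bar> powr m \<ge> 1" using m by (rule ge_one_powr_ge_zero)
      then show ?thesis using mult_right_mono[of 1 "\<bar>t\<bar> powr m" "(f t)\<^sup>2"] True by simp
    qed auto
  qed (rule i)
  moreover have "(LBINT t. \<bar>t\<bar> powr m * (f t)\<^sup>2) \<ge> 0" by simp
  ultimately show ?thesis by argo
qed

text \<open>Outside [-1, 1] the weight is at least 1 and dominates the integrand; inside, the sup
  bound is integrated over length 2. The contributions 8 and 1 give the constant 9.\<close>

lemma h1_fun_weighted_norm:
  assumes h: "h1_fun f g" and i: "integrable lborel (\<lambda>t. \<bar>t\<bar> powr m * (f t)\<^sup>2)" and m: "m \<ge> 0"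
  shows "(LBINT t. (f t)\<^sup>2) \<le> 9 * ((LBINT t. (g t)\<^sup>2) + (LBINT t. \<bar>t\<bar> powr m * (f t)\<^sup>2))"
    (is "_ \<le> 9 * ?E")
proof -
  have I: "integrable lborel (\<lambda>t. indicator {-1..1::real} t * (4 * ?E))"
    by (intro integrable_mult_left integrable_real_indicator) (auto simp: emeasure_lborel_Icc_eq)
  have "(LBINT t. (f t)\<^sup>2) \<le> (LBINT t. indicator {-1..1} t * (4 * ?E) + \<bar>t\<bar> powr m * (f t)\<^sup>2)"
  proof (rule integral_mono)
    show "integrable lborel (\<lambda>t. (f t)\<^sup>2)" using h by (simp add: h1_fun_def sq_int_def)
    show "integrable lborel (\<lambda>t. indicator {-1..1} t * (4 * ?E) + \<bar>t\<bar> powr m * (f t)\<^sup>2)"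
      by (intro Bochner_Integration.integrable_add I i)
    show "(f t)\<^sup>2 \<le> indicator {-1..1} t * (4 * ?E) + \<bar>t\<bar> powr m * (f t)\<^sup>2" for t
    proof (cases "t \<in> {-1..1}")
      case True
      then show ?thesis using h1_fun_weighted_sup[OF assms, of t] by (simp add: add_increasing2)
    next
      case False
      then have "\<bar>t\<bar> \<ge> 1" by auto
      then have "\<bar>t\<bar> powr m \<ge> 1" using m by (rule ge_one_powr_ge_zero)
      then show ?thesis using mult_right_mono[of 1 "\<bar>t\<bar> powr m" "(f t)\<^sup>2"] False by simp
    qed
  qed
  also have "\<dots> = 8 * ?E + (LBINT t. \<bar>t\<bar> powr m * (f t)\<^sup>2)"
    by (subst Bochner_Integration.integral_add[OF I i]) simp
  also have "\<dots> \<le> 9 * ?E"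
    by simp
  finally show ?thesis .
qed

section \<open>Uniqueness of continuous representatives and of their derivatives\<close>

lemma continuous_AE_zero_Icc:
  fixes k :: "real \<Rightarrow> real"
  assumes "l < r" and k: "continuous_on {l..r} k" and ae: "AE x in lborel. x \<in> {l..r} \<longrightarrow> k x = 0"
    and x: "x \<in> {l..r}"
  shows "k x = 0"
proof -
  have *: "k z = 0" if "z \<in> {l<..<r}" for z
  proof -
    \<comment> \<open>The zero set is closed and has full measure in the open interval, so it
      contains that interval; the endpoints follow by continuity.\<close>
    have "z \<in> {x \<in> {l..r}. k x = 0}"
    proof (rule mem_closed_if_AE_lebesgue_open[of "{l<..<r}"])
      show "closed {x \<in> {l..r}. k x = 0}"
        by (rule continuous_closed_preimage_constant[OF k]) simp
      have "AE x in lebesgue. x \<in> {l..r} \<longrightarrow> k x = 0" by (rule AE_completion[OF ae])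
      then show "AE x\<in>{l<..<r} in lebesgue. x \<in> {x \<in> {l..r}. k x = 0}"
        by eventually_elim auto
    qed (use that in auto)
    then show ?thesis by simp
  qed
  have cl: "closure {l<..<r} = {l..r}" using assms(1) by simp
  show ?thesis
    by (rule continuous_constant_on_closure[of "{l<..<r}" k 0 x]) (use * k x cl in auto)
qed

text \<open>The measures whose densities are the positive and the negative part of \<open>d\<close>
  on the interval agree on all half-lines, hence everywhere, and equal measures have a.e. equal
  densities.\<close>

lemma AE_zero_if_integrals_zero:
  assumes d: "sq_int d" and "l \<le> r"
    and z: "\<And>x y. l \<le> x \<Longrightarrow> x \<le> y \<Longrightarrow> y \<le> r \<Longrightarrow> (LBINT t:{x..y}. d t) = 0"
  shows "AE x in lborel. x \<in> {l..r} \<longrightarrow> d x = 0"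
proof -
  note [measurable] = sq_int_measurable[OF d]
  define D where "D t = indicator {l..r} t * d t" for t
  have [measurable]: "D \<in> borel_measurable borel" unfolding D_def by measurable
  have D: "integrable lborel D"
    using sq_int_set_integrable[OF d, of l r] by (simp add: D_def[abs_def] set_integrable_def)
  have Dx: "integrable lborel (\<lambda>t. indicator {x<..} t * D t)" for x
    by (rule Bochner_Integration.integrable_bound[OF D]) (auto split: split_indicator)
  have zero: "(LBINT t. indicator {x<..} t * D t) = 0" for x
  proof (cases "x < r")
    case True
    \<comment> \<open>The half-line excludes \<open>x\<close> and \<open>{max x l..r}\<close> may
      include it; a single point is negligible.\<close>
    have "AE t in lborel. t \<noteq> x" by (rule AE_lborel_singleton)
    then have "AE t in lborel. indicator {x<..} t * D t = indicator {max x l..r} t *\<^sub>R d t"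
      by eventually_elim (auto simp: D_def split: split_indicator)
    then have "(LBINT t. indicator {x<..} t * D t) = (LBINT t:{max x l..r}. d t)"
      unfolding set_lebesgue_integral_def by (intro integral_cong_AE) auto
    also have "\<dots> = 0" using True assms(2) by (intro z) auto
    finally show ?thesis .
  next
    case False
    then have "(\<lambda>t. indicator {x<..} t * D t) = (\<lambda>t. 0)"
      by (auto simp: D_def fun_eq_iff split: split_indicator)
    then show ?thesis by simp
  qed
  have fin: "(\<integral>\<^sup>+t. ennreal (c * D t) * indicator {x<..} t \<partial>lborel) < \<infinity>" if "\<bar>c\<bar> = 1" for c x
  proof -
    have "(\<integral>\<^sup>+t. ennreal (c * D t) * indicator {x<..} t \<partial>lborel) \<le> (\<integral>\<^sup>+t. ennreal (norm (D t)) \<partial>lborel)"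
      using that by (intro nn_integral_mono)
        (auto split: split_indicator intro!: ennreal_leI simp: abs_mult_pos intro: order_trans[OF abs_ge_self] simp: abs_mult)
    also have "\<dots> < \<infinity>" using D by (simp add: integrable_iff_bounded)
    finally show ?thesis .
  qed
  \<comment> \<open>Since \<open>ennreal\<close> truncates at 0, \<open>P\<close> and
    \<open>N\<close> carry the positive and the negative part of \<open>D\<close>.\<close>
  define P where "P = density lborel (\<lambda>t. ennreal (1 * D t))"
  define N where "N = density lborel (\<lambda>t. ennreal (-1 * D t))"
  have "P = N"
  proof (rule measure_eqI_lessThan)
    show "emeasure P {x<..} < \<infinity>" for x
      using fin[of 1 x] unfolding P_def by (subst emeasure_density) auto
    show "emeasure P {x<..} = emeasure N {x<..}" for x
    proof -
      define p where "p = (\<integral>\<^sup>+t. ennreal (indicator {x<..} t * D t) \<partial>lborel)"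
      define n where "n = (\<integral>\<^sup>+t. ennreal (- (indicator {x<..} t * D t)) \<partial>lborel)"
      have p: "emeasure P {x<..} = p" unfolding P_def p_def
        by (subst emeasure_density) (auto intro!: nn_integral_cong split: split_indicator)
      have n: "emeasure N {x<..} = n" unfolding N_def n_def
        by (subst emeasure_density) (auto intro!: nn_integral_cong split: split_indicator)
      have "p < \<infinity>" using fin[of 1 x] p unfolding P_def by (subst (asm) emeasure_density) auto
      moreover have "n < \<infinity>" using fin[of "-1" x] n unfolding N_def by (subst (asm) emeasure_density) auto
      moreover have "enn2real p - enn2real n = 0"
        using real_lebesgue_integral_def[OF Dx[of x]] zero[of x] by (simp add: p_def n_def)
      ultimately show ?thesis using p n
        by (metis ennreal_enn2real eq_iff_diff_eq_0 infinity_ennreal_def)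
    qed
  qed (auto simp: P_def N_def)
  then have "AE t in lborel. ennreal (1 * D t) = ennreal (-1 * D t)"
    unfolding P_def N_def by (intro sigma_finite_measure.density_unique_iff[OF lborel.sigma_finite_measure_axioms, THEN iffD1]) auto
  then show ?thesis
  proof eventually_elim
    case (elim t)
    \<comment> \<open>Whatever the sign of \<open>D t\<close>, one of the two truncations is 0, so
      their equality leaves no other value.\<close>
    then have "D t = 0"
      by (cases "D t \<ge> 0") (auto simp: ennreal_neg ennreal_eq_0_iff eq_commute[of 0])
    then show ?case by (auto simp: D_def)
  qed
qed

lemma ac_on_unique_Icc:
  assumes "l < r" and f: "ac_on {l..r} f g" "sq_int g" and f': "ac_on {l..r} f' g'" "sq_int g'"
    and ae: "AE x in lborel. x \<in> {l..r} \<longrightarrow> f x = f' x"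
  shows "\<And>x. x \<in> {l..r} \<Longrightarrow> f x = f' x" and "AE x in lborel. x \<in> {l..r} \<longrightarrow> g x = g' x"
proof -
  have eq: "f x = f' x" if "x \<in> {l..r}" for x
  proof -
    have "f x - f' x = 0"
    proof (rule continuous_AE_zero_Icc[OF \<open>l < r\<close>, where k = "\<lambda>x. f x - f' x"])
      show "continuous_on {l..r} (\<lambda>x. f x - f' x)"
        by (intro continuous_intros ac_on_continuous[OF f] ac_on_continuous[OF f'])
      show "AE x in lborel. x \<in> {l..r} \<longrightarrow> f x - f' x = 0" using ae by eventually_elim auto
    qed (rule that)
    then show ?thesis by simp
  qed
  then show "\<And>x. x \<in> {l..r} \<Longrightarrow> f x = f' x" .
  have "AE x in lborel. x \<in> {l..r} \<longrightarrow> g x - g' x = 0"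
  proof (rule AE_zero_if_integrals_zero)
    show "sq_int (\<lambda>x. g x - g' x)" by (rule sq_int_diff[OF f(2) f'(2)])
    show "l \<le> r" using assms by simp
    fix x y assume xy: "l \<le> x" "x \<le> y" "y \<le> r"
    then have "f y - f x = (LBINT t:{x..y}. g t)" "f' y - f' x = (LBINT t:{x..y}. g' t)"
      using f f' by (auto simp: ac_on_def)
    then show "(LBINT t:{x..y}. g t - g' t) = 0"
      using eq[of x] eq[of y] xy
      by (subst set_integral_diff(2)) (auto intro!: sq_int_set_integrable f f')
  qed
  then show "AE x in lborel. x \<in> {l..r} \<longrightarrow> g x = g' x" by eventually_elim auto
qed

lemma ac_on_unique_UNIV:
  assumes "ac_on UNIV f g" "sq_int g" "ac_on UNIV f' g'" "sq_int g'" "AE x in lborel. f x = f' x"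
  shows "AE x in lborel. g x = g' x"
proof -
  \<comment> \<open>Bounded intervals exhaust the line; \<open>Suc n\<close> keeps the first of them
    nondegenerate, as uniqueness on an interval requires.\<close>
  have "AE x in lborel. \<forall>n::nat. x \<in> {- real (Suc n)..real (Suc n)} \<longrightarrow> g x = g' x"
  proof (subst AE_all_countable, rule allI)
    fix n :: nat
    show "AE x in lborel. x \<in> {- real (Suc n)..real (Suc n)} \<longrightarrow> g x = g' x"
    proof (rule ac_on_unique_Icc(2))
      show "AE x in lborel. x \<in> {- real (Suc n)..real (Suc n)} \<longrightarrow> f x = f' x"
        using assms(5) by eventually_elim auto
    qed (use assms in \<open>auto intro: ac_on_subset\<close>)
  qed
  then show ?thesis
  proof eventually_elim
    case (elim x)
    obtain n where "\<bar>x\<bar> \<le> real n" using real_arch_simple by blast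
    then have "x \<in> {- real (Suc n)..real (Suc n)}" by auto
    then show ?case using elim by blast
  qed
qed

section \<open>Sobolev classes and their representatives on the whole line\<close>

lemma h1_fun_abs:
  assumes "h1_fun f g"
  shows "ac_rep UNIV (abs_L2R f) (abs_L2R g) f"
proof -
  have f: "sq_int f" and g: "sq_int g" using assms by (auto simp: h1_fun_def)
  note [measurable] = sq_int_measurable[OF g]
  have "(LBINT t:{x..y}. rep_L2R (abs_L2R g) t) = (LBINT t:{x..y}. g t)" for x y
    by (rule set_lebesgue_integral_cong_AE) (use rep_abs_AE[OF g] in auto)
  then show ?thesis
    using assms rep_abs_AE[OF f] by (auto simp: ac_rep_def L2_on_def h1_fun_def ac_on_def)
qed

lemma ac_rep_UNIV_imp_h1_fun:
  assumes "ac_rep UNIV u g f"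
  shows "h1_fun f (rep_L2R g)" and "abs_L2R f = u"
proof -
  have ac: "ac_on UNIV f (rep_L2R g)" using assms by (simp add: ac_rep_def ac_on_def)
  have [measurable]: "f \<in> borel_measurable borel"
    by (intro borel_measurable_continuous_onI ac_on_continuous[OF ac]) simp
  have ae: "AE x in lborel. rep_L2R u x = f x" using assms by (simp add: ac_rep_def)
  have f: "sq_int f" by (rule sq_int_cong_AE[OF sq_int_rep _ ae]) simp
  show "h1_fun f (rep_L2R g)" using ac f by (simp add: h1_fun_def)
  show "abs_L2R f = u" using abs_L2R_eq_iff[OF f sq_int_rep[of u]] ae by (auto elim: eventually_mono)
qed

lemma H1_UNIV_iff: "u \<in> H1 UNIV \<longleftrightarrow> (\<exists>f g. h1_fun f g \<and> u = abs_L2R f)"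
  using h1_fun_abs ac_rep_UNIV_imp_h1_fun unfolding H1_def by blast

lemma weak_deriv_UNIV:
  assumes "h1_fun f g"
  shows "weak_deriv UNIV (abs_L2R f) = abs_L2R g"
  unfolding weak_deriv_def
proof (rule the_equality)
  show "\<exists>f'. ac_rep UNIV (abs_L2R f) (abs_L2R g) f'" using h1_fun_abs[OF assms] by blast
  fix k assume "\<exists>f'. ac_rep UNIV (abs_L2R f) k f'"
  then obtain f' where f': "ac_rep UNIV (abs_L2R f) k f'" by blast
  from ac_rep_UNIV_imp_h1_fun[OF this] have h: "h1_fun f' (rep_L2R k)" "abs_L2R f' = abs_L2R f" by auto
  have "AE x in lborel. rep_L2R k x = g x"
  proof (rule ac_on_unique_UNIV)
    show "AE x in lborel. f' x = f x"
      using h assms abs_L2R_eq_iff[of f' f] by (simp add: h1_fun_def)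
  qed (use h assms in \<open>auto simp: h1_fun_def\<close>)
  then show "k = abs_L2R g"
    using abs_L2R_eq_iff[of "rep_L2R k" g] assms by (simp add: h1_fun_def)
qed

lemma weak_deriv_Icc:
  assumes "l < r" and u: "ac_rep {l..r} u g f"
  shows "weak_deriv {l..r} u = g"
  unfolding weak_deriv_def
proof (rule the_equality)
  show "\<exists>f. ac_rep {l..r} u g f" using u by blast
  fix k assume "\<exists>f. ac_rep {l..r} u k f"
  then obtain f' where f': "ac_rep {l..r} u k f'" by blast
  have "AE x in lborel. x \<in> {l..r} \<longrightarrow> rep_L2R k x = rep_L2R g x"
  proof (rule ac_on_unique_Icc(2)[OF \<open>l < r\<close>])
    show "ac_on {l..r} f' (rep_L2R k)" "ac_on {l..r} f (rep_L2R g)"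
      using u f' by (auto simp: ac_rep_def ac_on_def)
    have "AE x in lborel. x \<in> {l..r} \<longrightarrow> rep_L2R u x = f x"
      "AE x in lborel. x \<in> {l..r} \<longrightarrow> rep_L2R u x = f' x"
      using u f' by (auto simp: ac_rep_def)
    then show "AE x in lborel. x \<in> {l..r} \<longrightarrow> f' x = f x" by eventually_elim auto
  qed auto
  moreover have "AE x in lborel. x \<notin> {l..r} \<longrightarrow> rep_L2R k x = 0"
    "AE x in lborel. x \<notin> {l..r} \<longrightarrow> rep_L2R g x = 0"
    using u f' by (auto simp: ac_rep_def L2_on_def)
  ultimately have "AE x in lborel. rep_L2R k x = rep_L2R g x" by eventually_elim auto
  then show "k = g" by (rule L2R_eqI)
qed

text \<open>Zero boundary values are what makes the extension by 0 absolutely continuous across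
  \<open>l\<close> and \<open>r\<close>, with the derivative extended by 0 as well. All estimates
  can then be made on the whole line.\<close>

lemma H10_imp_h1_fun:
  assumes "l < r" and "u \<in> H10 l r"
  obtains f g where "h1_fun f g" "\<And>x. x \<notin> {l<..<r} \<Longrightarrow> f x = 0" "\<And>x. x \<notin> {l..r} \<Longrightarrow> g x = 0"
    "u = abs_L2R f" "weak_deriv {l..r} u = abs_L2R g"
proof -
  from assms(2) obtain k p where kp: "ac_rep {l..r} u k p" "p l = 0" "p r = 0"
    unfolding H10_def by blast
  define f where "f x = (if x \<in> {l..r} then p x else 0)" for x
  define g where "g x = indicator {l..r} x * rep_L2R k x" for x
  have g: "sq_int g" unfolding g_def by (intro sq_int_indicator) auto
  have k: "abs_L2R g = k"
  proof -
    have "AE x in lborel. x \<notin> {l..r} \<longrightarrow> rep_L2R k x = 0"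
      using kp by (simp add: ac_rep_def L2_on_def)
    then have "AE x in lborel. g x = rep_L2R k x"
      by eventually_elim (auto simp: g_def split: split_indicator)
    then show ?thesis using abs_L2R_eq_iff[OF g sq_int_rep[of k]] by simp
  qed
  have "ac_rep UNIV u k f"
    unfolding ac_rep_def
  proof (intro conjI ballI impI)
    have "AE x in lborel. x \<notin> {l..r} \<longrightarrow> rep_L2R u x = 0"
      "AE x in lborel. x \<in> {l..r} \<longrightarrow> rep_L2R u x = p x"
      using kp by (auto simp: ac_rep_def L2_on_def)
    then show "AE x in lborel. x \<in> UNIV \<longrightarrow> rep_L2R u x = f x"
      by eventually_elim (auto simp: f_def)
    fix x y :: real assume "x \<le> y"
    have k0: "AE x in lborel. x \<notin> {l..r} \<longrightarrow> rep_L2R k x = 0"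
      using kp by (simp add: ac_rep_def L2_on_def)
    show "f y - f x = (LBINT t:{x..y}. rep_L2R k t)"
    proof (cases "y < l \<or> r < x")
      case True
      then have "f y - f x = 0" using \<open>x \<le> y\<close> by (auto simp: f_def)
      moreover have "(LBINT t:{x..y}. rep_L2R k t) = (LBINT t:{x..y}. 0)"
        by (rule set_lebesgue_integral_cong_AE)
          (use True \<open>x \<le> y\<close> k0 in \<open>auto elim!: eventually_mono\<close>)
      ultimately show ?thesis by simp
    next
      case False
      \<comment> \<open>Only the part of [x, y] inside [l, r] contributes. Clamping an outer point
        to an endpoint keeps the value of \<open>f\<close> because \<open>p\<close> vanishes
        there.\<close>
      define x' y' where "x' = max x l" and "y' = min y r"
      have xy: "l \<le> x'" "x' \<le> y'" "y' \<le> r" using False \<open>x \<le> y\<close> \<open>l < r\<close> by (auto simp: x'_def y'_def)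
      have "f x = p x'" "f y = p y'" using False \<open>x \<le> y\<close> kp by (auto simp: f_def x'_def y'_def max_def min_def)
      moreover have "p y' - p x' = (LBINT t:{x'..y'}. rep_L2R k t)"
        using kp(1) xy by (auto simp: ac_rep_def)
      moreover have "(LBINT t:{x'..y'}. rep_L2R k t) = (LBINT t:{x..y}. rep_L2R k t)"
        unfolding set_lebesgue_integral_def
        by (intro integral_cong_AE)
          (use k0 in \<open>auto elim!: eventually_mono simp: x'_def y'_def split: split_indicator\<close>)
      ultimately show ?thesis by simp
    qed
  qed (auto simp: L2_on_def)
  from ac_rep_UNIV_imp_h1_fun[OF this] have f: "h1_fun f (rep_L2R k)" "abs_L2R f = u" by auto
  have "h1_fun f g"
  proof -
    have "AE x in lborel. g x = rep_L2R k x" using abs_L2R_eq_iff[OF g sq_int_rep[of k]] k by simp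
    then have "(LBINT t:{x..y}. g t) = (LBINT t:{x..y}. rep_L2R k t)" for x y
      by (intro set_lebesgue_integral_cong_AE) (auto simp: sq_int_measurable[OF g] elim: eventually_mono)
    then show ?thesis using f g by (simp add: h1_fun_def ac_on_def)
  qed
  moreover have "f x = 0" if "x \<notin> {l<..<r}" for x
    using that kp \<open>l < r\<close> by (cases "x = l"; cases "x = r") (auto simp: f_def)
  moreover have "g x = 0" if "x \<notin> {l..r}" for x using that by (simp add: g_def)
  moreover have "weak_deriv {l..r} u = abs_L2R g"
    using weak_deriv_Icc[OF \<open>l < r\<close> kp(1)] k by simp
  ultimately show ?thesis using that f(2) by blast
qed

text \<open>Converse of the extension by zero: off the interval all integrals of \<open>g\<close>
  are differences of zeros, so \<open>g\<close> vanishes a.e. there, and the derivatives on [l, r]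
  and on the line are the same class.\<close>

lemma h1_fun_imp_H10:
  assumes f: "h1_fun f g" and z: "\<And>x. x \<notin> {l<..<r} \<Longrightarrow> f x = 0" and "l < r"
  shows "abs_L2R f \<in> H10 l r"
    and "AE x in lborel. x \<notin> {l..r} \<longrightarrow> g x = 0"
    and "weak_deriv {l..r} (abs_L2R f) = abs_L2R g"
proof -
  have sq: "sq_int f" "sq_int g" using f by (auto simp: h1_fun_def)
  have ae: "AE x in lborel. x \<in> {p..q} \<longrightarrow> g x = 0" if "p < q" "{p..q} \<inter> {l<..<r} = {}" for p q
  proof (rule AE_zero_if_integrals_zero[OF sq(2)])
    fix x y assume xy: "p \<le> x" "x \<le> y" "y \<le> q"
    have "f y - f x = (LBINT t:{x..y}. g t)" using f xy by (auto simp: h1_fun_def ac_on_def)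
    moreover have "x \<in> {p..q}" "y \<in> {p..q}" using xy by auto
    then have "x \<notin> {l<..<r}" "y \<notin> {l<..<r}" using that by blast+
    ultimately show "(LBINT t:{x..y}. g t) = 0" using z by simp
  qed (use that in auto)
  have "AE x in lborel. \<forall>n::nat. (x \<in> {r..r + real (Suc n)} \<longrightarrow> g x = 0) \<and> (x \<in> {l - real (Suc n)..l} \<longrightarrow> g x = 0)"
    unfolding AE_all_countable AE_conj_iff by (intro allI conjI ae) (use \<open>l < r\<close> in auto)
  then show g0: "AE x in lborel. x \<notin> {l..r} \<longrightarrow> g x = 0"
  proof eventually_elim
    case (elim x)
    obtain n where "\<bar>x\<bar> + \<bar>l\<bar> + \<bar>r\<bar> \<le> real n" using real_arch_simple by blast
    then have "x \<in> {r..r + real (Suc n)} \<or> x \<in> {l - real (Suc n)..l}" if "x \<notin> {l..r}" using that by auto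
    then show ?case using elim by blast
  qed
  have u: "ac_rep {l..r} (abs_L2R f) (abs_L2R g) f"
    using h1_fun_abs[OF f] g0 rep_abs_AE[OF sq(1)] rep_abs_AE[OF sq(2)] z
    by (auto simp: ac_rep_def L2_on_def elim!: eventually_elim2)
  then show "abs_L2R f \<in> H10 l r" using z unfolding H10_def by auto
  show "weak_deriv {l..r} (abs_L2R f) = abs_L2R g" by (rule weak_deriv_Icc[OF \<open>l < r\<close> u])
qed

section \<open>The product rule for a continuously differentiable factor\<close>

lemma integrable_prod_mult:
  fixes a b :: "real \<Rightarrow> real"
  assumes a: "integrable lborel a" and b: "integrable lborel b"
  shows "integrable (lborel \<Otimes>\<^sub>M lborel) (\<lambda>(t, s). a t * b s)"
proof (rule lborel_pair.Fubini_integrable)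
  have [measurable]: "a \<in> borel_measurable borel" "b \<in> borel_measurable borel" using a b by auto
  show "(\<lambda>(t, s). a t * b s) \<in> borel_measurable (lborel \<Otimes>\<^sub>M lborel)" by measurable
  show "integrable lborel (\<lambda>x. LBINT y. norm (case (x, y) of (t, s) \<Rightarrow> a t * b s))"
    using a by (simp add: abs_mult)
  show "AE x in lborel. integrable lborel (\<lambda>y. case (x, y) of (t, s) \<Rightarrow> a t * b s)"
    using b by simp
qed

lemma DERIV_borel_measurable:
  assumes "\<And>x. (\<phi> has_real_derivative \<psi> x) (at x)"
  shows "\<phi> \<in> borel_measurable borel"
  using assms by (intro borel_measurable_continuous_onI DERIV_continuous_on) (auto intro: DERIV_subset)

lemma continuous_bounded_Icc:
  fixes f :: "real \<Rightarrow> real"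
  assumes "continuous_on {l..r} f"
  obtains K where "\<And>x. x \<in> {l..r} \<Longrightarrow> \<bar>f x\<bar> \<le> K"
  using compact_imp_bounded[OF compact_continuous_image[OF assms]]
  unfolding bounded_iff by (metis compact_Icc imageI real_norm_def)

text \<open>The product rule is Fubini's theorem on the triangle \<open>x \<le> t \<le> s \<le> y\<close>.\<close>

lemma ac_on_mult_C1:
  assumes f: "ac_on UNIV f g" "sq_int g"
    and \<phi>: "\<And>x. (\<phi> has_real_derivative \<psi> x) (at x)" and \<psi>: "continuous_on UNIV \<psi>"
  shows "ac_on UNIV (\<lambda>x. \<phi> x * f x) (\<lambda>x. \<phi> x * g x + \<psi> x * f x)"
  unfolding ac_on_def
proof (intro ballI impI)
  fix x y :: real assume "x \<le> y"
  have [measurable]: "g \<in> borel_measurable borel" using f(2) by (rule sq_int_measurable)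
  have [measurable]: "\<psi> \<in> borel_measurable borel" using \<psi> by (rule borel_measurable_continuous_onI)
  have cf: "continuous_on UNIV f" using ac_on_continuous[OF f] .
  have c\<phi>: "continuous_on UNIV \<phi>" using \<phi> by (intro DERIV_continuous_on) (auto intro: DERIV_subset)
  have Icc: "continuous_on {p..q} k" if "continuous_on UNIV k" for p q :: real and k :: "real \<Rightarrow> real"
    using that continuous_on_subset by blast
  have [measurable]: "\<phi> \<in> borel_measurable borel" "f \<in> borel_measurable borel"
    using cf c\<phi> by (auto intro: borel_measurable_continuous_onI)
  define a where "a t = indicator {x..y} t * g t" for t
  define b where "b s = indicator {x..y} s * \<psi> s" for s
  have [measurable]: "a \<in> borel_measurable borel" "b \<in> borel_measurable borel"
    unfolding a_def b_def by measurable
  have a: "integrable lborel a"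
    using sq_int_set_integrable[OF f(2), of x y] by (simp add: set_integrable_def a_def[abs_def])
  have b: "integrable lborel b"
    using borel_integrable_atLeastAtMost'[OF Icc[OF \<psi>], of x y] by (simp add: set_integrable_def b_def[abs_def])
  define F where "F t s = (if t \<le> s then a t * b s else 0)" for t s
  have F: "integrable (lborel \<Otimes>\<^sub>M lborel) (case_prod F)"
  proof (rule Bochner_Integration.integrable_bound[OF integrable_prod_mult[OF a b]])
    show "case_prod F \<in> borel_measurable (lborel \<Otimes>\<^sub>M lborel)" unfolding F_def by measurable
    show "AE z in lborel \<Otimes>\<^sub>M lborel. norm (case_prod F z) \<le> norm (case z of (t, s) \<Rightarrow> a t * b s)"
      by (auto simp: F_def)
  qed
  have inner1: "(LBINT t. F t s) = b s * (f s - f x)" for s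
  proof (cases "s \<in> {x..y}")
    case True
    have "(LBINT t. F t s) = (LBINT t. b s * (indicator {x..s} t * g t))"
      by (rule Bochner_Integration.integral_cong) (use True in \<open>auto simp: F_def a_def split: split_indicator\<close>)
    also have "\<dots> = b s * (LBINT t:{x..s}. g t)" by (simp add: set_lebesgue_integral_def)
    also have "(LBINT t:{x..s}. g t) = f s - f x" using f True by (auto simp: ac_on_def)
    finally show ?thesis .
  next
    case False
    then have "b s = 0" by (simp add: b_def)
    then have "(\<lambda>t. F t s) = (\<lambda>_. 0)" by (auto simp: F_def)
    then show ?thesis using \<open>b s = 0\<close> by simp
  qed
  have FTC: "(LBINT s. \<psi> s * indicator {p..q} s) = \<phi> q - \<phi> p" if "p \<le> q" for p q
    using that \<phi> \<psi> by (intro integral_FTC_Icc_real) (auto simp: continuous_on_eq_continuous_at)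
  have inner2: "(LBINT s. F t s) = a t * (\<phi> y - \<phi> t)" for t
  proof (cases "t \<in> {x..y}")
    case True
    have "(LBINT s. F t s) = (LBINT s. a t * (\<psi> s * indicator {t..y} s))"
      by (rule Bochner_Integration.integral_cong) (use True in \<open>auto simp: F_def b_def split: split_indicator\<close>)
    also have "\<dots> = a t * (\<phi> y - \<phi> t)" using FTC[of t y] True by simp
    finally show ?thesis .
  next
    case False
    then have "a t = 0" by (simp add: a_def)
    then have "(\<lambda>s. F t s) = (\<lambda>_. 0)" by (auto simp: F_def)
    then show ?thesis using \<open>a t = 0\<close> by simp
  qed
  \<comment> \<open>Equality of the two iterated integrals is integration by parts; what remains is
    to multiply out the constants \<open>f x\<close> and \<open>\<phi> y\<close>.\<close>
  have eq: "(LBINT s. b s * (f s - f x)) = (LBINT t. a t * (\<phi> y - \<phi> t))"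
    using lborel_pair.Fubini_integral[OF F] by (simp add: inner1 inner2)
  have i1: "integrable lborel (\<lambda>s. b s * f s)"
    using borel_integrable_atLeastAtMost'[OF continuous_on_mult[OF Icc[OF \<psi>] Icc[OF cf]], of x y]
    by (simp add: set_integrable_def b_def mult.assoc)
  have i2: "integrable lborel (\<lambda>t. a t * \<phi> t)"
  proof -
    obtain K where K: "\<And>t. t \<in> {x..y} \<Longrightarrow> \<bar>\<phi> t\<bar> \<le> K"
      using continuous_bounded_Icc[OF Icc[OF c\<phi>]] by blast
    show ?thesis
    proof (rule Bochner_Integration.integrable_bound)
      show "integrable lborel (\<lambda>t. K * a t)" using a by simp
      have "\<bar>a t * \<phi> t\<bar> \<le> \<bar>K * a t\<bar>" for t
      proof (cases "t \<in> {x..y}")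
        case True
        then have "\<bar>\<phi> t\<bar> \<le> \<bar>K\<bar>" using K[OF True] by linarith
        then show ?thesis unfolding abs_mult by (subst mult.commute) (rule mult_right_mono, auto)
      qed (simp add: a_def)
      then show "AE t in lborel. norm (a t * \<phi> t) \<le> norm (K * a t)" by simp
    qed simp
  qed
  have fa: "(LBINT t. a t) = f y - f x"
    using f \<open>x \<le> y\<close> by (auto simp: ac_on_def set_lebesgue_integral_def a_def)
  have fb: "(LBINT t. b t) = \<phi> y - \<phi> x"
    using FTC[OF \<open>x \<le> y\<close>] by (simp add: b_def mult.commute)
  have "(LBINT s. b s * (f s - f x)) = (LBINT s. b s * f s) - (\<phi> y - \<phi> x) * f x"
    using i1 b by (simp add: right_diff_distrib fb)
  moreover have "(LBINT t. a t * (\<phi> y - \<phi> t)) = (f y - f x) * \<phi> y - (LBINT t. a t * \<phi> t)"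
    using i2 a by (simp add: right_diff_distrib fa)
  ultimately have "(LBINT t. a t * \<phi> t) + (LBINT s. b s * f s) = \<phi> y * f y - \<phi> x * f x"
    using eq by (simp add: algebra_simps)
  moreover have "(LBINT t:{x..y}. \<phi> t * g t + \<psi> t * f t) = (LBINT t. a t * \<phi> t + b t * f t)"
    unfolding set_lebesgue_integral_def
    by (rule Bochner_Integration.integral_cong) (auto simp: a_def b_def split: split_indicator)
  ultimately show "\<phi> y * f y - \<phi> x * f x = (LBINT t:{x..y}. \<phi> t * g t + \<psi> t * f t)"
    using i1 i2 by simp
qed

lemma h1_fun_mult_C1:
  assumes f: "h1_fun f g"
    and \<phi>: "\<And>x. (\<phi> has_real_derivative \<psi> x) (at x)" and \<psi>: "continuous_on UNIV \<psi>"
    and K: "\<And>x. \<bar>\<phi> x\<bar> \<le> K" and L: "\<And>x. \<bar>\<psi> x\<bar> \<le> L"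
  shows "h1_fun (\<lambda>x. \<phi> x * f x) (\<lambda>x. \<phi> x * g x + \<psi> x * f x)"
proof -
  note [measurable] = DERIV_borel_measurable[OF \<phi>]
  have [measurable]: "\<psi> \<in> borel_measurable borel" using \<psi> by (rule borel_measurable_continuous_onI)
  have "sq_int f" "sq_int g" "ac_on UNIV f g" using f by (auto simp: h1_fun_def)
  then show ?thesis unfolding h1_fun_def
    by (intro conjI ac_on_mult_C1[OF _ _ \<phi> \<psi>] sq_int_add sq_int_mult_bounded[OF _ _ K] sq_int_mult_bounded[OF _ _ L])
      auto
qed

section \<open>Coercive forms\<close>

lemma quadratic_nonneg_discriminant:
  fixes a b c :: real
  assumes "\<And>t. 0 \<le> a + 2 * t * b + t\<^sup>2 * c"
  shows "b\<^sup>2 \<le> a * c"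
proof -
  have "c \<ge> 0"
  proof (rule ccontr)
    assume c: "\<not> c \<ge> 0"
    \<comment> \<open>For negative \<open>c\<close>, this \<open>t\<close> is large enough for
      \<open>t * c\<close> to outweigh \<open>2 * b\<close> and \<open>\<bar>a\<bar>\<close>, which
      makes the quadratic negative.\<close>
    define t where "t = (\<bar>a\<bar> + 2 * \<bar>b\<bar> + 1) / (- c) + 1"
    have t: "t \<ge> 1" using c by (simp add: t_def field_simps)
    have "t * c = c - (\<bar>a\<bar> + 2 * \<bar>b\<bar> + 1)" using c by (simp add: t_def field_simps)
    then have "t * c + 2 * b + \<bar>a\<bar> < 0" using c abs_ge_self[of b] by linarith
    then have "t * (t * c + 2 * b + \<bar>a\<bar>) < 0" using t by (simp add: mult_pos_neg)
    moreover have "a \<le> t * \<bar>a\<bar>" using mult_right_mono[OF t, of "\<bar>a\<bar>"] by simp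
    ultimately show False using assms[of t] by (simp add: power2_eq_square algebra_simps)
  qed
  show ?thesis
  proof (cases "c = 0")
    case True
    have "b = 0"
    proof (rule ccontr)
      assume "b \<noteq> 0"
      then show False using assms[of "- (a + 1) / (2 * b)"] True by (simp add: field_simps)
    qed
    then show ?thesis using True by simp
  next
    case False
    then have "c > 0" using \<open>c \<ge> 0\<close> by simp
    \<comment> \<open>Evaluation at the minimiser of the quadratic.\<close>
    have "0 \<le> c * (a + 2 * (- b / c) * b + (- b / c)\<^sup>2 * c)"
      using assms[of "- b / c"] \<open>c > 0\<close> by (intro mult_nonneg_nonneg) auto
    also have "\<dots> = a * c - b\<^sup>2" using False by (simp add: field_simps power2_eq_square)
    finally show ?thesis by simp
  qed
qed

text \<open>The ambient space is not assumed complete. Completeness is asked of the form norm, and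
  only for sequences with a geometric rate: minimising sequences can be chosen that way, and the
  rate is what produces pointwise limits in the concrete spaces.\<close>

locale coercive_form =
  fixes D :: "'a::real_inner set" and B :: "'a \<Rightarrow> 'a \<Rightarrow> real" and C :: real
  assumes subsp: "subspace D"
    and sym: "\<And>u w. u \<in> D \<Longrightarrow> w \<in> D \<Longrightarrow> B u w = B w u"
    and add: "\<And>u v w. u \<in> D \<Longrightarrow> v \<in> D \<Longrightarrow> w \<in> D \<Longrightarrow> B (u + v) w = B u w + B v w"
    and scale: "\<And>c u w. u \<in> D \<Longrightarrow> w \<in> D \<Longrightarrow> B (c *\<^sub>R u) w = c * B u w"
    and C_pos: "C > 0"
    and coercive: "\<And>u. u \<in> D \<Longrightarrow> (norm u)\<^sup>2 \<le> C * B u u"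
    and complete: "\<And>X K. (\<And>n::nat. X n \<in> D) \<Longrightarrow>
      (\<And>n k. n \<le> k \<Longrightarrow> B (X n - X k) (X n - X k) \<le> K * (1/4)^n) \<Longrightarrow>
      \<exists>u\<in>D. (\<lambda>n. B (X n - u) (X n - u)) \<longlonglongrightarrow> 0"
begin

lemma D_add: "u \<in> D \<Longrightarrow> w \<in> D \<Longrightarrow> u + w \<in> D"
  and D_scale: "u \<in> D \<Longrightarrow> c *\<^sub>R u \<in> D"
  and D_diff: "u \<in> D \<Longrightarrow> w \<in> D \<Longrightarrow> u - w \<in> D"
  using subsp by (auto intro: subspace_add subspace_scale subspace_diff)

lemma add_right: "u \<in> D \<Longrightarrow> v \<in> D \<Longrightarrow> w \<in> D \<Longrightarrow> B w (u + v) = B w u + B w v"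
  using add sym D_add by metis

lemma scale_right: "u \<in> D \<Longrightarrow> w \<in> D \<Longrightarrow> B w (c *\<^sub>R u) = c * B w u"
  using scale sym D_scale by metis

lemma diff: "u \<in> D \<Longrightarrow> v \<in> D \<Longrightarrow> w \<in> D \<Longrightarrow> B (u - v) w = B u w - B v w"
  using add[of u "-1 *\<^sub>R v" w] scale[of v w "-1"] D_scale[of v "-1"] by simp

lemma diff_right: "u \<in> D \<Longrightarrow> v \<in> D \<Longrightarrow> w \<in> D \<Longrightarrow> B w (u - v) = B w u - B w v"
  using diff sym D_diff by metis

lemma nonneg: "u \<in> D \<Longrightarrow> B u u \<ge> 0"
  using coercive[of u] C_pos by (smt (verit) mult_pos_neg zero_le_power2)

lemma expand: "u \<in> D \<Longrightarrow> w \<in> D \<Longrightarrow>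
    B (u + t *\<^sub>R w) (u + t *\<^sub>R w) = B u u + 2 * t * B u w + t\<^sup>2 * B w w"
  by (simp add: add add_right scale scale_right D_add D_scale sym[of w u] power2_eq_square algebra_simps)

lemma Cauchy_Schwarz_form: "u \<in> D \<Longrightarrow> w \<in> D \<Longrightarrow> (B u w)\<^sup>2 \<le> B u u * B w w"
  using nonneg[OF D_add[OF _ D_scale]] by (intro quadratic_nonneg_discriminant) (simp flip: expand)

lemma unique:
  assumes "u \<in> D" "v \<in> D" "\<And>w. w \<in> D \<Longrightarrow> B u w = B v w"
  shows "u = v"
proof -
  have "B (u - v) (u - v) = 0" using assms D_diff[of u v] by (simp add: diff)
  then have "(norm (u - v))\<^sup>2 \<le> 0" using coercive[OF D_diff[of u v]] assms by simp
  then show ?thesis by simp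
qed

text \<open>The Riesz representative of \<open>f\<close> minimizes \<open>B u u - 2 \<langle>f, u\<rangle>\<close>; by the parallelogram identity
  a minimizing sequence is Cauchy for the form.\<close>

lemma exists_representative: "\<exists>u\<in>D. \<forall>w\<in>D. B u w = inner f w"
proof -
  define Q where "Q u = B u u - 2 * inner f u" for u
  have low: "Q u \<ge> - C * (norm f)\<^sup>2" if "u \<in> D" for u
  proof -
    have "(norm u)\<^sup>2 / C \<le> B u u" using coercive[OF that] C_pos by (simp add: field_simps)
    moreover have "inner f u \<le> norm f * norm u" by (rule norm_cauchy_schwarz)
    ultimately have 1: "Q u \<ge> (norm u)\<^sup>2 / C - 2 * (norm f * norm u)" by (simp add: Q_def)
    \<comment> \<open>Completing the square in \<open>norm u\<close> gives the lower bound on the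
      functional.\<close>
    have "0 \<le> (norm u - C * norm f)\<^sup>2 / C" using C_pos by simp
    also have "\<dots> = (norm u)\<^sup>2 / C - 2 * (norm f * norm u) + C * (norm f)\<^sup>2"
      using C_pos by (simp add: field_simps power2_eq_square)
    finally show ?thesis using 1 by simp
  qed
  define d where "d = Inf (Q ` D)"
  have bdd: "bdd_below (Q ` D)" using low by (intro bdd_belowI2)
  have d_le: "d \<le> Q u" if "u \<in> D" for u
    unfolding d_def by (rule cInf_lower) (use bdd that in auto)
  have "0 \<in> D" using subsp by (rule subspace_0)
  then have ne: "Q ` D \<noteq> {}" by auto
  have "\<exists>u\<in>D. Q u < d + (1/4)^n" for n :: nat
    using cInf_lessD[OF ne, of "d + (1/4)^n"] by (auto simp: d_def)
  then obtain X where X: "\<And>n. X n \<in> D" "\<And>n. Q (X n) < d + (1/4)^n" by metis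
  have "B (X n - X k) (X n - X k) \<le> 4 * (1/4)^n" if "n \<le> k" for n k
  proof -
    have "B (X n - X k) (X n - X k)
        = 2 * Q (X n) + 2 * Q (X k) - 4 * Q ((1/2) *\<^sub>R (X n + X k))"
      using X(1) by (simp add: Q_def diff diff_right add add_right scale scale_right D_add D_diff D_scale
          sym[of "X k" "X n"] inner_add_right algebra_simps)
    also have "\<dots> \<le> 2 * (d + (1/4)^n) + 2 * (d + (1/4)^k) - 4 * d"
      by (intro diff_mono add_mono mult_left_mono less_imp_le[OF X(2)] d_le D_scale D_add X(1)) auto
    also have "(1/4::real)^k \<le> (1/4)^n" using that by (intro power_decreasing) auto
    finally show ?thesis by simp
  qed
  from complete[OF X(1) this] obtain u where u: "u \<in> D" and lim: "(\<lambda>n. B (X n - u) (X n - u)) \<longlonglongrightarrow> 0"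
    by blast
  have "B u w = inner f w" if w: "w \<in> D" for w
  proof -
    have "(\<lambda>n. sqrt (B (X n - u) (X n - u) * B w w)) \<longlonglongrightarrow> sqrt (0 * B w w)"
      by (intro tendsto_intros lim)
    then have lim0: "(\<lambda>n. sqrt (B (X n - u) (X n - u) * B w w)) \<longlonglongrightarrow> 0" by simp
    have "norm (B (X n) w - B u w) \<le> sqrt (B (X n - u) (X n - u) * B w w)" for n
      using Cauchy_Schwarz_form[OF D_diff[OF X(1) u] w, of n] X(1) u w
      by (simp add: diff real_le_rsqrt)
    then have "(\<lambda>n. B (X n) w - B u w) \<longlonglongrightarrow> 0"
      by (intro Lim_null_comparison[OF _ lim0]) (auto intro: always_eventually)
    then have limw: "(\<lambda>n. B (X n) w) \<longlonglongrightarrow> B u w" by (simp add: LIM_zero_iff)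
    \<comment> \<open>First-order condition at the minimum: a nonnegative quadratic in
      \<open>t\<close> with zero constant term has zero linear coefficient. It is proved along the
      minimising sequence, whose defect (1/4)^n vanishes in the limit, so the value of
      \<open>Q u\<close> need not be identified with \<open>d\<close>.\<close>
    have "0 \<le> 0 + 2 * t * (B u w - inner f w) + t\<^sup>2 * B w w" for t
    proof (rule LIMSEQ_le_const)
      show "(\<lambda>n. (1/4)^n + 2 * t * (B (X n) w - inner f w) + t\<^sup>2 * B w w)
          \<longlonglongrightarrow> 0 + 2 * t * (B u w - inner f w) + t\<^sup>2 * B w w"
        by (intro tendsto_intros limw LIMSEQ_power_zero) auto
      have "0 \<le> (1/4)^n + 2 * t * (B (X n) w - inner f w) + t\<^sup>2 * B w w" for n
        using d_le[OF D_add[OF X(1)[of n] D_scale[OF w, of t]]] X(2)[of n] X(1)[of n] w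
        by (simp add: Q_def expand inner_add_right algebra_simps)
      then show "\<exists>N. \<forall>n\<ge>N. 0 \<le> (1/4)^n + 2 * t * (B (X n) w - inner f w) + t\<^sup>2 * B w w" by blast
    qed
    from quadratic_nonneg_discriminant[OF this] show ?thesis by simp
  qed
  then show ?thesis using u by blast
qed

text \<open>Linearity comes from uniqueness of weak solutions, and both bounds from testing the
  equation with the solution itself.\<close>

lemma exists_resolvent:
  obtains A :: "'a \<Rightarrow>\<^sub>L 'a"
  where "\<And>f. A f \<in> D" "\<And>f w. w \<in> D \<Longrightarrow> B (A f) w = inner f w"
    "\<And>f. B (A f) (A f) \<le> C * (norm f)\<^sup>2" "\<And>f. norm (A f) \<le> C * norm f"
proof -
  from exists_representative obtain S where S: "\<And>f. S f \<in> D" "\<And>f w. w \<in> D \<Longrightarrow> B (S f) w = inner f w"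
    by metis
  have bound: "norm (S f) \<le> C * norm f" for f
  proof -
    have "norm (S f) * norm (S f) \<le> C * inner f (S f)"
      using coercive[OF S(1)[of f]] S(2)[OF S(1), of f f] by (simp add: power2_eq_square)
    also have "\<dots> \<le> C * (norm f * norm (S f))"
      using C_pos by (intro mult_left_mono norm_cauchy_schwarz) auto
    finally have "norm (S f) * norm (S f) \<le> (C * norm f) * norm (S f)" by (simp add: mult.assoc)
    then show ?thesis using C_pos by (cases "norm (S f) = 0") auto
  qed
  have lin: "bounded_linear S"
  proof (rule bounded_linear_intro[where K=C])
    show "S (f + g) = S f + S g" for f g
      by (rule unique) (auto simp: S D_add add inner_add_left)
    show "S (c *\<^sub>R f) = c *\<^sub>R S f" for c f
      by (rule unique) (auto simp: S D_scale scale)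
    show "norm (S f) \<le> norm f * C" for f using bound[of f] by (simp add: mult.commute)
  qed
  have "B (S f) (S f) \<le> C * (norm f)\<^sup>2" for f
  proof -
    have "B (S f) (S f) = inner f (S f)" by (simp add: S)
    also have "\<dots> \<le> norm f * norm (S f)" by (rule norm_cauchy_schwarz)
    also have "\<dots> \<le> norm f * (C * norm f)" by (intro mult_left_mono bound) auto
    finally show ?thesis by (simp add: power2_eq_square mult_ac)
  qed
  then show ?thesis using that[of "Blinfun S"] S bound by (simp add: bounded_linear_Blinfun_apply[OF lin])
qed

end

section \<open>Forms of Schroedinger type with a confining potential\<close>

definition solution_graph :: "L2R set \<Rightarrow> (L2R \<Rightarrow> L2R \<Rightarrow> real) \<Rightarrow> operator" where
  "solution_graph D B = {(f, u). u \<in> D \<and> (\<forall>w\<in>D. B u w = inner f w)}"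

text \<open>Unique solvability turns the weak equation into the graph of a map. The right-hand side
  stands first in the pairs, so this is the graph of an inverse.\<close>

lemma (in coercive_form) solution_graph_eq:
  assumes "\<And>f. A f \<in> D" "\<And>f w. w \<in> D \<Longrightarrow> B (A f) w = inner f w"
  shows "{(f, u). u \<in> D \<and> (\<forall>w\<in>D. B u w = inner f w)} = {(f, A f) | f. True}"
proof -
  have "u = A f" if "u \<in> D" "\<forall>w\<in>D. B u w = inner f w" for f u
    by (rule unique) (use that assms in auto)
  then show ?thesis using assms by auto
qed

text \<open>One notion for both problems: \<open>I = UNIV\<close> gives the form domain of the limit
  operator, and an open interval encodes the Dirichlet condition, because \<open>f\<close> is
  continuous and vanishes also at the endpoints.\<close>

definition form_fun :: "real set \<Rightarrow> (real \<Rightarrow> real) \<Rightarrow> (real \<Rightarrow> real) \<Rightarrow> (real \<Rightarrow> real) \<Rightarrow> bool" where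
  "form_fun I V f g \<longleftrightarrow> h1_fun f g \<and> (\<forall>x. x \<notin> I \<longrightarrow> f x = 0) \<and> integrable lborel (\<lambda>x. V x * (f x)\<^sup>2)"

definition form_domain :: "real set \<Rightarrow> (real \<Rightarrow> real) \<Rightarrow> L2R set" where
  "form_domain I V = {abs_L2R f | f g. form_fun I V f g}"

text \<open>The weak derivative is taken on the whole line also for functions living on an interval,
  which is consistent because they are extended by zero.\<close>

definition sform :: "(real \<Rightarrow> real) \<Rightarrow> L2R \<Rightarrow> L2R \<Rightarrow> real" where
  "sform V u w = inner (weak_deriv UNIV u) (weak_deriv UNIV w) + (LBINT x. V x * (rep_L2R u x * rep_L2R w x))"

lemma sform_abs:
  assumes [measurable]: "V \<in> borel_measurable borel" and f: "h1_fun f g" "h1_fun f' g'"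
  shows "sform V (abs_L2R f) (abs_L2R f') = (LBINT x. g x * g' x) + (LBINT x. V x * (f x * f' x))"
proof -
  have sq: "sq_int f" "sq_int f'" "sq_int g" "sq_int g'" using f by (auto simp: h1_fun_def)
  note [measurable] = sq_int_measurable[OF sq(1)] sq_int_measurable[OF sq(2)]
  have "(LBINT x. V x * (rep_L2R (abs_L2R f) x * rep_L2R (abs_L2R f') x)) = (LBINT x. V x * (f x * f' x))"
    by (rule integral_cong_AE)
      (use rep_abs_AE[OF sq(1)] rep_abs_AE[OF sq(2)] in \<open>auto elim!: eventually_elim2\<close>)
  then show ?thesis
    using sq by (simp add: sform_def weak_deriv_UNIV[OF f(1)] weak_deriv_UNIV[OF f(2)] inner_abs_L2R)
qed

lemma weighted_product_integrable:
  assumes [measurable]: "V \<in> borel_measurable borel" "f \<in> borel_measurable borel" "f' \<in> borel_measurable borel"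
    and V: "\<And>x. V x \<ge> (0::real)"
    and i: "integrable lborel (\<lambda>x. V x * (f x)\<^sup>2)" "integrable lborel (\<lambda>x. V x * (f' x)\<^sup>2)"
  shows "integrable lborel (\<lambda>x. V x * (f x * f' x))"
proof (rule Bochner_Integration.integrable_bound)
  show "integrable lborel (\<lambda>x. V x * (f x)\<^sup>2 + V x * (f' x)\<^sup>2)" using i by simp
  have "\<bar>f x * f' x\<bar> \<le> (f x)\<^sup>2 + (f' x)\<^sup>2" for x
  proof -
    have "2 * (\<bar>f x\<bar> * \<bar>f' x\<bar>) \<le> (f x)\<^sup>2 + (f' x)\<^sup>2"
      using sum_squares_bound[of "\<bar>f x\<bar>" "\<bar>f' x\<bar>"] by simp
    moreover have "0 \<le> \<bar>f x\<bar> * \<bar>f' x\<bar>" by simp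
    ultimately show ?thesis unfolding abs_mult by linarith
  qed
  then have "\<bar>V x * (f x * f' x)\<bar> \<le> V x * (f x)\<^sup>2 + V x * (f' x)\<^sup>2" for x
    using mult_left_mono[of "\<bar>f x * f' x\<bar>" "(f x)\<^sup>2 + (f' x)\<^sup>2" "V x"] V[of x]
    by (simp add: abs_mult distrib_left)
  then show "AE x in lborel. norm (V x * (f x * f' x)) \<le> norm (V x * (f x)\<^sup>2 + V x * (f' x)\<^sup>2)"
    using V by (intro AE_I2) simp
qed simp

lemma form_fun_cmult: "form_fun I V f g \<Longrightarrow> form_fun I V (\<lambda>x. c * f x) (\<lambda>x. c * g x)"
  using integrable_mult_right[of "c\<^sup>2" lborel "\<lambda>x. V x * (f x)\<^sup>2"]
  unfolding form_fun_def by (auto intro: h1_fun_cmult simp: power_mult_distrib mult.left_commute)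

lemma form_fun_add:
  assumes V: "V \<in> borel_measurable borel" "\<And>x. V x \<ge> (0::real)"
    and f: "form_fun I V f g" "form_fun I V f' g'"
  shows "form_fun I V (\<lambda>x. f x + f' x) (\<lambda>x. g x + g' x)"
proof -
  have sq: "sq_int f" "sq_int f'" using f by (auto simp: form_fun_def h1_fun_def)
  have "integrable lborel (\<lambda>x. V x * (f x)\<^sup>2 + V x * (f' x)\<^sup>2 + 2 * (V x * (f x * f' x)))"
    using f weighted_product_integrable[OF V(1) sq_int_measurable[OF sq(1)] sq_int_measurable[OF sq(2)] V(2)]
    by (auto simp: form_fun_def)
  then have "integrable lborel (\<lambda>x. V x * (f x + f' x)\<^sup>2)"
    by (simp add: power2_sum algebra_simps)
  then show ?thesis using f by (auto simp: form_fun_def intro: h1_fun_add)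
qed

lemma form_fun_diff:
  assumes V: "V \<in> borel_measurable borel" "\<And>x. V x \<ge> (0::real)"
    and f: "form_fun I V f g" "form_fun I V f' g'"
  shows "form_fun I V (\<lambda>x. f x - f' x) (\<lambda>x. g x - g' x)"
  using form_fun_add[OF V f(1) form_fun_cmult[OF f(2), of "-1"]] by simp

text \<open>The same constants serve the limit operator and all rescaled ones, so every estimate in
  this locale is uniform in the parameter. The normalisation \<open>\<kappa> \<le> 1\<close> lets
  one factor \<open>1 / \<kappa>\<close> absorb the derivative term along with the potential
  term.\<close>

locale confining =
  fixes I :: "real set" and V :: "real \<Rightarrow> real" and \<kappa> m :: real
  assumes V_measurable [measurable]: "V \<in> borel_measurable borel"
    and \<kappa>: "0 < \<kappa>" "\<kappa> \<le> 1" and m: "0 \<le> m"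
    and V_ge: "\<And>x. \<kappa> * \<bar>x\<bar> powr m \<le> V x"
begin

lemma V_nonneg: "V x \<ge> 0"
  using V_ge[of x] \<kappa> by (smt (verit) mult_nonneg_nonneg powr_ge_zero)

abbreviation energy :: "(real \<Rightarrow> real) \<Rightarrow> (real \<Rightarrow> real) \<Rightarrow> real" where
  "energy f g \<equiv> (LBINT x. (g x)\<^sup>2) + (LBINT x. V x * (f x)\<^sup>2)"

lemma
  assumes f: "form_fun I V f g"
  shows weight_integrable: "integrable lborel (\<lambda>t. \<bar>t\<bar> powr m * (f t)\<^sup>2)" (is ?int)
    and weight_le: "(LBINT t. (g t)\<^sup>2) + (LBINT t. \<bar>t\<bar> powr m * (f t)\<^sup>2) \<le> energy f g / \<kappa>" (is ?le)
    and pointwise_le: "(f x)\<^sup>2 \<le> 4 / \<kappa> * energy f g" (is ?pw)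
    and norm_le: "(LBINT t. (f t)\<^sup>2) \<le> 9 / \<kappa> * energy f g" (is ?nm)
proof -
  have h: "h1_fun f g" and i: "integrable lborel (\<lambda>x. V x * (f x)\<^sup>2)"
    using f by (auto simp: form_fun_def)
  then have [measurable]: "f \<in> borel_measurable borel" by (auto simp: h1_fun_def dest: sq_int_measurable)
  have le: "\<bar>t\<bar> powr m * (f t)\<^sup>2 \<le> V t * (f t)\<^sup>2 / \<kappa>" for t
    using mult_right_mono[OF V_ge[of t], of "(f t)\<^sup>2"] \<kappa> by (simp add: field_simps)
  show int: ?int
    by (rule Bochner_Integration.integrable_bound[OF integrable_divide[OF i, of \<kappa>]])
      (use le V_nonneg \<kappa> in \<open>auto intro!: AE_I2 simp: abs_mult\<close>)
  have "(LBINT t. \<bar>t\<bar> powr m * (f t)\<^sup>2) \<le> (LBINT x. V x * (f x)\<^sup>2 / \<kappa>)"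
    by (rule integral_mono[OF int _ le]) (use i in simp)
  moreover have "(LBINT t. (g t)\<^sup>2) \<le> (LBINT t. (g t)\<^sup>2) / \<kappa>"
    using mult_left_mono[OF \<kappa>(2), of "LBINT t. (g t)\<^sup>2"] \<kappa> by (simp add: field_simps)
  ultimately show le': ?le by (simp add: add_divide_distrib)
  have "(f x)\<^sup>2 \<le> 4 * (energy f g / \<kappa>)"
    using h1_fun_weighted_sup[OF h int m, of x] le' by argo
  then show ?pw by simp
  have "(LBINT t. (f t)\<^sup>2) \<le> 9 * (energy f g / \<kappa>)"
    using h1_fun_weighted_norm[OF h int m] le' by argo
  then show ?nm by simp
qed

text \<open>The assumed energy bound is the one that resolvents satisfy; \<open>4 / \<kappa>\<close>
  times \<open>9 / \<kappa>\<close> is the square of \<open>6 / \<kappa>\<close>.\<close>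

lemma sup_le:
  assumes f: "form_fun I V f g" and en: "energy f g \<le> 9 / \<kappa> * N\<^sup>2" and "N \<ge> 0"
  shows "\<bar>f x\<bar> \<le> 6 / \<kappa> * N"
proof (rule power2_le_imp_le)
  have "(f x)\<^sup>2 \<le> 4 / \<kappa> * (9 / \<kappa> * N\<^sup>2)"
    by (rule order_trans[OF pointwise_le[OF f] mult_left_mono[OF en]]) (use \<kappa> in auto)
  then show "\<bar>f x\<bar>\<^sup>2 \<le> (6 / \<kappa> * N)\<^sup>2" by (simp add: power_mult_distrib power_divide power2_eq_square)
qed (use \<kappa> assms in auto)

lemma sform_square: "form_fun I V f g \<Longrightarrow> sform V (abs_L2R f) (abs_L2R f) = energy f g"
  using sform_abs[OF V_measurable, of f g f g] by (simp add: form_fun_def power2_eq_square)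

text \<open>The derivatives converge in L^2, while the functions converge at every point because the
  form norm bounds the sup norm. Convergence everywhere, not just a.e., keeps the limit zero off
  \<open>I\<close> and makes it an indefinite integral of the limiting derivative. Fatou's lemma
  handles the weighted integrals.\<close>

lemma form_complete:
  assumes X: "\<And>n::nat. X n \<in> form_domain I V"
    and K: "\<And>n k. n \<le> k \<Longrightarrow> sform V (X n - X k) (X n - X k) \<le> K * (1/4)^n"
  shows "\<exists>u\<in>form_domain I V. (\<lambda>n. sform V (X n - u) (X n - u)) \<longlonglongrightarrow> 0"
proof -
  have "\<forall>n. \<exists>f g. X n = abs_L2R f \<and> form_fun I V f g" using X by (auto simp: form_domain_def)
  then obtain f g where Xf: "\<And>n. X n = abs_L2R (f n)" and fg: "\<And>n. form_fun I V (f n) (g n)" by metis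
  have sq: "sq_int (f n)" "sq_int (g n)" and ac: "ac_on UNIV (f n) (g n)" for n
    using fg[of n] by (auto simp: form_fun_def h1_fun_def)
  note [measurable] = sq_int_measurable[OF sq(1)] sq_int_measurable[OF sq(2)]
  have dif: "form_fun I V (\<lambda>x. f n x - f k x) (\<lambda>x. g n x - g k x)" for n k
    by (rule form_fun_diff[OF V_measurable V_nonneg fg fg])
  have en: "energy (\<lambda>x. f n x - f k x) (\<lambda>x. g n x - g k x) \<le> K * (1/4)^n" if "n \<le> k" for n k
    using K[OF that] sform_square[OF dif, of n k] by (simp add: Xf abs_L2R_diff sq)
  have nnV: "(LBINT x. V x * (f n x - f k x)\<^sup>2) \<ge> 0" for n k
    using V_nonneg by (intro integral_nonneg_AE AE_I2) simp
  have eng: "(LBINT x. (g n x - g k x)\<^sup>2) \<le> K * (1/4)^n" if "n \<le> k" for n k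
    using en[OF that] nnV[of n k] by simp
  have nng: "(LBINT x. (g n x - g k x)\<^sup>2) \<ge> 0" for n k by simp
  have enV: "(LBINT x. V x * (f n x - f k x)\<^sup>2) \<le> K * (1/4)^n" if "n \<le> k" for n k
    using en[OF that] nng[of n k] by linarith
  obtain l where l: "sq_int l" "\<And>n. (LBINT x. (g n x - l x)\<^sup>2) \<le> K * (1/4)^n"
    using sq_int_complete[OF sq(2) eng] by blast
  have conv: "convergent (\<lambda>n. f n x)" for x
  proof (rule convergent_if_summable_increments)
    show "\<bar>f (Suc n) x - f n x\<bar> \<le> sqrt (4 / \<kappa> * K) * (1/2)^n" for n
    proof -
      have "(f n x - f (Suc n) x)\<^sup>2 \<le> 4 / \<kappa> * (K * (1/4)^n)"
        by (rule order_trans[OF pointwise_le[OF dif[of n "Suc n"]] mult_left_mono[OF en]]) (use \<kappa> in auto)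
      then have "\<bar>f n x - f (Suc n) x\<bar> \<le> sqrt (4 / \<kappa> * (K * (1/4)^n))"
        by (intro real_le_rsqrt) simp
      also have "\<dots> = sqrt (4 / \<kappa> * K) * sqrt ((1/4)^n)"
        by (simp only: mult.assoc flip: real_sqrt_mult)
      also have "sqrt ((1/4)^n) = (1/2)^n" by (simp add: real_sqrt_power real_sqrt_divide)
      finally show ?thesis by (simp add: abs_minus_commute)
    qed
    show "summable (\<lambda>n. sqrt (4 / \<kappa> * K) * (1/2)^n)" by (intro summable_mult summable_geometric) auto
  qed
  define F where "F x = lim (\<lambda>n. f n x)" for x
  have lim: "(\<lambda>n. f n x) \<longlonglongrightarrow> F x" for x using conv[of x] by (simp add: F_def convergent_LIMSEQ_iff)
  have [measurable]: "F \<in> borel_measurable borel" unfolding F_def by measurable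
  have "sq_int (\<lambda>x. f 0 x - F x)"
  proof -
    have "integrable lborel (\<lambda>x. (f 0 x - F x)\<^sup>2)"
    proof (rule integral_Fatou(1))
      show "integrable lborel (\<lambda>x. (f 0 x - f k x)\<^sup>2)" for k by (intro sq_int_integrable sq_int_diff sq)
      show "AE x in lborel. (\<lambda>k. (f 0 x - f k x)\<^sup>2) \<longlonglongrightarrow> (f 0 x - F x)\<^sup>2"
        by (intro AE_I2 tendsto_intros lim)
      have "(LBINT x. (f 0 x - f k x)\<^sup>2) \<le> 9 / \<kappa> * K" for k
        by (rule order_trans[OF norm_le[OF dif[of 0 k]] mult_left_mono]) (use \<kappa> en[of 0 k] in auto)
      then show "\<forall>\<^sub>F k in sequentially. (LBINT x. (f 0 x - f k x)\<^sup>2) \<le> 9 / \<kappa> * K" by simp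
    qed auto
    then show ?thesis by (simp add: sq_int_def)
  qed
  from sq_int_diff[OF sq(1)[of 0] this] have F: "sq_int F" by simp
  have FV: "integrable lborel (\<lambda>x. V x * (f n x - F x)\<^sup>2)"
    "(LBINT x. V x * (f n x - F x)\<^sup>2) \<le> K * (1/4)^n" for n
  proof (rule_tac [!] integral_Fatou[where F="\<lambda>k x. V x * (f n x - f k x)\<^sup>2"])
    show "integrable lborel (\<lambda>x. V x * (f n x - f k x)\<^sup>2)" for k using dif by (simp add: form_fun_def)
    then show "integrable lborel (\<lambda>x. V x * (f n x - f k x)\<^sup>2)" for k .
    show "AE x in lborel. (\<lambda>k. V x * (f n x - f k x)\<^sup>2) \<longlonglongrightarrow> V x * (f n x - F x)\<^sup>2"
      by (intro AE_I2 tendsto_intros lim)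
    then show "AE x in lborel. (\<lambda>k. V x * (f n x - f k x)\<^sup>2) \<longlonglongrightarrow> V x * (f n x - F x)\<^sup>2" .
    show "\<forall>\<^sub>F k in sequentially. (LBINT x. V x * (f n x - f k x)\<^sup>2) \<le> K * (1/4)^n"
      using enV by (auto simp: eventually_sequentially)
    then show "\<forall>\<^sub>F k in sequentially. (LBINT x. V x * (f n x - f k x)\<^sup>2) \<le> K * (1/4)^n" .
  qed (auto simp: V_nonneg)
  have acF: "ac_on UNIV F l"
    unfolding ac_on_def
  proof (intro ballI impI)
    fix x y :: real assume "x \<le> y"
    have "(\<lambda>n. (LBINT t:{x..y}. g n t) - (LBINT t:{x..y}. l t)) \<longlonglongrightarrow> 0"
    proof (rule Lim_null_comparison)
      show "\<forall>\<^sub>F n in sequentially. norm ((LBINT t:{x..y}. g n t) - (LBINT t:{x..y}. l t))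
          \<le> sqrt ((y - x) * (K * (1/4)^n))"
      proof (rule always_eventually, rule allI)
        fix n
        have "((LBINT t:{x..y}. g n t) - (LBINT t:{x..y}. l t))\<^sup>2 = (LBINT t:{x..y}. g n t - l t)\<^sup>2"
          by (subst set_integral_diff(2)) (auto intro!: sq_int_set_integrable sq l)
        also have "\<dots> \<le> (y - x) * (LBINT t. (g n t - l t)\<^sup>2)"
          by (rule set_integral_sq_le[OF sq_int_diff[OF sq(2) l(1)] \<open>x \<le> y\<close>])
        also have "\<dots> \<le> (y - x) * (K * (1/4)^n)" using l(2)[of n] \<open>x \<le> y\<close> by (intro mult_left_mono) auto
        finally show "norm ((LBINT t:{x..y}. g n t) - (LBINT t:{x..y}. l t)) \<le> sqrt ((y - x) * (K * (1/4)^n))"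
          by (simp add: real_le_rsqrt)
      qed
      have "(\<lambda>n. sqrt ((y - x) * (K * (1/4)^n))) \<longlonglongrightarrow> sqrt ((y - x) * (K * 0))"
        by (intro tendsto_intros LIMSEQ_power_zero) auto
      then show "(\<lambda>n. sqrt ((y - x) * (K * (1/4)^n))) \<longlonglongrightarrow> 0" by simp
    qed
    then have "(\<lambda>n. LBINT t:{x..y}. g n t) \<longlonglongrightarrow> (LBINT t:{x..y}. l t)" by (simp add: LIM_zero_iff)
    moreover have "(LBINT t:{x..y}. g n t) = f n y - f n x" for n
      using ac[of n] \<open>x \<le> y\<close> by (auto simp: ac_on_def)
    moreover have "(\<lambda>n. f n y - f n x) \<longlonglongrightarrow> F y - F x" by (intro tendsto_intros lim)
    ultimately show "F y - F x = (LBINT t:{x..y}. l t)" using LIMSEQ_unique by force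
  qed
  have "F x = 0" if "x \<notin> I" for x
    using lim[of x] fg that by (simp add: form_fun_def LIMSEQ_const_iff)
  moreover have hF: "h1_fun F l" using F l acF by (simp add: h1_fun_def)
  moreover have "integrable lborel (\<lambda>x. V x * (F x)\<^sup>2)"
  proof (rule Bochner_Integration.integrable_bound)
    show "integrable lborel (\<lambda>x. 2 * (V x * (f 0 x)\<^sup>2) + 2 * (V x * (f 0 x - F x)\<^sup>2))"
      using fg[of 0] FV(1)[of 0] by (auto simp: form_fun_def)
    have "V x * (F x)\<^sup>2 \<le> V x * (2 * (f 0 x)\<^sup>2 + 2 * (f 0 x - F x)\<^sup>2)" for x
      using zero_le_power2[of "F x - 2 * f 0 x"]
      by (intro mult_left_mono V_nonneg) (simp add: power2_eq_square algebra_simps)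
    then show "AE x in lborel. norm (V x * (F x)\<^sup>2) \<le> norm (2 * (V x * (f 0 x)\<^sup>2) + 2 * (V x * (f 0 x - F x)\<^sup>2))"
      using V_nonneg by (intro AE_I2) (simp add: algebra_simps)
  qed simp
  ultimately have FF: "form_fun I V F l" by (simp add: form_fun_def)
  have "(\<lambda>n. sform V (X n - abs_L2R F) (X n - abs_L2R F)) \<longlonglongrightarrow> 0"
  proof (rule Lim_null_comparison)
    show "\<forall>\<^sub>F n in sequentially. norm (sform V (X n - abs_L2R F) (X n - abs_L2R F)) \<le> 2 * K * (1/4)^n"
    proof (rule always_eventually, rule allI)
      fix n
      have "form_fun I V (\<lambda>x. f n x - F x) (\<lambda>x. g n x - l x)"
        by (rule form_fun_diff[OF V_measurable V_nonneg fg FF])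
      from sform_square[OF this] have "sform V (X n - abs_L2R F) (X n - abs_L2R F)
          = energy (\<lambda>x. f n x - F x) (\<lambda>x. g n x - l x)"
        by (simp add: Xf abs_L2R_diff sq F)
      moreover have "energy (\<lambda>x. f n x - F x) (\<lambda>x. g n x - l x) \<ge> 0"
        using V_nonneg by (intro add_nonneg_nonneg integral_nonneg_AE AE_I2) auto
      ultimately show "norm (sform V (X n - abs_L2R F) (X n - abs_L2R F)) \<le> 2 * K * (1/4)^n"
        using l(2)[of n] FV(2)[of n] by simp
    qed
    have "(\<lambda>n. 2 * K * (1/4)^n) \<longlonglongrightarrow> 2 * K * 0" by (intro tendsto_intros LIMSEQ_power_zero) auto
    then show "(\<lambda>n. 2 * K * (1/4)^n) \<longlonglongrightarrow> 0" by simp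
  qed
  then show ?thesis using FF by (auto simp: form_domain_def)
qed

sublocale coercive_form "form_domain I V" "sform V" "9 / \<kappa>"
proof
  have rep: "\<exists>f g. u = abs_L2R f \<and> form_fun I V f g \<and> sq_int f \<and> h1_fun f g" if "u \<in> form_domain I V" for u
    using that by (auto simp: form_domain_def form_fun_def h1_fun_def)
  have cls: "abs_L2R f \<in> form_domain I V" if "form_fun I V f g" for f g
    using that by (auto simp: form_domain_def)
  have zero: "form_fun I V (\<lambda>_. 0) (\<lambda>_. 0)"
    by (simp add: form_fun_def h1_fun_def sq_int_zero ac_on_def)
  show "subspace (form_domain I V)"
  proof (rule subspaceI)
    show "0 \<in> form_domain I V" using cls[OF zero] by (simp flip: zero_L2R.abs_eq)
    show "u + w \<in> form_domain I V" if "u \<in> form_domain I V" "w \<in> form_domain I V" for u w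
      using rep[OF that(1)] rep[OF that(2)]
      by (auto simp: abs_L2R_add intro!: cls[OF form_fun_add[OF V_measurable V_nonneg]])
    show "c *\<^sub>R u \<in> form_domain I V" if "u \<in> form_domain I V" for c u
      using rep[OF that] by (auto simp: abs_L2R_scaleR intro!: cls[OF form_fun_cmult])
  qed
  show "sform V u w = sform V w u" for u w by (simp add: sform_def inner_commute mult_ac)
  show "sform V (u + v) w = sform V u w + sform V v w"
    if u: "u \<in> form_domain I V" and v: "v \<in> form_domain I V" and w: "w \<in> form_domain I V" for u v w
  proof -
    obtain f g where "u = abs_L2R f" "form_fun I V f g" using rep[OF u] by blast
    moreover obtain f' g' where "v = abs_L2R f'" "form_fun I V f' g'" using rep[OF v] by blast
    moreover obtain f'' g'' where "w = abs_L2R f''" "form_fun I V f'' g''" using rep[OF w] by blast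
    ultimately have *: "u = abs_L2R f" "form_fun I V f g" "v = abs_L2R f'" "form_fun I V f' g'"
      "w = abs_L2R f''" "form_fun I V f'' g''" by blast+
    then have h: "h1_fun f g" "h1_fun f' g'" "h1_fun f'' g''" by (auto simp: form_fun_def)
    then have sq: "sq_int f" "sq_int g" "sq_int f'" "sq_int g'" "sq_int f''" "sq_int g''" by (auto simp: h1_fun_def)
    have i: "integrable lborel (\<lambda>x. V x * (f x * f'' x))" "integrable lborel (\<lambda>x. V x * (f' x * f'' x))"
      by (rule weighted_product_integrable[OF V_measurable sq_int_measurable[OF sq(1)] sq_int_measurable[OF sq(5)] V_nonneg]
          weighted_product_integrable[OF V_measurable sq_int_measurable[OF sq(3)] sq_int_measurable[OF sq(5)] V_nonneg];
          use * in \<open>simp add: form_fun_def\<close>)+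
    show ?thesis
      using i sq_int_mult[OF sq(2) sq(6)] sq_int_mult[OF sq(4) sq(6)]
      by (simp add: * abs_L2R_add sq sform_abs[OF V_measurable h1_fun_add[OF h(1,2)] h(3)]
          sform_abs[OF V_measurable h(1,3)] sform_abs[OF V_measurable h(2,3)] distrib_right distrib_left)
  qed
  show "sform V (c *\<^sub>R u) w = c * sform V u w"
    if u: "u \<in> form_domain I V" and w: "w \<in> form_domain I V" for c u w
  proof -
    obtain f g where "u = abs_L2R f" "form_fun I V f g" using rep[OF u] by blast
    moreover obtain f' g' where "w = abs_L2R f'" "form_fun I V f' g'" using rep[OF w] by blast
    ultimately have *: "u = abs_L2R f" "form_fun I V f g" "w = abs_L2R f'" "form_fun I V f' g'" by blast+
    then have h: "h1_fun f g" "h1_fun f' g'" by (auto simp: form_fun_def)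
    then have sq: "sq_int f" by (auto simp: h1_fun_def)
    show ?thesis
      by (simp add: * abs_L2R_scaleR sq sform_abs[OF V_measurable h1_fun_cmult[OF h(1)] h(2)]
          sform_abs[OF V_measurable h] mult.assoc mult.left_commute[of _ c] distrib_left)
  qed
  show "0 < 9 / \<kappa>" using \<kappa> by simp
  show "(norm u)\<^sup>2 \<le> 9 / \<kappa> * sform V u u" if u: "u \<in> form_domain I V" for u
  proof -
    obtain f g where "u = abs_L2R f" "form_fun I V f g" "sq_int f" using rep[OF u] by blast
    then show ?thesis using norm_le[of f g] sform_square[of f g] by (simp add: norm_abs_L2R)
  qed
qed (rule form_complete)

end

section \<open>Comparison of resolvents\<close>

lemma (in confining) exists_solution_operator:
  obtains A where "solution_graph (form_domain I V) (sform V) = blinfun_graph A"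
    "\<And>F. A F \<in> form_domain I V" "\<And>F w. w \<in> form_domain I V \<Longrightarrow> sform V (A F) w = inner F w"
    "\<And>F. sform V (A F) (A F) \<le> 9 / \<kappa> * (norm F)\<^sup>2" "\<And>F. norm (A F) \<le> 9 / \<kappa> * norm F"
proof -
  obtain A :: "L2R \<Rightarrow>\<^sub>L L2R" where A: "\<And>F. A F \<in> form_domain I V"
    "\<And>F w. w \<in> form_domain I V \<Longrightarrow> sform V (A F) w = inner F w"
    "\<And>F. sform V (A F) (A F) \<le> 9 / \<kappa> * (norm F)\<^sup>2" "\<And>F. norm (A F) \<le> 9 / \<kappa> * norm F"
    using exists_resolvent by blast
  have "solution_graph (form_domain I V) (sform V) = blinfun_graph A"
    unfolding solution_graph_def blinfun_graph_def using solution_graph_eq[of A] A by simp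
  then show ?thesis using that A by blast
qed

lemma (in confining) form_fun_mult_C1:
  assumes f: "form_fun I V f g"
    and \<phi>: "\<And>x. (\<phi> has_real_derivative \<psi> x) (at x)" and \<psi>: "continuous_on UNIV \<psi>"
    and K: "\<And>x. \<bar>\<phi> x\<bar> \<le> K" and L: "\<And>x. \<bar>\<psi> x\<bar> \<le> L"
  shows "form_fun I V (\<lambda>x. \<phi> x * f x) (\<lambda>x. \<phi> x * g x + \<psi> x * f x)"
proof -
  have h: "h1_fun f g" and i: "integrable lborel (\<lambda>x. V x * (f x)\<^sup>2)" using f by (auto simp: form_fun_def)
  note [measurable] = DERIV_borel_measurable[OF \<phi>]
  have [measurable]: "f \<in> borel_measurable borel" using h by (auto simp: h1_fun_def dest: sq_int_measurable)
  have "integrable lborel (\<lambda>x. V x * (\<phi> x * f x)\<^sup>2)"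
  proof (rule Bochner_Integration.integrable_bound)
    show "integrable lborel (\<lambda>x. K\<^sup>2 * (V x * (f x)\<^sup>2))" using i by simp
    have "(\<phi> x)\<^sup>2 \<le> K\<^sup>2" for x using K[of x] by (metis abs_ge_zero power2_abs power_mono)
    then have "(\<phi> x)\<^sup>2 * (V x * (f x)\<^sup>2) \<le> K\<^sup>2 * (V x * (f x)\<^sup>2)" for x
      by (intro mult_right_mono) (simp_all add: V_nonneg)
    then show "AE x in lborel. norm (V x * (\<phi> x * f x)\<^sup>2) \<le> norm (K\<^sup>2 * (V x * (f x)\<^sup>2))"
      using V_nonneg by (intro AE_I2) (simp add: power_mult_distrib mult.left_commute)
  qed simp
  then show ?thesis using f h1_fun_mult_C1[OF h \<phi> \<psi> K L] by (simp add: form_fun_def)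
qed

section \<open>Cutoffs and smallness of solutions far from the origin\<close>

lemma max_square_has_derivative: "((\<lambda>z::real. (max 0 z)\<^sup>2) has_real_derivative 2 * max 0 z) (at z)"
proof -
  consider "z > 0" | "z < 0" | "z = 0" by linarith
  then show ?thesis
  proof cases
    case 1
    have "((\<lambda>z::real. z\<^sup>2) has_real_derivative 2 * max 0 z) (at z)"
      using 1 by (auto intro!: derivative_eq_intros)
    then show ?thesis
      by (rule has_field_derivative_transform_within_open[where S="{0<..}"]) (use 1 in auto)
  next
    case 2
    have "((\<lambda>z::real. 0) has_real_derivative 2 * max 0 z) (at z)"
      using 2 by (auto intro!: derivative_eq_intros)
    then show ?thesis
      by (rule has_field_derivative_transform_within_open[where S="{..<0}"]) (use 2 in auto)
  next
    case 3
    have "((\<lambda>h::real. ((max 0 (0 + h))\<^sup>2 - (max 0 0)\<^sup>2) / h) \<longlongrightarrow> 0) (at 0)"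
    proof (rule Lim_null_comparison)
      show "\<forall>\<^sub>F h in at 0. norm (((max 0 (0 + h))\<^sup>2 - (max 0 0)\<^sup>2) / h) \<le> \<bar>h::real\<bar>"
        by (intro always_eventually allI) (auto simp: max_def power2_eq_square)
      show "((\<lambda>h::real. \<bar>h\<bar>) \<longlongrightarrow> 0) (at 0)" by (intro tendsto_eq_intros) auto
    qed
    then show ?thesis using 3 by (simp add: DERIV_def)
  qed
qed

text \<open>Squaring the truncated parabola makes it C^1 where it reaches zero, with slope of order
  \<open>1 / R\<close>. The bound on \<open>1 - \<phi> x\<close> squared is linear in
  \<open>\<bar>x\<bar>\<close> so that a weight of exponent at least 1 can absorb it, with a gain
  \<open>1 / R\<close>.\<close>

lemma exists_cutoff:
  fixes R :: real
  assumes "R > 0"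
  obtains \<phi> \<psi> where "\<And>x. (\<phi> has_real_derivative \<psi> x) (at x)" "continuous_on UNIV \<psi>"
    "\<And>x. 0 \<le> \<phi> x" "\<And>x. \<phi> x \<le> 1" "\<And>x. \<bar>x\<bar> \<ge> R \<Longrightarrow> \<phi> x = 0"
    "\<And>x. (1 - \<phi> x)\<^sup>2 \<le> 2 * \<bar>x\<bar> / R" "\<And>x. \<bar>\<psi> x\<bar> \<le> 4 / R"
proof -
  define p where "p x = max 0 (1 - (x / R)\<^sup>2)" for x
  define \<psi> where "\<psi> x = 2 * p x * (- 2 * (x / R) / R)" for x
  have p: "0 \<le> p x" "p x \<le> 1" for x by (auto simp: p_def)
  have p0: "p x = 0" if "\<bar>x\<bar> \<ge> R" for x
  proof -
    have "\<bar>x / R\<bar> \<ge> 1" using that assms by (simp add: field_simps)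
    then have "(x / R)\<^sup>2 \<ge> 1" by (metis abs_square_le_1 abs_le_square_iff abs_one one_power2 power2_eq_square)
    then show ?thesis by (simp add: p_def)
  qed
  have der: "((\<lambda>x. (p x)\<^sup>2) has_real_derivative \<psi> x) (at x)" for x
  proof -
    have "((\<lambda>x. 1 - (x / R)\<^sup>2) has_real_derivative - 2 * (x / R) / R) (at x)"
      using assms by (auto intro!: derivative_eq_intros simp: power2_eq_square)
    from DERIV_chain2[OF max_square_has_derivative this] show ?thesis by (simp add: p_def \<psi>_def)
  qed
  have eta: "(1 - (p x)\<^sup>2)\<^sup>2 \<le> 2 * \<bar>x\<bar> / R" for x
  proof -
    have "0 \<le> (p x)\<^sup>2" "(p x)\<^sup>2 \<le> 1" using p[of x] by (auto simp: power_le_one)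
    then have "(1 - (p x)\<^sup>2)\<^sup>2 \<le> 1 - (p x)\<^sup>2"
      using mult_left_le[of "1 - (p x)\<^sup>2" "1 - (p x)\<^sup>2"] by (simp add: power2_eq_square)
    also have "\<dots> \<le> 2 * \<bar>x / R\<bar>"
    proof (cases "\<bar>x / R\<bar> \<ge> 1")
      case True
      then show ?thesis using zero_le_power2[of "p x"] by linarith
    next
      case False
      define s where "s = \<bar>x / R\<bar>"
      have s: "0 \<le> s" "s \<le> 1" using False by (auto simp: s_def)
      have "(x / R)\<^sup>2 = s\<^sup>2" unfolding s_def by (rule power2_abs[symmetric])
      moreover have s2: "s\<^sup>2 \<le> s" using s by (simp add: power2_eq_square mult_left_le)
      ultimately have px: "p x = 1 - s\<^sup>2" using s by (simp add: p_def)
      have "1 - (p x)\<^sup>2 = 2 * s\<^sup>2 - (s\<^sup>2)\<^sup>2" unfolding px by (simp add: power2_eq_square algebra_simps)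
      also have "\<dots> \<le> 2 * s" using s2 zero_le_power2[of "s\<^sup>2"] by linarith
      finally show ?thesis by (simp add: s_def)
    qed
    finally show ?thesis using assms by (simp add: abs_divide)
  qed
  have psi: "\<bar>\<psi> x\<bar> \<le> 4 / R" for x
  proof (cases "\<bar>x\<bar> \<ge> R")
    case True
    then show ?thesis using p0[OF True] assms by (simp add: \<psi>_def)
  next
    case False
    then have "\<bar>x / R\<bar> \<le> 1" using assms by (simp add: field_simps)
    then have "p x * \<bar>x / R\<bar> \<le> 1" using p[of x] by (intro mult_le_one) auto
    then have "4 / R * (p x * \<bar>x / R\<bar>) \<le> 4 / R * 1" using assms by (intro mult_left_mono) auto
    moreover have "\<bar>\<psi> x\<bar> = 4 / R * (p x * \<bar>x / R\<bar>)" using p[of x] assms by (simp add: \<psi>_def abs_mult)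
    ultimately show ?thesis by simp
  qed
  have "continuous_on UNIV \<psi>" unfolding \<psi>_def p_def by (intro continuous_intros) (use assms in auto)
  then show ?thesis
    using that[of "\<lambda>x. (p x)\<^sup>2" \<psi>] der eta psi p p0 by (simp add: power_le_one)
qed

text \<open>Testing the equation for \<open>u\<close> with \<open>\<eta>\<^sup>2 u\<close> gives \<open>q[\<eta> u] = \<langle>F, \<eta>\<^sup>2 u\<rangle> + \<parallel>\<eta>' u\<parallel>\<^sup>2\<close>, so the part of
  \<open>u\<close> far from the origin is small in the form norm, not only in \<open>L\<^sup>2\<close>.\<close>

lemma (in confining) tail_estimate:
  assumes f: "form_fun I V f g"
    and sol: "\<And>w. w \<in> form_domain I V \<Longrightarrow> sform V (abs_L2R f) w = inner F w"
    and en: "energy f g \<le> 9 / \<kappa> * (norm F)\<^sup>2"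
    and nrm: "norm (abs_L2R f) \<le> 9 / \<kappa> * norm F"
    and m1: "m \<ge> 1" and R: "R \<ge> 1"
    and \<eta>: "\<And>x. (\<eta> has_real_derivative \<psi> x) (at x)" and \<psi>: "continuous_on UNIV \<psi>"
    and \<eta>1: "\<And>x. \<bar>\<eta> x\<bar> \<le> 1" and \<eta>2: "\<And>x. (\<eta> x)\<^sup>2 \<le> 2 * \<bar>x\<bar> / R" and \<psi>R: "\<And>x. \<bar>\<psi> x\<bar> \<le> 4 / R"
  shows "norm (abs_L2R (\<lambda>x. \<eta> x * f x)) \<le> 14 / \<kappa> / sqrt R * norm F"
    and "sform V (abs_L2R (\<lambda>x. \<eta> x * f x)) (abs_L2R (\<lambda>x. \<eta> x * f x)) \<le> 1310 / \<kappa>\<^sup>2 / sqrt R * (norm F)\<^sup>2"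
proof -
  have h: "h1_fun f g" and i: "integrable lborel (\<lambda>x. V x * (f x)\<^sup>2)" using f by (auto simp: form_fun_def)
  have sq: "sq_int f" "sq_int g" using h by (auto simp: h1_fun_def)
  note [measurable] = sq_int_measurable[OF sq(1)] sq_int_measurable[OF sq(2)]
  note [measurable] = DERIV_borel_measurable[OF \<eta>]
  have [measurable]: "\<psi> \<in> borel_measurable borel" using \<psi> by (rule borel_measurable_continuous_onI)
  note f1 = form_fun_mult_C1[OF f \<eta> \<psi> \<eta>1 \<psi>R]
  note f2 = form_fun_mult_C1[OF f1 \<eta> \<psi> \<eta>1 \<psi>R]
  have sq1: "sq_int (\<lambda>x. \<eta> x * f x)" and sq2: "sq_int (\<lambda>x. \<eta> x * (\<eta> x * f x))"
    using f1 f2 by (auto simp: form_fun_def h1_fun_def)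
  define N where "N = norm (abs_L2R (\<lambda>x. \<eta> x * f x))"
  have wint: "integrable lborel (\<lambda>t. \<bar>t\<bar> powr m * (f t)\<^sup>2)" by (rule weight_integrable[OF f])
  have "N\<^sup>2 = (LBINT x. (\<eta> x * f x)\<^sup>2)" unfolding N_def by (rule norm_abs_L2R[OF sq1])
  also have "\<dots> \<le> (LBINT x. 2 / R * ((f x)\<^sup>2 + \<bar>x\<bar> powr m * (f x)\<^sup>2))"
  proof (rule integral_mono)
    show "integrable lborel (\<lambda>x. (\<eta> x * f x)\<^sup>2)" by (rule sq_int_integrable[OF sq1])
    show "integrable lborel (\<lambda>x. 2 / R * ((f x)\<^sup>2 + \<bar>x\<bar> powr m * (f x)\<^sup>2))"
      by (intro integrable_mult_right Bochner_Integration.integrable_add wint sq_int_integrable sq)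
    fix x
    \<comment> \<open>Here \<open>m \<ge> 1\<close> enters: the linear bound on the cutoff is
      absorbed by the weight of the form.\<close>
    have "\<bar>x\<bar> \<le> 1 + \<bar>x\<bar> powr m"
    proof (cases "\<bar>x\<bar> \<le> 1")
      case False
      then have "\<bar>x\<bar> powr 1 \<le> \<bar>x\<bar> powr m" using m1 by (intro powr_mono) auto
      then show ?thesis using False by simp
    qed (simp add: add_increasing2)
    then have "2 * \<bar>x\<bar> / R \<le> 2 / R * (1 + \<bar>x\<bar> powr m)" using R by (simp add: field_simps)
    then have "(\<eta> x)\<^sup>2 \<le> 2 / R * (1 + \<bar>x\<bar> powr m)" using \<eta>2[of x] by linarith
    from mult_right_mono[OF this, of "(f x)\<^sup>2"]
    show "(\<eta> x * f x)\<^sup>2 \<le> 2 / R * ((f x)\<^sup>2 + \<bar>x\<bar> powr m * (f x)\<^sup>2)"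
      by (simp add: power_mult_distrib algebra_simps)
  qed
  also have "\<dots> = 2 / R * ((LBINT x. (f x)\<^sup>2) + (LBINT x. \<bar>x\<bar> powr m * (f x)\<^sup>2))"
    using wint sq_int_integrable[OF sq(1)] by simp
  also have "\<dots> \<le> 2 / R * (9 / \<kappa> * (9 / \<kappa> * (norm F)\<^sup>2) + 1 / \<kappa> * (9 / \<kappa> * (norm F)\<^sup>2))"
  proof (intro mult_left_mono add_mono)
    have "9 / \<kappa> * energy f g \<le> 9 / \<kappa> * (9 / \<kappa> * (norm F)\<^sup>2)" by (rule mult_left_mono[OF en]) (use \<kappa> in auto)
    then show "(LBINT x. (f x)\<^sup>2) \<le> 9 / \<kappa> * (9 / \<kappa> * (norm F)\<^sup>2)" using norm_le[OF f] by linarith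
    have "1 / \<kappa> * energy f g \<le> 1 / \<kappa> * (9 / \<kappa> * (norm F)\<^sup>2)" by (rule mult_left_mono[OF en]) (use \<kappa> in auto)
    moreover have "(LBINT t. \<bar>t\<bar> powr m * (f t)\<^sup>2) \<le> energy f g / \<kappa>"
    proof -
      have "(LBINT t. (g t)\<^sup>2) \<ge> 0" by simp
      then show ?thesis using weight_le[OF f] by linarith
    qed
    ultimately show "(LBINT x. \<bar>x\<bar> powr m * (f x)\<^sup>2) \<le> 1 / \<kappa> * (9 / \<kappa> * (norm F)\<^sup>2)" by simp
  qed (use R in auto)
  also have "\<dots> = 180 / (\<kappa>\<^sup>2 * R) * (norm F)\<^sup>2" using \<kappa> R by (simp add: field_simps power2_eq_square)
  \<comment> \<open>The L^2 norm contributes 81 and the weighted norm 9; doubled this is 180,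
    rounded up to the square of 14.\<close>
  also have "\<dots> \<le> 196 / (\<kappa>\<^sup>2 * R) * (norm F)\<^sup>2" using \<kappa> R by (intro mult_right_mono divide_right_mono) auto
  also have "\<dots> = (14 / \<kappa> / sqrt R * norm F)\<^sup>2" using R by (simp add: power_mult_distrib power_divide)
  finally have N2: "N\<^sup>2 \<le> (14 / \<kappa> / sqrt R * norm F)\<^sup>2" .
  then have N_le: "N \<le> 14 / \<kappa> / sqrt R * norm F" by (rule power2_le_imp_le) (use \<kappa> R in auto)
  then show "norm (abs_L2R (\<lambda>x. \<eta> x * f x)) \<le> 14 / \<kappa> / sqrt R * norm F" by (simp add: N_def)
  have eta2: "(\<eta> x)\<^sup>2 \<le> 1" for x using \<eta>1[of x] by (simp add: abs_square_le_1)
  have norm2: "norm (abs_L2R (\<lambda>x. \<eta> x * (\<eta> x * f x))) \<le> N"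
  proof (rule power2_le_imp_le)
    have "(LBINT x. (\<eta> x * (\<eta> x * f x))\<^sup>2) \<le> (LBINT x. (\<eta> x * f x)\<^sup>2)"
    proof (rule integral_mono[OF sq_int_integrable[OF sq2] sq_int_integrable[OF sq1]])
      show "(\<eta> x * (\<eta> x * f x))\<^sup>2 \<le> (\<eta> x * f x)\<^sup>2" for x
        using mult_right_mono[OF eta2[of x], of "(\<eta> x * f x)\<^sup>2"] by (simp add: power_mult_distrib)
    qed
    then show "(norm (abs_L2R (\<lambda>x. \<eta> x * (\<eta> x * f x))))\<^sup>2 \<le> N\<^sup>2"
      by (simp add: N_def norm_abs_L2R sq1 sq2)
  qed (simp add: N_def)
  have sqp: "sq_int (\<lambda>x. \<psi> x * f x)" by (rule sq_int_mult_bounded[OF sq(1) _ \<psi>R]) simp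
  have sq_d1: "sq_int (\<lambda>x. \<eta> x * g x + \<psi> x * f x)"
    and sq_d2: "sq_int (\<lambda>x. \<eta> x * (\<eta> x * g x + \<psi> x * f x) + \<psi> x * (\<eta> x * f x))"
    using f1 f2 by (auto simp: form_fun_def h1_fun_def)
  have "sform V (abs_L2R (\<lambda>x. \<eta> x * f x)) (abs_L2R (\<lambda>x. \<eta> x * f x))
      = (LBINT x. (\<eta> x * g x + \<psi> x * f x)\<^sup>2) + (LBINT x. V x * (\<eta> x * f x)\<^sup>2)"
    by (rule sform_square[OF f1])
  \<comment> \<open>Localisation identity: the square of the derivative of \<open>\<eta> f\<close>
    is the product of the derivatives of \<open>f\<close> and of \<open>\<eta>\<close> squared times
    \<open>f\<close>, plus the square of \<open>\<psi> f\<close>.\<close>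
  also have "(LBINT x. (\<eta> x * g x + \<psi> x * f x)\<^sup>2)
      = (LBINT x. g x * (\<eta> x * (\<eta> x * g x + \<psi> x * f x) + \<psi> x * (\<eta> x * f x)) + (\<psi> x * f x)\<^sup>2)"
    by (rule Bochner_Integration.integral_cong) (auto simp: power2_eq_square algebra_simps)
  also have "\<dots> = (LBINT x. g x * (\<eta> x * (\<eta> x * g x + \<psi> x * f x) + \<psi> x * (\<eta> x * f x)))
      + (LBINT x. (\<psi> x * f x)\<^sup>2)"
    by (rule Bochner_Integration.integral_add[OF sq_int_mult[OF sq(2) sq_d2] sq_int_integrable[OF sqp]])
  also have "(LBINT x. V x * (\<eta> x * f x)\<^sup>2) = (LBINT x. V x * (f x * (\<eta> x * (\<eta> x * f x))))"
    by (rule Bochner_Integration.integral_cong) (auto simp: power2_eq_square)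
  also have "(LBINT x. g x * (\<eta> x * (\<eta> x * g x + \<psi> x * f x) + \<psi> x * (\<eta> x * f x)))
      + (LBINT x. (\<psi> x * f x)\<^sup>2) + (LBINT x. V x * (f x * (\<eta> x * (\<eta> x * f x))))
      = sform V (abs_L2R f) (abs_L2R (\<lambda>x. \<eta> x * (\<eta> x * f x))) + (LBINT x. (\<psi> x * f x)\<^sup>2)"
    using sform_abs[OF V_measurable h f2[unfolded form_fun_def, THEN conjunct1]] by simp
  also have "sform V (abs_L2R f) (abs_L2R (\<lambda>x. \<eta> x * (\<eta> x * f x))) = inner F (abs_L2R (\<lambda>x. \<eta> x * (\<eta> x * f x)))"
    by (rule sol) (use f2 in \<open>auto simp: form_domain_def\<close>)
  also have "\<dots> \<le> norm F * (14 / \<kappa> / sqrt R * norm F)"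
    using norm2 N_le by (intro order_trans[OF norm_cauchy_schwarz] mult_left_mono) auto
  also have "(LBINT x. (\<psi> x * f x)\<^sup>2) \<le> (LBINT x. (4 / R)\<^sup>2 * (f x)\<^sup>2)"
  proof (rule integral_mono[OF sq_int_integrable[OF sqp]])
    show "integrable lborel (\<lambda>x. (4 / R)\<^sup>2 * (f x)\<^sup>2)" by (intro integrable_mult_right sq_int_integrable sq)
    show "(\<psi> x * f x)\<^sup>2 \<le> (4 / R)\<^sup>2 * (f x)\<^sup>2" for x
    proof -
      have "(\<psi> x)\<^sup>2 \<le> (4 / R)\<^sup>2" using \<psi>R[of x] by (metis abs_ge_zero power2_abs power_mono)
      then show ?thesis by (simp add: power_mult_distrib mult_right_mono)
    qed
  qed
  also have "(LBINT x. (4 / R)\<^sup>2 * (f x)\<^sup>2) = (4 / R)\<^sup>2 * (norm (abs_L2R f))\<^sup>2"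
    by (simp add: norm_abs_L2R sq)
  also have "\<dots> \<le> (4 / R)\<^sup>2 * (9 / \<kappa> * norm F)\<^sup>2"
    by (intro mult_left_mono power_mono nrm) auto
  also have "(4 / R)\<^sup>2 * (9 / \<kappa> * norm F)\<^sup>2 = 1 / R\<^sup>2 * (1296 / \<kappa>\<^sup>2 * (norm F)\<^sup>2)"
    by (simp add: power_mult_distrib power_divide)
  \<comment> \<open>As \<open>R \<ge> 1\<close>, the better decay of the cutoff term is weakened to
    that of the source term. Its constant 1296 is 16 times 81, and adding 14 gives 1310.\<close>
  also have "\<dots> \<le> 1 / sqrt R * (1296 / \<kappa>\<^sup>2 * (norm F)\<^sup>2)"
  proof (intro mult_right_mono divide_left_mono)
    have "R * 1 \<le> R * R" using R by (intro mult_left_mono) auto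
    moreover have "sqrt R \<le> R" using R by (simp add: real_le_lsqrt power2_eq_square)
    ultimately show "sqrt R \<le> R\<^sup>2" by (simp add: power2_eq_square)
  qed (use R in auto)
  also have "norm F * (14 / \<kappa> / sqrt R * norm F) = 14 / \<kappa> * (1 / sqrt R * (norm F)\<^sup>2)"
    by (simp add: power2_eq_square)
  also have "\<dots> \<le> 14 / \<kappa>\<^sup>2 * (1 / sqrt R * (norm F)\<^sup>2)"
  proof (intro mult_right_mono divide_left_mono)
    show "\<kappa>\<^sup>2 \<le> \<kappa>" using \<kappa> by (simp add: power2_eq_square mult_left_le)
  qed (use \<kappa> R in auto)
  finally show "sform V (abs_L2R (\<lambda>x. \<eta> x * f x)) (abs_L2R (\<lambda>x. \<eta> x * f x)) \<le> 1310 / \<kappa>\<^sup>2 / sqrt R * (norm F)\<^sup>2"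
    by (simp add: add_divide_distrib[symmetric] mult.commute[of "sqrt R"] flip: distrib_right)
qed

lemma blinfun_graph_inject: "blinfun_graph A = blinfun_graph B \<Longrightarrow> A = B"
  by (metis the_blinfun_graph)

text \<open>With \<open>u = A F\<close>, \<open>w = A' G\<close> and a cutoff \<open>\<phi>\<close> supported where both potentials are close,
  \<open>\<langle>F, A' G\<rangle> - \<langle>A F, G\<rangle> = q[(1 - \<phi>) u, w] - \<langle>(1 - \<phi>) u, G\<rangle> + \<integral> (q - V) \<phi> u w\<close>.\<close>

lemma resolvent_difference:
  assumes H: "confining q \<kappa> m" and H': "confining V \<kappa> m" and m1: "m \<ge> 1" and R: "R \<ge> 1"
    and q_le: "\<And>x. q x \<le> K * \<bar>x\<bar> powr m" and K: "K \<ge> 0"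
    and sub: "{-R<..<R} \<subseteq> I"
    and qint: "set_integrable lborel {-R..R} q" and Vint: "set_integrable lborel {-R..R} V"
    and \<sigma>: "(LBINT x:{-R..R}. \<bar>q x - V x\<bar>) \<le> \<sigma>"
    and A: "solution_graph (form_domain UNIV q) (sform q) = blinfun_graph A"
    and A': "solution_graph (form_domain I V) (sform V) = blinfun_graph A'"
  shows "norm (A' - A) \<le> sqrt (1310 / \<kappa>\<^sup>2 / sqrt R * ((1 + K / \<kappa>) * (9 / \<kappa>))) + 14 / \<kappa> / sqrt R + 36 / \<kappa>\<^sup>2 * \<sigma>"
    (is "_ \<le> ?b")
proof -
  interpret q: confining UNIV q \<kappa> m by (rule H)
  interpret v: confining I V \<kappa> m by (rule H')
  note \<kappa> = q.\<kappa>
  note [measurable] = q.V_measurable v.V_measurable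
  obtain A0 where A0: "solution_graph (form_domain UNIV q) (sform q) = blinfun_graph A0"
    "\<And>F. A0 F \<in> form_domain UNIV q" "\<And>F w. w \<in> form_domain UNIV q \<Longrightarrow> sform q (A0 F) w = inner F w"
    "\<And>F. sform q (A0 F) (A0 F) \<le> 9 / \<kappa> * (norm F)\<^sup>2" "\<And>F. norm (A0 F) \<le> 9 / \<kappa> * norm F"
    by (rule q.exists_solution_operator) (rule that)
  \<comment> \<open>The given operators are known only through their graphs; identifying them with
    the constructed ones transfers the bounds.\<close>
  have "A0 = A" using A0(1) A by (intro blinfun_graph_inject) simp
  note A = A0(2-)[unfolded this]
  obtain A1 where A1: "solution_graph (form_domain I V) (sform V) = blinfun_graph A1"
    "\<And>F. A1 F \<in> form_domain I V" "\<And>F w. w \<in> form_domain I V \<Longrightarrow> sform V (A1 F) w = inner F w"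
    "\<And>F. sform V (A1 F) (A1 F) \<le> 9 / \<kappa> * (norm F)\<^sup>2" "\<And>F. norm (A1 F) \<le> 9 / \<kappa> * norm F"
    by (rule v.exists_solution_operator) (rule that)
  have "A1 = A'" using A1(1) A' by (intro blinfun_graph_inject) simp
  note A' = A1(2-)[unfolded this]
  have \<sigma>0: "\<sigma> \<ge> 0"
  proof -
    have "(LBINT x:{-R..R}. \<bar>q x - V x\<bar>) \<ge> 0" unfolding set_lebesgue_integral_def by simp
    then show ?thesis using \<sigma> by linarith
  qed
  have b0: "?b \<ge> 0" using \<kappa> K R \<sigma>0 by (intro add_nonneg_nonneg mult_nonneg_nonneg) auto
  have R0: "R > 0" using R by simp
  obtain \<phi> \<psi> where \<phi>: "\<And>x. (\<phi> has_real_derivative \<psi> x) (at x)" and \<psi>: "continuous_on UNIV \<psi>"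
    and \<phi>01: "\<And>x. 0 \<le> \<phi> x" "\<And>x. \<phi> x \<le> 1" and \<phi>0: "\<And>x. \<bar>x\<bar> \<ge> R \<Longrightarrow> \<phi> x = 0"
    and \<eta>2: "\<And>x. (1 - \<phi> x)\<^sup>2 \<le> 2 * \<bar>x\<bar> / R" and \<psi>R: "\<And>x. \<bar>\<psi> x\<bar> \<le> 4 / R"
    by (rule exists_cutoff[OF R0]) (rule that)
  have \<eta>: "((\<lambda>x. 1 - \<phi> x) has_real_derivative - \<psi> x) (at x)" for x
    using \<phi> by (auto intro!: derivative_eq_intros)
  have c\<psi>: "continuous_on UNIV (\<lambda>x. - \<psi> x)" using \<psi> by (rule continuous_on_minus)
  have \<phi>1: "\<bar>\<phi> x\<bar> \<le> 1" and \<eta>1: "\<bar>1 - \<phi> x\<bar> \<le> 1" and \<psi>R': "\<bar>- \<psi> x\<bar> \<le> 4 / R" for x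
    using \<phi>01[of x] \<psi>R[of x] by auto
  note [measurable] = DERIV_borel_measurable[OF \<phi>]
  have main: "\<bar>inner F (A' G) - inner (A F) G\<bar> \<le> ?b * (norm F * norm G)" for F G
  proof -
    obtain f g where f: "A F = abs_L2R f" "form_fun UNIV q f g"
      using A(1)[of F] unfolding form_domain_def by blast
    obtain k l where k: "A' G = abs_L2R k" "form_fun I V k l"
      using A'(1)[of G] unfolding form_domain_def by blast
    have hf: "h1_fun f g" and hk: "h1_fun k l" using f k by (auto simp: form_fun_def)
    then have sq: "sq_int f" "sq_int k" by (auto simp: h1_fun_def)
    note [measurable] = sq_int_measurable[OF sq(1)] sq_int_measurable[OF sq(2)]
    have enF: "q.energy f g \<le> 9 / \<kappa> * (norm F)\<^sup>2" using A(3)[of F] q.sform_square[OF f(2)] f(1) by simp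
    have enG: "v.energy k l \<le> 9 / \<kappa> * (norm G)\<^sup>2" using A'(3)[of G] v.sform_square[OF k(2)] k(1) by simp
    have q_w: "q x * (k x)\<^sup>2 \<le> K * (\<bar>x\<bar> powr m * (k x)\<^sup>2)" for x
      using mult_right_mono[OF q_le[of x], of "(k x)\<^sup>2"] by (simp add: mult.assoc)
    have w: "integrable lborel (\<lambda>x. K * (\<bar>x\<bar> powr m * (k x)\<^sup>2))"
      using v.weight_integrable[OF k(2)] by simp
    \<comment> \<open>\<open>A' G\<close> lies in the domain of the limit form without any cutoff:
      \<open>q\<close> is at most \<open>K\<close> times the weight, which the form of
      \<open>V\<close> controls.\<close>
    have qk: "integrable lborel (\<lambda>x. q x * (k x)\<^sup>2)"
    proof (rule Bochner_Integration.integrable_bound[OF w])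
      show "AE x in lborel. norm (q x * (k x)\<^sup>2) \<le> norm (K * (\<bar>x\<bar> powr m * (k x)\<^sup>2))"
        using q_w q.V_nonneg K by (intro AE_I2) simp
    qed simp
    have kq: "form_fun UNIV q k l" using hk qk by (simp add: form_fun_def)
    have kq_dom: "abs_L2R k \<in> form_domain UNIV q" using kq by (auto simp: form_domain_def)
    have enk: "sform q (abs_L2R k) (abs_L2R k) \<le> (1 + K / \<kappa>) * (9 / \<kappa>) * (norm G)\<^sup>2"
    proof -
      have l2: "(LBINT x. (l x)\<^sup>2) \<ge> 0" by simp
      have V2: "(LBINT x. V x * (k x)\<^sup>2) \<ge> 0" using v.V_nonneg by (intro integral_nonneg_AE AE_I2) simp
      have "(LBINT x. q x * (k x)\<^sup>2) \<le> (LBINT x. K * (\<bar>x\<bar> powr m * (k x)\<^sup>2))"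
        by (rule integral_mono[OF qk w q_w])
      also have "\<dots> = K * (LBINT x. \<bar>x\<bar> powr m * (k x)\<^sup>2)" by simp
      also have "\<dots> \<le> K * (v.energy k l / \<kappa>)"
        using v.weight_le[OF k(2)] l2 K by (intro mult_left_mono) linarith+
      finally have "sform q (abs_L2R k) (abs_L2R k) \<le> v.energy k l + K / \<kappa> * v.energy k l"
        using q.sform_square[OF kq] V2 by simp
      also have "\<dots> = (1 + K / \<kappa>) * v.energy k l" by (simp add: distrib_right)
      also have "\<dots> \<le> (1 + K / \<kappa>) * (9 / \<kappa> * (norm G)\<^sup>2)"
        using K \<kappa> by (intro mult_left_mono enG) auto
      finally show ?thesis by (simp only: mult.assoc)
    qed
    note ff = q.form_fun_mult_C1[OF f(2) \<phi> \<psi> \<phi>1 \<psi>R]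
    note fe = q.form_fun_mult_C1[OF f(2) \<eta> c\<psi> \<eta>1 \<psi>R']
    have sqf: "sq_int (\<lambda>x. \<phi> x * f x)" "sq_int (\<lambda>x. (1 - \<phi> x) * f x)"
      using ff fe by (auto simp: form_fun_def h1_fun_def)
    define u1 u2 where "u1 = abs_L2R (\<lambda>x. \<phi> x * f x)" and "u2 = abs_L2R (\<lambda>x. (1 - \<phi> x) * f x)"
    have dom: "u1 \<in> form_domain UNIV q" "u2 \<in> form_domain UNIV q"
      using ff fe unfolding u1_def u2_def form_domain_def by blast+
    have sum: "A F = u1 + u2"
      unfolding u1_def u2_def f(1) abs_L2R_add[OF sqf] by (simp add: left_diff_distrib)
    have supf: "\<bar>f x\<bar> \<le> 6 / \<kappa> * norm F" and supk: "\<bar>k x\<bar> \<le> 6 / \<kappa> * norm G" for x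
      using q.sup_le[OF f(2) enF] v.sup_le[OF k(2) enG] by simp_all
    \<comment> \<open>On the support of the cutoff \<open>V\<close> is only known to be integrable,
      so the energy of \<open>\<phi> f\<close> is finite because \<open>f\<close> is bounded. The
      cutoff vanishes off (-R, R), hence off \<open>I\<close>.\<close>
    have ffV: "form_fun I V (\<lambda>x. \<phi> x * f x) (\<lambda>x. \<phi> x * g x + \<psi> x * f x)"
      unfolding form_fun_def
    proof (intro conjI allI impI)
      show "h1_fun (\<lambda>x. \<phi> x * f x) (\<lambda>x. \<phi> x * g x + \<psi> x * f x)" using ff by (simp add: form_fun_def)
      show "\<phi> x * f x = 0" if "x \<notin> I" for x
      proof -
        have "x \<notin> {-R<..<R}" using that sub by blast
        then show ?thesis using \<phi>0[of x] by auto
      qed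
      show "integrable lborel (\<lambda>x. V x * (\<phi> x * f x)\<^sup>2)"
      proof (rule Bochner_Integration.integrable_bound)
        show "integrable lborel (\<lambda>x. (6 / \<kappa> * norm F)\<^sup>2 * (indicator {-R..R} x *\<^sub>R V x))"
          using Vint unfolding set_integrable_def by (rule integrable_mult_right)
        have "V x * (\<phi> x * f x)\<^sup>2 \<le> (6 / \<kappa> * norm F)\<^sup>2 * (indicator {-R..R} x *\<^sub>R V x)" for x
        proof (cases "x \<in> {-R..R}")
          case True
          have "\<bar>\<phi> x * f x\<bar> \<le> 1 * (6 / \<kappa> * norm F)"
            unfolding abs_mult by (intro mult_mono \<phi>1 supf) auto
          then have "(\<phi> x * f x)\<^sup>2 \<le> (6 / \<kappa> * norm F)\<^sup>2"
            by (metis abs_ge_zero mult_1 power2_abs power_mono)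
          from mult_left_mono[OF this v.V_nonneg[of x]] True show ?thesis by (simp add: mult.commute)
        next
          case False
          then have "\<bar>x\<bar> \<ge> R" by auto
          then show ?thesis using \<phi>0[of x] False by simp
        qed
        then show "AE x in lborel. norm (V x * (\<phi> x * f x)\<^sup>2)
            \<le> norm ((6 / \<kappa> * norm F)\<^sup>2 * (indicator {-R..R} x *\<^sub>R V x))"
          using v.V_nonneg by (intro AE_I2) (simp add: abs_mult)
      qed simp
    qed
    have u1V: "u1 \<in> form_domain I V" using ffV unfolding u1_def form_domain_def by blast
    \<comment> \<open>The equation for \<open>A F\<close> is tested with all of \<open>A' G\<close>,
      the one for \<open>A' G\<close> only with \<open>u1\<close>, the part of \<open>A F\<close>
      that lies in its form domain; \<open>u2\<close> is left over.\<close>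
    have e1: "inner F (A' G) = sform q u1 (abs_L2R k) + sform q u2 (abs_L2R k)"
      using A(2)[OF kq_dom, of F] q.add[OF dom kq_dom] by (simp add: k(1) sum)
    have e2: "inner (A F) G = sform V u1 (abs_L2R k) + inner u2 G"
    proof -
      have "inner u1 G = sform V (A' G) u1" using A'(2)[OF u1V, of G] by (simp add: inner_commute)
      also have "\<dots> = sform V u1 (abs_L2R k)" using v.sym[OF A'(1)[of G] u1V] by (simp add: k(1))
      finally show ?thesis by (simp add: sum inner_add_left)
    qed
    have tail: "norm u2 \<le> 14 / \<kappa> / sqrt R * norm F" "sform q u2 u2 \<le> 1310 / \<kappa>\<^sup>2 / sqrt R * (norm F)\<^sup>2"
      unfolding u2_def
      by (rule q.tail_estimate[OF f(2) _ enF _ m1 R \<eta> c\<psi> \<eta>1 \<eta>2 \<psi>R'];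
          use A(2)[of _ F] A(4)[of F] f(1) in simp)+
    have T1: "\<bar>sform q u2 (abs_L2R k)\<bar> \<le> sqrt (1310 / \<kappa>\<^sup>2 / sqrt R * ((1 + K / \<kappa>) * (9 / \<kappa>))) * (norm F * norm G)"
    proof -
      have "(sform q u2 (abs_L2R k))\<^sup>2 \<le> sform q u2 u2 * sform q (abs_L2R k) (abs_L2R k)"
        by (rule q.Cauchy_Schwarz_form[OF dom(2) kq_dom])
      also have "\<dots> \<le> (1310 / \<kappa>\<^sup>2 / sqrt R * (norm F)\<^sup>2) * ((1 + K / \<kappa>) * (9 / \<kappa>) * (norm G)\<^sup>2)"
        by (rule mult_mono[OF tail(2) enk]) (use R q.nonneg[OF kq_dom] in auto)
      also have "\<dots> = (1310 / \<kappa>\<^sup>2 / sqrt R * ((1 + K / \<kappa>) * (9 / \<kappa>))) * (norm F * norm G)\<^sup>2"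
        by (simp add: power_mult_distrib)
      finally have "\<bar>sform q u2 (abs_L2R k)\<bar>
          \<le> sqrt ((1310 / \<kappa>\<^sup>2 / sqrt R * ((1 + K / \<kappa>) * (9 / \<kappa>))) * (norm F * norm G)\<^sup>2)"
        by (intro real_le_rsqrt) simp
      then show ?thesis unfolding real_sqrt_mult real_sqrt_abs by simp
    qed
    have T2: "\<bar>inner u2 G\<bar> \<le> 14 / \<kappa> / sqrt R * (norm F * norm G)"
      using order_trans[OF Cauchy_Schwarz_ineq2[of u2 G] mult_right_mono[OF tail(1), of "norm G"]]
      by (simp add: mult.assoc)
    have T3: "\<bar>sform q u1 (abs_L2R k) - sform V u1 (abs_L2R k)\<bar> \<le> 36 / \<kappa>\<^sup>2 * \<sigma> * (norm F * norm G)"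
    proof -
      have h1: "h1_fun (\<lambda>x. \<phi> x * f x) (\<lambda>x. \<phi> x * g x + \<psi> x * f x)" using ff by (simp add: form_fun_def)
      have iq: "integrable lborel (\<lambda>x. q x * (\<phi> x * f x * k x))"
        by (rule weighted_product_integrable) (use ff qk q.V_nonneg in \<open>auto simp: form_fun_def\<close>)
      have iV: "integrable lborel (\<lambda>x. V x * (\<phi> x * f x * k x))"
        by (rule weighted_product_integrable) (use ffV k v.V_nonneg in \<open>auto simp: form_fun_def\<close>)
      have id: "integrable lborel (\<lambda>x. indicator {-R..R} x *\<^sub>R \<bar>q x - V x\<bar>)"
        using set_integrable_abs[OF set_integral_diff(1)[OF qint Vint]] by (simp add: set_integrable_def)
      have eq: "sform q u1 (abs_L2R k) - sform V u1 (abs_L2R k)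
          = (LBINT x. q x * (\<phi> x * f x * k x) - V x * (\<phi> x * f x * k x))"
        unfolding u1_def sform_abs[OF q.V_measurable h1 hk] sform_abs[OF v.V_measurable h1 hk]
        using iq iV by simp
      \<comment> \<open>The factor 36 is the product of the two sup bounds; with \<open>f\<close>
        and \<open>k\<close> bounded, only the L^1 distance of the potentials on [-R, R]
        matters.\<close>
      have "\<bar>LBINT x. q x * (\<phi> x * f x * k x) - V x * (\<phi> x * f x * k x)\<bar> \<le> (LBINT x. 36 / \<kappa>\<^sup>2 * (norm F * norm G) * (indicator {-R..R} x *\<^sub>R \<bar>q x - V x\<bar>))"
      proof (rule integral_abs_bound_integral)
        show "integrable lborel (\<lambda>x. q x * (\<phi> x * f x * k x) - V x * (\<phi> x * f x * k x))" using iq iV by simp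
        show "integrable lborel (\<lambda>x. 36 / \<kappa>\<^sup>2 * (norm F * norm G) * (indicator {-R..R} x *\<^sub>R \<bar>q x - V x\<bar>))"
          using id by (rule integrable_mult_right)
        fix x
        show "\<bar>q x * (\<phi> x * f x * k x) - V x * (\<phi> x * f x * k x)\<bar>
            \<le> 36 / \<kappa>\<^sup>2 * (norm F * norm G) * (indicator {-R..R} x *\<^sub>R \<bar>q x - V x\<bar>)"
        proof (cases "x \<in> {-R..R}")
          case True
          have "\<bar>\<phi> x * f x * k x\<bar> \<le> 1 * (6 / \<kappa> * norm F) * (6 / \<kappa> * norm G)"
            unfolding abs_mult by (intro mult_mono \<phi>1 supf supk) (use \<kappa> in auto)
          then have "\<bar>q x - V x\<bar> * \<bar>\<phi> x * f x * k x\<bar> \<le> \<bar>q x - V x\<bar> * (1 * (6 / \<kappa> * norm F) * (6 / \<kappa> * norm G))"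
            by (rule mult_left_mono) simp
          moreover have "\<bar>q x * (\<phi> x * f x * k x) - V x * (\<phi> x * f x * k x)\<bar> = \<bar>q x - V x\<bar> * \<bar>\<phi> x * f x * k x\<bar>"
            by (simp only: abs_mult[symmetric] left_diff_distrib)
          ultimately show ?thesis using True by (simp add: power2_eq_square mult_ac)
        next
          case False
          then have "\<bar>x\<bar> \<ge> R" by auto
          then show ?thesis using \<phi>0[of x] False by simp
        qed
      qed
      also have "\<dots> = 36 / \<kappa>\<^sup>2 * (norm F * norm G) * (LBINT x:{-R..R}. \<bar>q x - V x\<bar>)"
        unfolding set_lebesgue_integral_def by (rule integral_mult_right_zero)
      also have "\<dots> \<le> 36 / \<kappa>\<^sup>2 * (norm F * norm G) * \<sigma>"
        by (intro mult_left_mono \<sigma>) auto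
      also have "\<dots> = 36 / \<kappa>\<^sup>2 * \<sigma> * (norm F * norm G)" by (simp only: mult_ac)
      finally show ?thesis unfolding eq .
    qed
    have "\<bar>inner F (A' G) - inner (A F) G\<bar>
        \<le> \<bar>sform q u2 (abs_L2R k)\<bar> + \<bar>inner u2 G\<bar> + \<bar>sform q u1 (abs_L2R k) - sform V u1 (abs_L2R k)\<bar>"
      unfolding e1 e2 by linarith
    also have "\<dots> \<le> ?b * (norm F * norm G)" using T1 T2 T3 by (simp only: distrib_right)
    finally show ?thesis .
  qed
  show ?thesis
  proof (rule norm_blinfun_bound[OF b0])
    fix G
    \<comment> \<open>Duality with the error itself as test vector: by symmetry of \<open>A\<close>,
      its squared norm is the difference estimated in \<open>main\<close>.\<close>
    define F where "F = (A' - A) G"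
    have "inner F (A G) = inner (A F) G"
      using A(2)[OF A(1)[of G], of F] A(2)[OF A(1)[of F], of G] q.sym[OF A(1)[of F] A(1)[of G]]
      by (simp add: inner_commute)
    then have "norm F * norm F = inner F (A' G) - inner (A F) G"
      by (simp add: F_def blinfun.diff_left inner_diff_right flip: power2_norm_eq_inner power2_eq_square)
        (simp add: power2_norm_eq_inner inner_diff_right)
    also have "\<dots> \<le> (?b * norm G) * norm F" using main[of F G] by (simp add: mult_ac)
    finally show "norm ((A' - A) G) \<le> ?b * norm G"
      using b0 by (cases "norm F = 0") (auto simp: F_def)
  qed
qed

section \<open>Dilations and the operators of the theorem\<close>

lemma (in coercive_form) polar_form:
  assumes q: "\<And>u. u \<in> D \<Longrightarrow> q u = B u u" and "u \<in> D" "w \<in> D"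
  shows "(q (u + w) - q (u - w)) / 4 = B u w"
  using assms D_add[of u w] D_diff[of u w]
  by (simp add: add add_right diff diff_right sym[of w u])

lemma energy_form_UNIV:
  assumes [measurable]: "V \<in> borel_measurable borel" and f: "form_fun I V f g"
  shows "energy_form UNIV V (abs_L2R f) = sform V (abs_L2R f) (abs_L2R f)"
proof -
  have h: "h1_fun f g" and i: "integrable lborel (\<lambda>x. V x * (f x)\<^sup>2)" using f by (auto simp: form_fun_def)
  then have sq: "sq_int f" "sq_int g" by (auto simp: h1_fun_def)
  note [measurable] = sq_int_measurable[OF sq(1)] sq_int_measurable[OF sq(2)]
  have "energy_form UNIV V (abs_L2R f) = (LBINT x. (g x)\<^sup>2 + V x * (f x)\<^sup>2)"
    unfolding energy_form_def energy_density_def set_lebesgue_integral_def weak_deriv_UNIV[OF h]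
    by (rule integral_cong_AE) (use rep_abs_AE[OF sq(1)] rep_abs_AE[OF sq(2)] in \<open>auto elim!: eventually_elim2\<close>)
  also have "\<dots> = (LBINT x. (g x)\<^sup>2) + (LBINT x. V x * (f x)\<^sup>2)"
    by (rule Bochner_Integration.integral_add[OF sq_int_integrable[OF sq(2)] i])
  finally show ?thesis
    using sform_abs[OF assms(1) h h] by (simp add: power2_eq_square)
qed

lemma H_form_domain_eq:
  assumes [measurable]: "q_pot M m cp cm \<in> borel_measurable borel"
  shows "H_form_domain M m cp cm = form_domain UNIV (q_pot M m cp cm)"
proof -
  let ?q = "q_pot M m cp cm"
  have iff: "integrable lborel (\<lambda>x. ?q x * (rep_L2R (abs_L2R f) x)\<^sup>2) \<longleftrightarrow> integrable lborel (\<lambda>x. ?q x * (f x)\<^sup>2)"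
    if "h1_fun f g" for f g
  proof -
    have sq: "sq_int f" using that by (simp add: h1_fun_def)
    note [measurable] = sq_int_measurable[OF sq]
    show ?thesis by (rule integrable_cong_AE) (use rep_abs_AE[OF sq] in auto)
  qed
  show ?thesis
  proof (intro set_eqI iffI)
    fix u assume "u \<in> H_form_domain M m cp cm"
    then obtain f g where f: "h1_fun f g" "u = abs_L2R f"
      and i: "integrable lborel (\<lambda>x. ?q x * (rep_L2R u x)\<^sup>2)"
      unfolding H_form_domain_def H1_UNIV_iff by blast
    then have "form_fun UNIV ?q f g" using iff[OF f(1)] by (simp add: form_fun_def)
    then show "u \<in> form_domain UNIV ?q" using f(2) unfolding form_domain_def by blast
  next
    fix u assume "u \<in> form_domain UNIV ?q"
    then obtain f g where f: "form_fun UNIV ?q f g" "u = abs_L2R f" unfolding form_domain_def by blast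
    then have h: "h1_fun f g" by (simp add: form_fun_def)
    then have "u \<in> H1 UNIV" using f(2) H1_UNIV_iff by blast
    moreover have "integrable lborel (\<lambda>x. ?q x * (rep_L2R u x)\<^sup>2)"
      using f iff[OF h] by (simp add: form_fun_def)
    ultimately show "u \<in> H_form_domain M m cp cm" by (simp add: H_form_domain_def)
  qed
qed

lemma H_op_inverse:
  assumes "confining (q_pot M m cp cm) \<kappa> m"
  shows "(H_op M m cp cm)\<inverse> = solution_graph (form_domain UNIV (q_pot M m cp cm)) (sform (q_pot M m cp cm))"
proof -
  let ?q = "q_pot M m cp cm"
  interpret q: confining UNIV ?q \<kappa> m by (rule assms)
  have E: "energy_form UNIV ?q u = sform ?q u u" if "u \<in> form_domain UNIV ?q" for u
    using that energy_form_UNIV[OF q.V_measurable] unfolding form_domain_def by blast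
  have "polar (energy_form UNIV ?q) u w = sform ?q u w"
    if "u \<in> form_domain UNIV ?q" "w \<in> form_domain UNIV ?q" for u w
    unfolding polar_def by (rule q.polar_form[OF E that])
  then show ?thesis
    unfolding H_op_def form_operator_def solution_graph_def H_form_domain_eq[OF q.V_measurable] by auto
qed

section \<open>Unitary dilations of the line\<close>

lemma integral_dilation: "s > 0 \<Longrightarrow> (LBINT t. f (t * s)) = (LBINT x. f x) / (s::real)" for f :: "real \<Rightarrow> real"
  using lborel_integral_real_affine[of s f 0] by (simp add: mult.commute)

lemma integrable_dilation: "s > 0 \<Longrightarrow> integrable lborel (\<lambda>t. f (t * s)) \<longleftrightarrow> integrable lborel f" for f :: "real \<Rightarrow> real" and s :: real
  using lborel_integrable_real_affine_iff[of s f 0] by (simp add: mult.commute)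

definition dil :: "real \<Rightarrow> (real \<Rightarrow> real) \<Rightarrow> real \<Rightarrow> real" where
  "dil s f t = sqrt s * f (t * s)"

definition Dil :: "real \<Rightarrow> L2R \<Rightarrow> L2R" where
  "Dil s u = abs_L2R (dil s (rep_L2R u))"

lemma dil_inverse: "s > 0 \<Longrightarrow> dil (1 / s) (dil s f) = f" "s > 0 \<Longrightarrow> dil s (dil (1 / s) f) = f"
  by (auto simp: dil_def fun_eq_iff real_sqrt_divide)

lemma sq_int_dil:
  assumes "sq_int f" "s > 0"
  shows "sq_int (dil s f)"
proof -
  have [measurable]: "f \<in> borel_measurable borel" using assms(1) by (rule sq_int_measurable)
  have "integrable lborel (\<lambda>t. s * (f (t * s))\<^sup>2)"
    using integrable_dilation[OF assms(2), of "\<lambda>x. (f x)\<^sup>2"] assms by (simp add: sq_int_def)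
  then show ?thesis using assms(2) unfolding sq_int_def dil_def[abs_def] by (simp add: power_mult_distrib)
qed

lemma integral_dil:
  assumes "s > 0"
  shows "(LBINT t. dil s f t * dil s g t) = (LBINT x. f x * g x)"
proof -
  have "dil s f t * dil s g t = s * (f (t * s) * g (t * s))" for t
    using assms by (simp add: dil_def)
  then show ?thesis using integral_dilation[OF assms, of "\<lambda>x. f x * g x"] assms by simp
qed

text \<open>Independence of the representative is read off from the isometry: the squared distance
  of the two dilates equals that of the originals, which is zero.\<close>

lemma Dil_abs:
  assumes "sq_int f" "s > 0"
  shows "Dil s (abs_L2R f) = abs_L2R (dil s f)"
proof -
  define k where "k = rep_L2R (abs_L2R f)"
  have sq: "sq_int k" "sq_int (dil s k)" "sq_int (dil s f)" by (simp_all add: k_def sq_int_dil assms)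
  have "dil s k t - dil s f t = dil s (\<lambda>x. k x - f x) t" for t by (simp add: dil_def right_diff_distrib)
  then have "(LBINT t. (dil s k t - dil s f t)\<^sup>2) = (LBINT x. (k x - f x)\<^sup>2)"
    using integral_dil[OF assms(2), of "\<lambda>x. k x - f x" "\<lambda>x. k x - f x"] by (simp add: power2_eq_square)
  also have "\<dots> = (norm (abs_L2R k - abs_L2R f))\<^sup>2"
    by (simp add: abs_L2R_diff sq assms norm_abs_L2R sq_int_diff)
  also have "\<dots> = 0" by (simp add: k_def)
  finally have "(norm (abs_L2R (dil s k) - abs_L2R (dil s f)))\<^sup>2 = 0"
    by (simp add: abs_L2R_diff sq norm_abs_L2R sq_int_diff)
  then show ?thesis by (simp add: Dil_def k_def)
qed

lemma Dil_inverse: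
  assumes "s > 0"
  shows "Dil s (Dil (1 / s) u) = u" "Dil (1 / s) (Dil s u) = u"
  using assms unfolding Dil_def[of "1 / s" u] Dil_def[of s u]
  by (simp_all add: Dil_abs sq_int_dil dil_inverse del: divide_divide_eq_right)

lemma inner_Dil:
  assumes "s > 0"
  shows "inner (Dil s u) (Dil s w) = inner u w"
  by (simp add: Dil_def inner_abs_L2R sq_int_dil integral_dil assms) (simp add: inner_L2R.rep_eq)

lemma Dil_scaleR:
  assumes "s > 0"
  shows "Dil s (c *\<^sub>R u) = c *\<^sub>R Dil s u"
proof -
  have "Dil s (c *\<^sub>R u) = Dil s (abs_L2R (\<lambda>x. c * rep_L2R u x))"
    using abs_L2R_scaleR[OF sq_int_rep[of u], of c] by simp
  also have "\<dots> = abs_L2R (\<lambda>t. c * dil s (rep_L2R u) t)"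
    using assms by (subst Dil_abs) (auto intro: sq_int_cmult simp: dil_def[abs_def] mult.left_commute)
  also have "\<dots> = c *\<^sub>R Dil s u" using assms by (simp add: Dil_def abs_L2R_scaleR sq_int_dil)
  finally show ?thesis .
qed

text \<open>Chain rule by substitution in the indefinite integral; \<open>dil\<close> is normalised
  as an isometry, so the extra factor \<open>s\<close> appears explicitly.\<close>

lemma h1_fun_dil:
  assumes "h1_fun f g" "s > 0"
  shows "h1_fun (dil s f) (\<lambda>t. s * dil s g t)"
proof -
  have sq: "sq_int f" "sq_int g" and ac: "ac_on UNIV f g" using assms by (auto simp: h1_fun_def)
  have "ac_on UNIV (dil s f) (\<lambda>t. s * dil s g t)"
    unfolding ac_on_def
  proof (intro ballI impI)
    fix x y :: real assume "x \<le> y"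
    have "(LBINT t:{x..y}. s * dil s g t) = (LBINT t. sqrt s * s * (indicator {x * s..y * s} (t * s) *\<^sub>R g (t * s)))"
      unfolding set_lebesgue_integral_def
      by (rule Bochner_Integration.integral_cong) (use assms(2) in \<open>auto simp: dil_def split: split_indicator\<close>)
    also have "\<dots> = sqrt s * (LBINT t. indicator {x * s..y * s} t *\<^sub>R g t)"
      using integral_dilation[OF assms(2), of "\<lambda>t. indicator {x * s..y * s} t *\<^sub>R g t"] assms(2) by simp
    also have "(LBINT t. indicator {x * s..y * s} t *\<^sub>R g t) = f (y * s) - f (x * s)"
      using ac \<open>x \<le> y\<close> assms(2) by (auto simp: ac_on_def set_lebesgue_integral_def)
    finally show "dil s f y - dil s f x = (LBINT t:{x..y}. s * dil s g t)"
      by (simp add: dil_def right_diff_distrib)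
  qed
  then show ?thesis using sq assms(2) by (simp add: h1_fun_def sq_int_dil sq_int_cmult)
qed

lemma form_fun_dil:
  assumes f: "form_fun J W f g" and s: "s > 0"
    and V: "\<And>t. V t = s\<^sup>2 * W (t * s)" and I: "\<And>t. t \<in> I \<longleftrightarrow> t * s \<in> J"
  shows "form_fun I V (dil s f) (\<lambda>t. s * dil s g t)"
proof -
  have "integrable lborel (\<lambda>t. s ^ 3 * (W (t * s) * (f (t * s))\<^sup>2))"
    using f integrable_dilation[OF s, of "\<lambda>x. W x * (f x)\<^sup>2"] by (simp add: form_fun_def)
  moreover have "s ^ 3 * (W (t * s) * (f (t * s))\<^sup>2) = V t * (dil s f t)\<^sup>2" for t
    using s by (simp add: V dil_def power_mult_distrib power3_eq_cube power2_eq_square)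
  ultimately show ?thesis using f s I h1_fun_dil[of f g s] by (auto simp: form_fun_def dil_def)
qed

text \<open>The two derivatives contribute a factor \<open>s\<close> each, and the potential is
  scaled to match. With \<open>s = \<epsilon> powr \<alpha>\<close> the common factor is the
  prefactor in \<open>Q_hat\<close>.\<close>

lemma sform_Dil:
  assumes V_meas: "V \<in> borel_measurable borel" and W_meas: "W \<in> borel_measurable borel" and s: "s > 0"
    and V: "\<And>t. V t = s\<^sup>2 * W (t * s)" and h: "h1_fun f g" "h1_fun f' g'"
  shows "sform V (Dil s (abs_L2R f)) (Dil s (abs_L2R f')) = s\<^sup>2 * sform W (abs_L2R f) (abs_L2R f')"
proof -
  have sq: "sq_int f" "sq_int f'" using h by (auto simp: h1_fun_def)
  have "(LBINT t. s * dil s g t * (s * dil s g' t)) = (LBINT t. s\<^sup>2 * (dil s g t * dil s g' t))"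
    by (simp add: power2_eq_square mult_ac)
  also have "\<dots> = s\<^sup>2 * (LBINT x. g x * g' x)" using integral_dil[OF s, of g g'] by simp
  finally have 1: "(LBINT t. s * dil s g t * (s * dil s g' t)) = s\<^sup>2 * (LBINT x. g x * g' x)" .
  have "(LBINT t. V t * (dil s f t * dil s f' t)) = (LBINT t. s ^ 3 * (W (t * s) * (f (t * s) * f' (t * s))))"
    using s by (intro Bochner_Integration.integral_cong) (auto simp: V dil_def power3_eq_cube power2_eq_square)
  also have "\<dots> = s\<^sup>2 * (LBINT x. W x * (f x * f' x))"
    using integral_dilation[OF s, of "\<lambda>x. W x * (f x * f' x)"] s by (simp add: power3_eq_cube power2_eq_square)
  finally have 2: "(LBINT t. V t * (dil s f t * dil s f' t)) = s\<^sup>2 * (LBINT x. W x * (f x * f' x))" .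
  show ?thesis
    using 1 2 by (simp add: Dil_abs sq s sform_abs[OF W_meas h] distrib_left
        sform_abs[OF V_meas h1_fun_dil[OF h(1) s] h1_fun_dil[OF h(2) s]])
qed

section \<open>The form on the bounded interval and the inverse of its dilated operator\<close>

lemma H10_eq_form_domain:
  assumes "l < r" and [measurable]: "W \<in> borel_measurable borel" and W: "set_integrable lborel {l..r} W"
  shows "H10 l r = form_domain {l<..<r} W"
proof
  show "form_domain {l<..<r} W \<subseteq> H10 l r"
    using h1_fun_imp_H10(1)[OF _ _ assms(1)] unfolding form_domain_def form_fun_def by blast
  show "H10 l r \<subseteq> form_domain {l<..<r} W"
  proof
    fix u assume "u \<in> H10 l r"
    from H10_imp_h1_fun[OF assms(1) this] obtain f g where
      f: "h1_fun f g" "\<And>x. x \<notin> {l<..<r} \<Longrightarrow> f x = 0" "u = abs_L2R f" by metis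
    have cont: "continuous_on {l..r} f" using h1_fun_continuous[OF f(1)] continuous_on_subset by blast
    obtain K where K: "\<And>x. x \<in> {l..r} \<Longrightarrow> \<bar>f x\<bar> \<le> K"
      using continuous_bounded_Icc[OF cont] by blast
    have [measurable]: "f \<in> borel_measurable borel" using f(1) by (auto simp: h1_fun_def dest: sq_int_measurable)
    \<comment> \<open>An H^1 function is bounded on the interval, so integrability of
      \<open>W\<close> makes the potential energy finite, and the form domain is all of
      \<open>H10 l r\<close>.\<close>
    have "integrable lborel (\<lambda>x. W x * (f x)\<^sup>2)"
    proof (rule Bochner_Integration.integrable_bound)
      show "integrable lborel (\<lambda>x. K\<^sup>2 * (indicator {l..r} x *\<^sub>R W x))"
        using W unfolding set_integrable_def by (rule integrable_mult_right)
      have "\<bar>W x\<bar> * (f x)\<^sup>2 \<le> K\<^sup>2 * (indicator {l..r} x * \<bar>W x\<bar>)" for x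
      proof (cases "x \<in> {l..r}")
        case True
        then have "(f x)\<^sup>2 \<le> K\<^sup>2" using K[OF True] by (metis abs_ge_zero power2_abs power_mono)
        then show ?thesis using True by (simp add: mult.commute mult_left_mono)
      next
        case False
        then show ?thesis using f(2)[of x] by auto
      qed
      then show "AE x in lborel. norm (W x * (f x)\<^sup>2) \<le> norm (K\<^sup>2 * (indicator {l..r} x *\<^sub>R W x))"
        by (intro AE_I2) (simp add: abs_mult)
    qed simp
    then show "u \<in> form_domain {l<..<r} W" using f by (auto simp: form_domain_def form_fun_def)
  qed
qed

text \<open>\<open>f\<close> vanishes and \<open>g\<close> vanishes a.e. off the interval, so the
  form there equals the form on the line for any admissible continuation \<open>W\<close> of the
  potential.\<close>

lemma energy_form_Icc:
  assumes "l < r" and [measurable]: "W \<in> borel_measurable borel"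
    and eq: "\<And>x. x \<in> {l..r} \<Longrightarrow> W' x = W x"
    and f: "form_fun {l<..<r} W f g"
  shows "energy_form {l..r} W' (abs_L2R f) = sform W (abs_L2R f) (abs_L2R f)"
proof -
  have h: "h1_fun f g" and z: "\<And>x. x \<notin> {l<..<r} \<Longrightarrow> f x = 0" and i: "integrable lborel (\<lambda>x. W x * (f x)\<^sup>2)"
    using f by (auto simp: form_fun_def)
  then have sq: "sq_int f" "sq_int g" by (auto simp: h1_fun_def)
  note [measurable] = sq_int_measurable[OF sq(1)] sq_int_measurable[OF sq(2)]
  have wd: "weak_deriv {l..r} (abs_L2R f) = abs_L2R g"
    by (rule h1_fun_imp_H10(3)[OF h _ assms(1)]) (rule z)
  have g0: "AE x in lborel. x \<notin> {l..r} \<longrightarrow> g x = 0"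
    by (rule h1_fun_imp_H10(2)[OF h _ assms(1)]) (rule z)
  have "energy_form {l..r} W' (abs_L2R f)
      = (LBINT x. indicator {l..r} x *\<^sub>R ((rep_L2R (abs_L2R g) x)\<^sup>2 + W' x * (rep_L2R (abs_L2R f) x)\<^sup>2))"
    unfolding energy_form_def energy_density_def set_lebesgue_integral_def wd ..
  also have "\<dots> = (LBINT x. indicator {l..r} x *\<^sub>R ((rep_L2R (abs_L2R g) x)\<^sup>2 + W x * (rep_L2R (abs_L2R f) x)\<^sup>2))"
    by (rule Bochner_Integration.integral_cong) (auto simp: eq split: split_indicator)
  also have "\<dots> = (LBINT x. (g x)\<^sup>2 + W x * (f x)\<^sup>2)"
  proof (rule integral_cong_AE)
    show "AE x in lborel. indicator {l..r} x *\<^sub>R ((rep_L2R (abs_L2R g) x)\<^sup>2 + W x * (rep_L2R (abs_L2R f) x)\<^sup>2)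
        = (g x)\<^sup>2 + W x * (f x)\<^sup>2"
      using rep_abs_AE[OF sq(1)] rep_abs_AE[OF sq(2)] g0
      by eventually_elim (use z in \<open>auto split: split_indicator\<close>)
  qed simp_all
  also have "\<dots> = (LBINT x. (g x)\<^sup>2) + (LBINT x. W x * (f x)\<^sup>2)"
    by (rule Bochner_Integration.integral_add[OF sq_int_integrable[OF sq(2)] i])
  finally show ?thesis
    using sform_abs[OF assms(2) h h] by (simp add: power2_eq_square)
qed

lemma form_domain_dilation:
  assumes s: "s > 0" and V: "\<And>t. V t = s\<^sup>2 * W (t * s)" and I: "\<And>t. t \<in> I \<longleftrightarrow> t * s \<in> J"
  shows "form_domain I V = Dil s ` form_domain J W"
proof (intro set_eqI iffI)
  fix u assume "u \<in> Dil s ` form_domain J W"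
  then obtain f g where f: "form_fun J W f g" "u = Dil s (abs_L2R f)" unfolding form_domain_def by blast
  then have "sq_int f" by (simp add: form_fun_def h1_fun_def)
  then show "u \<in> form_domain I V"
    using form_fun_dil[OF f(1) s V I] f(2) s unfolding form_domain_def by (auto simp: Dil_abs)
next
  fix u assume "u \<in> form_domain I V"
  then obtain f g where f: "form_fun I V f g" "u = abs_L2R f" unfolding form_domain_def by blast
  have s': "1 / s > 0" using s by simp
  have W: "W x = (1 / s)\<^sup>2 * V (x * (1 / s))" for x using s by (simp add: V power_divide)
  have J: "x \<in> J \<longleftrightarrow> x * (1 / s) \<in> I" for x using s by (simp add: I)
  have dom: "abs_L2R (dil (1 / s) f) \<in> form_domain J W"
    using form_fun_dil[OF f(1) s' W J] unfolding form_domain_def by blast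
  have "sq_int f" using f by (simp add: form_fun_def h1_fun_def)
  then have "u = Dil s (abs_L2R (dil (1 / s) f))"
    using s by (simp add: Dil_abs sq_int_dil dil_inverse f(2))
  then show "u \<in> Dil s ` form_domain J W" using dom by blast
qed

lemma inner_eq_0_disjoint:
  assumes "u \<in> L2_on A" "w \<in> L2_on (- A)"
  shows "inner u w = 0"
proof -
  have "AE x in lborel. rep_L2R u x * rep_L2R w x = 0"
    using assms by (auto simp: L2_on_def elim!: eventually_elim2)
  then show ?thesis by (simp add: inner_L2R.rep_eq integral_eq_zero_AE)
qed

lemma L2_on_abs:
  assumes "sq_int f" "AE x in lborel. x \<notin> A \<longrightarrow> f x = 0"
  shows "abs_L2R f \<in> L2_on A"
  unfolding L2_on_def using rep_abs_AE[OF assms(1)] assms(2)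
  by (auto elim!: eventually_elim2)

lemma J_dil_eq: "\<epsilon> > 0 \<Longrightarrow> J_dil \<alpha> \<epsilon> = Dil (\<epsilon> powr \<alpha>)"
  by (simp add: fun_eq_iff J_dil_def Dil_def dil_def[abs_def] powr_half_sqrt[symmetric] powr_powr)

text \<open>A right-hand side splits into an inner and an outer part. The outer one is orthogonal to
  the form domain, so the weak equation maps it to zero. For the inner one, the factor by which the
  dilation multiplies the form is exactly the prefactor in \<open>Q_hat\<close>.\<close>

lemma inverse_plus_zero_Q_hat:
  assumes ab: "a > 0" "b > 0" and \<epsilon>: "\<epsilon> > 0"
    and V: "confining V \<kappa> m"
    and eq: "\<And>t. t * \<epsilon> powr \<alpha> \<in> {-a..b} \<Longrightarrow> V t = (\<epsilon> powr \<alpha>)\<^sup>2 * W_pot h h' M \<epsilon> (t * \<epsilon> powr \<alpha>)"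
    and int: "set_integrable lborel {-a..b} (W_pot h h' M \<epsilon>)"
  shows "inverse_plus_zero (I_scaled a b \<alpha> \<epsilon>) (Q_hat a b h h' M \<alpha> \<epsilon>)
    = solution_graph (form_domain (I_scaled a b \<alpha> \<epsilon>) V) (sform V)"
proof -
  define s where "s = \<epsilon> powr \<alpha>"
  define I where "I = I_scaled a b \<alpha> \<epsilon>"
  define J where "J = {-a<..<b}"
  \<comment> \<open>Pulling \<open>V\<close> back continues \<open>W_pot\<close> beyond [-a, b] with
    a lower bound on the whole line.\<close>
  define W where "W x = V (x / s) / s\<^sup>2" for x
  have s: "s > 0" using \<epsilon> by (simp add: s_def)
  have s2: "\<epsilon> powr (2 * \<alpha>) = s\<^sup>2"
    unfolding s_def power2_eq_square powr_add[symmetric] by simp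
  interpret v: confining I V \<kappa> m by (rule V)
  note [measurable] = v.V_measurable
  \<comment> \<open>The pulled-back weight acquires the factor
    \<open>1 / (s\<^sup>2 * s powr m)\<close>; the minimum with \<open>\<kappa>\<close> keeps the
    constant below 1. Its dependence on \<epsilon> is harmless, as it serves only the polarisation
    identity for \<open>W\<close>.\<close>
  define \<kappa>' where "\<kappa>' = min \<kappa> (\<kappa> / (s\<^sup>2 * s powr m))"
  have W_meas [measurable]: "W \<in> borel_measurable borel" unfolding W_def by measurable
  have "confining W \<kappa>' m"
  proof
    show "0 < \<kappa>'" using v.\<kappa> s by (simp add: \<kappa>'_def)
    show "\<kappa>' \<le> 1" using v.\<kappa> by (simp add: \<kappa>'_def)
    show "0 \<le> m" by (rule v.m)
    fix x :: real
    have "\<kappa> * \<bar>x / s\<bar> powr m / s\<^sup>2 \<le> W x"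
      unfolding W_def by (intro divide_right_mono v.V_ge) simp
    moreover have "\<bar>x / s\<bar> powr m = \<bar>x\<bar> powr m / s powr m" using s by (simp add: powr_divide abs_divide)
    ultimately have "\<kappa> / (s\<^sup>2 * s powr m) * \<bar>x\<bar> powr m \<le> W x" by (simp add: field_simps)
    moreover have "\<kappa>' * \<bar>x\<bar> powr m \<le> \<kappa> / (s\<^sup>2 * s powr m) * \<bar>x\<bar> powr m"
      by (intro mult_right_mono) (auto simp: \<kappa>'_def)
    ultimately show "\<kappa>' * \<bar>x\<bar> powr m \<le> W x" by linarith
  qed (rule W_meas)
  then interpret w: confining J W \<kappa>' m .
  have VW: "V t = s\<^sup>2 * W (t * s)" for t using s by (simp add: W_def)
  have W_eq: "W_pot h h' M \<epsilon> x = W x" if "x \<in> {-a..b}" for x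
    using eq[of "x / s"] that s unfolding s_def[symmetric] W_def by simp
  have IJ: "t \<in> I \<longleftrightarrow> t * s \<in> J" for t
    using s by (auto simp: I_def I_scaled_def J_def s_def powr_minus field_simps)
  have ab': "-a < b" using ab by simp
  have ind: "(\<lambda>x. indicator {-a..b} x *\<^sub>R W_pot h h' M \<epsilon> x) = (\<lambda>x. indicator {-a..b} x *\<^sub>R W x)"
    by (auto simp: W_eq fun_eq_iff split: split_indicator)
  have Wint: "set_integrable lborel {-a..b} W"
    using int unfolding set_integrable_def ind .
  have H10: "H10 (-a) b = form_domain J W"
    unfolding J_def by (rule H10_eq_form_domain[OF ab' W_meas Wint])
  have E: "energy_form {-a..b} (W_pot h h' M \<epsilon>) u = sform W u u" if u: "u \<in> form_domain J W" for u
  proof -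
    obtain f g where f: "u = abs_L2R f" "form_fun J W f g" using u unfolding form_domain_def by blast
    then show ?thesis using energy_form_Icc[OF ab' W_meas W_eq, of f g] by (simp add: J_def)
  qed
  have pol: "polar (energy_form {-a..b} (W_pot h h' M \<epsilon>)) u w = sform W u w"
    if "u \<in> form_domain J W" "w \<in> form_domain J W" for u w
    unfolding polar_def by (rule w.polar_form[OF E that])
  have dom: "form_domain I V = Dil s ` form_domain J W"
    by (rule form_domain_dilation[OF s]) (rule VW, rule IJ)
  have sD: "sform V (Dil s u) (Dil s w) = s\<^sup>2 * sform W u w"
    if u: "u \<in> form_domain J W" and w: "w \<in> form_domain J W" for u w
  proof -
    obtain f g where f: "u = abs_L2R f" "h1_fun f g"
      using u unfolding form_domain_def form_fun_def by blast
    obtain f' g' where f': "w = abs_L2R f'" "h1_fun f' g'"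
      using w unfolding form_domain_def form_fun_def by blast
    show ?thesis unfolding f(1) f'(1) by (rule sform_Dil[OF v.V_measurable W_meas s _ f(2) f'(2)]) (rule VW)
  qed
  have Q: "(v, f) \<in> Q_op a b h h' M \<epsilon> \<longleftrightarrow>
      v \<in> form_domain J W \<and> f \<in> L2_on {-a..b} \<and> (\<forall>w\<in>form_domain J W. sform W v w = inner f w)" for v f
    unfolding Q_op_def form_operator_def H10 using pol by auto
  have suppI: "u \<in> L2_on I" if "u \<in> form_domain I V" for u
    using that L2_on_abs unfolding form_domain_def form_fun_def h1_fun_def by fastforce
  have "inverse_plus_zero I (Q_hat a b h h' M \<alpha> \<epsilon>) = solution_graph (form_domain I V) (sform V)"
  proof (intro set_eqI iffI)
    fix p assume "p \<in> inverse_plus_zero I (Q_hat a b h h' M \<alpha> \<epsilon>)"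
    then obtain v f G where p: "p = (s\<^sup>2 *\<^sub>R Dil s f + G, Dil s v + 0)"
      and vf: "(v, f) \<in> Q_op a b h h' M \<epsilon>" and G: "G \<in> L2_on (- I)"
      unfolding inverse_plus_zero_def op_direct_sum_def zero_operator_def Q_hat_def J_dil_eq[OF \<epsilon>] s2 s_def[symmetric]
      by blast
    have v: "v \<in> form_domain J W" and sol: "\<And>w. w \<in> form_domain J W \<Longrightarrow> sform W v w = inner f w"
      using vf Q by auto
    have u: "Dil s v \<in> form_domain I V" using v dom by blast
    have "sform V (Dil s v) w' = inner (s\<^sup>2 *\<^sub>R Dil s f + G) w'" if w': "w' \<in> form_domain I V" for w'
    proof -
      obtain w where w: "w' = Dil s w" "w \<in> form_domain J W" using w' dom by blast
      have "inner w' G = 0" by (rule inner_eq_0_disjoint[OF suppI[OF w'] G])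
      then have "inner (s\<^sup>2 *\<^sub>R Dil s f + G) w' = s\<^sup>2 * inner f w"
        using w s by (simp add: inner_add_left inner_Dil inner_commute[of G])
      then show ?thesis using sD[OF v w(2)] sol[OF w(2)] w(1) by simp
    qed
    then show "p \<in> solution_graph (form_domain I V) (sform V)"
      unfolding p solution_graph_def using u by simp
  next
    fix p assume p: "p \<in> solution_graph (form_domain I V) (sform V)"
    obtain F u where p_eq: "p = (F, u)" by (cases p)
    with p have u: "u \<in> form_domain I V" and sol: "\<And>w. w \<in> form_domain I V \<Longrightarrow> sform V u w = inner F w"
      by (auto simp: solution_graph_def)
    have I_meas: "I \<in> sets borel" "- I \<in> sets borel" by (auto simp: I_def I_scaled_def)
    define FI where "FI = abs_L2R (\<lambda>x. indicator I x * rep_L2R F x)"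
    define G where "G = abs_L2R (\<lambda>x. indicator (- I) x * rep_L2R F x)"
    have sqF: "sq_int (\<lambda>x. indicator I x * rep_L2R F x)" "sq_int (\<lambda>x. indicator (- I) x * rep_L2R F x)"
      by (intro sq_int_indicator sq_int_rep I_meas)+
    have F: "FI + G = F"
    proof -
      have "indicator I x * rep_L2R F x + indicator (- I) x * rep_L2R F x = rep_L2R F x" for x
        by (simp split: split_indicator)
      then show ?thesis unfolding FI_def G_def by (simp add: abs_L2R_add sqF)
    qed
    have G: "G \<in> L2_on (- I)" unfolding G_def by (rule L2_on_abs[OF sqF(2)]) simp
    obtain v where v: "u = Dil s v" "v \<in> form_domain J W" using u dom by blast
    \<comment> \<open>The preimage of the inner part under scaling and dilation; it is supported in
      [-a, b] since the inner part vanishes off \<open>I\<close>.\<close>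
    define f where "f = inverse (s\<^sup>2) *\<^sub>R Dil (1 / s) FI"
    have Df: "s\<^sup>2 *\<^sub>R Dil s f = FI"
      using s by (simp add: f_def Dil_scaleR Dil_inverse)
    have s': "1 / s > 0" using s by simp
    have "Dil (1 / s) FI = abs_L2R (dil (1 / s) (\<lambda>x. indicator I x * rep_L2R F x))"
      unfolding FI_def by (rule Dil_abs[OF sqF(1) s'])
    then have f_eq: "f = abs_L2R (\<lambda>x. inverse (s\<^sup>2) * dil (1 / s) (\<lambda>x. indicator I x * rep_L2R F x) x)"
      unfolding f_def by (simp only: abs_L2R_scaleR[OF sq_int_dil[OF sqF(1) s']])
    have f_supp: "f \<in> L2_on {-a..b}"
      unfolding f_eq
    proof (rule L2_on_abs)
      show "sq_int (\<lambda>x. inverse (s\<^sup>2) * dil (1 / s) (\<lambda>x. indicator I x * rep_L2R F x) x)"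
        by (intro sq_int_cmult sq_int_dil sqF s')
      have "dil (1 / s) (\<lambda>x. indicator I x * rep_L2R F x) x = 0" if "x \<notin> {-a..b}" for x
      proof -
        have "x \<notin> J" using that by (auto simp: J_def)
        then have "x * (1 / s) \<notin> I" using IJ[of "x * (1 / s)"] s by simp
        then show ?thesis by (simp add: dil_def)
      qed
      then show "AE x in lborel. x \<notin> {-a..b} \<longrightarrow> inverse (s\<^sup>2) * dil (1 / s) (\<lambda>x. indicator I x * rep_L2R F x) x = 0"
        by simp
    qed
    have "sform W v w = inner f w" if w: "w \<in> form_domain J W" for w
    proof -
      have w': "Dil s w \<in> form_domain I V" using w dom by blast
      have "s\<^sup>2 * sform W v w = inner F (Dil s w)" using sol[OF w'] sD[OF v(2) w] v(1) by simp
      also have "\<dots> = inner FI (Dil s w)"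
        using inner_eq_0_disjoint[OF suppI[OF w'] G] unfolding F[symmetric]
        by (simp add: inner_add_left inner_commute[of G])
      also have "\<dots> = s\<^sup>2 * inner f w" unfolding Df[symmetric] using s by (simp add: inner_Dil)
      finally show ?thesis using s by simp
    qed
    then have "(v, f) \<in> Q_op a b h h' M \<epsilon>" using Q v(2) f_supp by blast
    then have "(Dil s v, s\<^sup>2 *\<^sub>R Dil s f) \<in> Q_hat a b h h' M \<alpha> \<epsilon>"
      unfolding Q_hat_def J_dil_eq[OF \<epsilon>] s2 s_def[symmetric] by blast
    then have "(FI + G, Dil s v + 0) \<in> inverse_plus_zero I (Q_hat a b h h' M \<alpha> \<epsilon>)"
      using G unfolding Df inverse_plus_zero_def op_direct_sum_def zero_operator_def by blast
    then show "p \<in> inverse_plus_zero I (Q_hat a b h h' M \<alpha> \<epsilon>)" by (simp add: p_eq F v(1))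
  qed
  then show ?thesis by (simp add: I_def)
qed

section \<open>The potentials\<close>

locale width_profile =
  fixes a b M m cp cm :: real and h h' :: "real \<Rightarrow> real"
  assumes a_pos: "a > 0" and b_pos: "b > 0"
    and h_cont: "continuous_on {-a..b} h"
    and h_pos: "\<And>x. x \<in> {-a..b} \<Longrightarrow> h x > 0"
    and h_max: "{x \<in> {-a..b}. \<forall>y\<in>{-a..b}. h y \<le> h x} = {0}"
    and h'_cont: "continuous_on ({-a..b} - {0}) h'"
    and M_pos: "M > 0" and cp_pos: "cp > 0" and cm_pos: "cm > 0" and m_ge: "m \<ge> 1"
    and exp_right: "(\<lambda>x. h x - (M - cp * x powr m)) \<in> O[at_right 0](\<lambda>x. x powr (m + 1))"
    and exp_left: "(\<lambda>x. h x - (M - cm * \<bar>x\<bar> powr m)) \<in> O[at_left 0](\<lambda>x. \<bar>x\<bar> powr (m + 1))"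
    and Q_form: "\<And>\<epsilon>. \<epsilon> > 0 \<Longrightarrow> Q_form_defined a b h h' M \<epsilon>"
begin

abbreviation (input) q :: "real \<Rightarrow> real" where "q \<equiv> q_pot M m cp cm"

definition c :: "real \<Rightarrow> real" where "c x = (if x > 0 then cp else cm)"

definition P :: "real \<Rightarrow> real" where "P x = pi\<^sup>2 * (1 / (h x)\<^sup>2 - 1 / M\<^sup>2)"

definition v :: "real \<Rightarrow> real" where "v x = (pi\<^sup>2 / 3 + 1 / 4) * ((h' x)\<^sup>2 / (h x)\<^sup>2)"

lemma W_pot_eq: "W_pot h h' M \<epsilon> x = P x / \<epsilon>\<^sup>2 + v x"
  by (simp add: W_pot_def P_def v_def)

lemma c_pos: "c x > 0" using cp_pos cm_pos by (simp add: c_def)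

lemma q_pot_eq: "q x = 2 * pi\<^sup>2 / M ^ 3 * (c x * \<bar>x\<bar> powr m)"
  by (auto simp: q_pot_def c_def)

lemma q_pot_measurable [measurable]: "q \<in> borel_measurable borel"
  unfolding q_pot_def[abs_def] by measurable

text \<open>The expansion determines the limit of \<open>h\<close> from the right, and continuity
  identifies it with the value; thus \<open>M\<close> is the maximum of \<open>h\<close>.\<close>

lemma h_0: "h 0 = M"
proof -
  have "0 \<in> interior {-a..b}" using a_pos b_pos by simp
  then have "isCont h 0" using h_cont by (rule continuous_on_interior[rotated])
  then have lim1: "(h \<longlongrightarrow> h 0) (at_right 0)"
    unfolding isCont_def by (rule filterlim_mono[OF _ order_refl at_le]) simp
  have z: "((\<lambda>x::real. x powr p) \<longlongrightarrow> 0) (at_right 0)" if "p > 0" for p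
    by (rule tendsto_zero_powrI[OF tendsto_ident_at tendsto_const _ that]) (auto simp: eventually_at_filter)
  have "((\<lambda>x. h x - (M - cp * x powr m)) \<longlongrightarrow> 0) (at_right 0)"
  proof -
    obtain C where C: "C > 0" "\<forall>\<^sub>F x in at_right 0. norm (h x - (M - cp * x powr m)) \<le> C * norm (x powr (m + 1))"
      using exp_right by (rule landau_o.bigE)
    have "((\<lambda>x::real. C * norm (x powr (m + 1))) \<longlongrightarrow> C * norm (0::real)) (at_right 0)"
      using m_ge by (intro tendsto_intros z) auto
    then have "((\<lambda>x::real. C * norm (x powr (m + 1))) \<longlongrightarrow> 0) (at_right 0)" by simp
    then show ?thesis using C(2) by (rule Lim_null_comparison[rotated])
  qed
  moreover have "((\<lambda>x. M - cp * x powr m) \<longlongrightarrow> M - cp * 0) (at_right 0)"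
    using m_ge by (intro tendsto_intros z) auto
  ultimately have "((\<lambda>x. h x - (M - cp * x powr m) + (M - cp * x powr m)) \<longlongrightarrow> 0 + (M - cp * 0)) (at_right 0)"
    by (rule tendsto_add)
  then have "(h \<longlongrightarrow> M) (at_right 0)" by simp
  then show ?thesis using lim1 tendsto_unique trivial_limit_at_right_real by blast
qed

lemma h_le: "x \<in> {-a..b} \<Longrightarrow> h x \<le> M"
  using h_max h_0 by blast

lemma h_less: "x \<in> {-a..b} \<Longrightarrow> x \<noteq> 0 \<Longrightarrow> h x < M"
  using h_max h_0 h_le by (smt (verit) mem_Collect_eq singletonD)

section \<open>Bounds on the potential from the expansion at the maximum\<close>

lemma expansion:
  obtains C r where "C > 0" "r > 0" "r \<le> 1" "r \<le> a" "r \<le> b"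
    "\<And>x. \<bar>x\<bar> < r \<Longrightarrow> \<bar>M - h x - c x * \<bar>x\<bar> powr m\<bar> \<le> C * \<bar>x\<bar> powr (m + 1)"
proof -
  obtain C1 where C1: "C1 > 0" "\<forall>\<^sub>F x in at_right 0. norm (h x - (M - cp * x powr m)) \<le> C1 * norm (x powr (m + 1))"
    using exp_right by (rule landau_o.bigE)
  obtain C2 where C2: "C2 > 0" "\<forall>\<^sub>F x in at_left 0. norm (h x - (M - cm * \<bar>x\<bar> powr m)) \<le> C2 * norm (\<bar>x\<bar> powr (m + 1))"
    using exp_left by (rule landau_o.bigE)
  from C1(2) obtain r1 where r1: "r1 > 0"
    "\<And>x. 0 < x \<Longrightarrow> x < r1 \<Longrightarrow> norm (h x - (M - cp * x powr m)) \<le> C1 * norm (x powr (m + 1))"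
    unfolding eventually_at_right_field by blast
  from C2(2) obtain r2 where r2: "r2 < 0"
    "\<And>x. r2 < x \<Longrightarrow> x < 0 \<Longrightarrow> norm (h x - (M - cm * \<bar>x\<bar> powr m)) \<le> C2 * norm (\<bar>x\<bar> powr (m + 1))"
    unfolding eventually_at_left_field by blast
  define r where "r = Min {r1, - r2, 1, a, b}"
  have r: "r > 0" "r \<le> r1" "r \<le> - r2" "r \<le> 1" "r \<le> a" "r \<le> b"
    using r1(1) r2(1) a_pos b_pos by (auto simp: r_def)
  have "\<bar>M - h x - c x * \<bar>x\<bar> powr m\<bar> \<le> max C1 C2 * \<bar>x\<bar> powr (m + 1)" if x: "\<bar>x\<bar> < r" for x
  proof -
    consider "x > 0" | "x < 0" | "x = 0" by linarith
    then show ?thesis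
    proof cases
      case 1
      then have "\<bar>M - h x - c x * \<bar>x\<bar> powr m\<bar> \<le> C1 * \<bar>x\<bar> powr (m + 1)"
        using r1(2)[of x] x r by (simp add: c_def abs_minus_commute algebra_simps abs_if split: if_splits)
      also have "\<dots> \<le> max C1 C2 * \<bar>x\<bar> powr (m + 1)" by (intro mult_right_mono) auto
      finally show ?thesis .
    next
      case 2
      then have "\<bar>M - h x - c x * \<bar>x\<bar> powr m\<bar> \<le> C2 * \<bar>x\<bar> powr (m + 1)"
        using r2(2)[of x] x r by (simp add: c_def abs_minus_commute algebra_simps abs_if split: if_splits)
      also have "\<dots> \<le> max C1 C2 * \<bar>x\<bar> powr (m + 1)" by (intro mult_right_mono) auto
      finally show ?thesis .
    next
      case 3
      \<comment> \<open>At the origin both powers are 0 because \<open>0 powr m = 0\<close>, and the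
        remaining difference is \<open>M - h 0\<close>.\<close>
      then show ?thesis using h_0 m_ge by simp
    qed
  qed
  then show ?thesis using that[of "max C1 C2" r] C1(1) r by auto
qed

text \<open>The difference factors through \<open>M - y\<close>; the other factor is bounded below
  by \<open>y \<le> M\<close> in its denominator and \<open>M + y \<ge> M\<close> in its
  numerator.\<close>

lemma inverse_square_lower:
  assumes "0 < y" "y \<le> M"
  shows "(M - y) / M ^ 3 \<le> 1 / y\<^sup>2 - 1 / M\<^sup>2"
proof -
  have "1 / y\<^sup>2 - 1 / M\<^sup>2 = (M - y) * ((M + y) / (y\<^sup>2 * M\<^sup>2))"
    using assms M_pos by (simp add: field_simps power2_eq_square)
  moreover have "1 / M ^ 3 \<le> (M + y) / (y\<^sup>2 * M\<^sup>2)"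
  proof -
    have "y\<^sup>2 \<le> M\<^sup>2" using assms by (intro power_mono) auto
    then have "y\<^sup>2 * M\<^sup>2 \<le> M\<^sup>2 * M\<^sup>2" by (rule mult_right_mono) simp
    also have "\<dots> \<le> (M + y) * M ^ 3"
      using assms M_pos by (simp add: power2_eq_square power3_eq_cube algebra_simps)
    finally show ?thesis using assms M_pos by (simp add: field_simps)
  qed
  then have "(M - y) * (1 / M ^ 3) \<le> (M - y) * ((M + y) / (y\<^sup>2 * M\<^sup>2))"
    by (rule mult_left_mono) (use assms in simp)
  ultimately show ?thesis by simp
qed

text \<open>Near the origin the leading term of the expansion dominates the remainder. Away from it,
  uniqueness of the maximum and compactness give a positive gap between \<open>M\<close> and
  \<open>h\<close>, while the weight stays bounded.\<close>

lemma P_lower: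
  obtains k where "k > 0" "\<And>x. x \<in> {-a..b} \<Longrightarrow> k * \<bar>x\<bar> powr m \<le> P x"
proof -
  obtain C r where C: "C > 0" and r: "r > 0" "r \<le> 1" "r \<le> a" "r \<le> b"
    and ex: "\<And>x. \<bar>x\<bar> < r \<Longrightarrow> \<bar>M - h x - c x * \<bar>x\<bar> powr m\<bar> \<le> C * \<bar>x\<bar> powr (m + 1)"
    using expansion by blast
  define c0 where "c0 = min cp cm"
  have c0: "c0 > 0" "c0 \<le> c x" for x using cp_pos cm_pos by (auto simp: c0_def c_def)
  \<comment> \<open>Within this radius the remainder is at most half of the smallest possible
    leading term.\<close>
  define r0 where "r0 = min r (c0 / (2 * C))"
  have r0: "r0 > 0" "r0 \<le> r" using r c0 C by (auto simp: r0_def)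
  have near: "c0 / 2 * \<bar>x\<bar> powr m \<le> M - h x" if x: "\<bar>x\<bar> < r0" for x
  proof -
    have "C * \<bar>x\<bar> powr (m + 1) = (C * \<bar>x\<bar>) * \<bar>x\<bar> powr m" by (simp add: powr_add powr_one' mult_ac)
    also have "\<dots> \<le> (c0 / 2) * \<bar>x\<bar> powr m"
    proof (rule mult_right_mono)
      have "\<bar>x\<bar> \<le> c0 / (2 * C)" using x by (simp add: r0_def)
      then show "C * \<bar>x\<bar> \<le> c0 / 2" using C by (simp add: field_simps)
    qed simp
    finally have 1: "C * \<bar>x\<bar> powr (m + 1) \<le> c0 / 2 * \<bar>x\<bar> powr m" .
    have "c0 * \<bar>x\<bar> powr m \<le> c x * \<bar>x\<bar> powr m" by (intro mult_right_mono c0) simp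
    moreover have "c0 * \<bar>x\<bar> powr m = c0 / 2 * \<bar>x\<bar> powr m + c0 / 2 * \<bar>x\<bar> powr m" by simp
    moreover have "\<bar>M - h x - c x * \<bar>x\<bar> powr m\<bar> \<le> C * \<bar>x\<bar> powr (m + 1)" using ex x r0 by simp
    ultimately show ?thesis using 1 by linarith
  qed
  define S where "S = {-a..b} \<inter> {x. r0 \<le> \<bar>x\<bar>}"
  have "closed {x::real. r0 \<le> \<bar>x\<bar>}" by (intro closed_Collect_le continuous_intros)
  then have S: "compact S" unfolding S_def by (intro compact_Int_closed) auto
  have "b \<in> S" using r r0 a_pos b_pos by (auto simp: S_def)
  then have "S \<noteq> {}" by auto
  moreover have "continuous_on S (\<lambda>x. M - h x)"
    by (intro continuous_intros continuous_on_subset[OF h_cont]) (auto simp: S_def)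
  ultimately obtain x0 where x0: "x0 \<in> S" "\<And>x. x \<in> S \<Longrightarrow> M - h x0 \<le> M - h x"
    using continuous_attains_inf[OF S] by blast
  define d where "d = M - h x0"
  have d: "d > 0" using h_less[of x0] x0(1) r0 by (auto simp: d_def S_def)
  \<comment> \<open>An upper bound for the weight on the interval, which turns the gap
    \<open>d\<close> into a multiple of the weight.\<close>
  define B where "B = (a + b) powr m"
  have B: "B > 0" using a_pos b_pos by (simp add: B_def)
  define k where "k = min (c0 / 2) (d / B)"
  have k: "k > 0" using c0 d B by (simp add: k_def)
  have kc: "k \<le> c0 / 2" "k \<le> d / B" unfolding k_def by (rule min.cobounded1, rule min.cobounded2)
  have kk: "k * \<bar>x\<bar> powr m \<le> M - h x" if x: "x \<in> {-a..b}" for x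
  proof (cases "\<bar>x\<bar> < r0")
    case True
    have "k * \<bar>x\<bar> powr m \<le> c0 / 2 * \<bar>x\<bar> powr m" by (intro mult_right_mono kc) auto
    then show ?thesis using near[OF True] by linarith
  next
    case False
    have "\<bar>x\<bar> powr m \<le> B" unfolding B_def using x a_pos b_pos m_ge by (intro powr_mono2) auto
    then have "k * \<bar>x\<bar> powr m \<le> d / B * B" using d B by (intro mult_mono kc) auto
    then show ?thesis using x0(2)[of x] False x B by (auto simp: d_def S_def)
  qed
  have "pi\<^sup>2 / M ^ 3 * k * \<bar>x\<bar> powr m \<le> P x" if x: "x \<in> {-a..b}" for x
  proof -
    have "k * \<bar>x\<bar> powr m / M ^ 3 \<le> (M - h x) / M ^ 3" using kk[OF x] M_pos by (intro divide_right_mono) auto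
    also have "\<dots> \<le> 1 / (h x)\<^sup>2 - 1 / M\<^sup>2" by (rule inverse_square_lower[OF h_pos[OF x] h_le[OF x]])
    finally have "pi\<^sup>2 * (k * \<bar>x\<bar> powr m / M ^ 3) \<le> pi\<^sup>2 * (1 / (h x)\<^sup>2 - 1 / M\<^sup>2)" by (rule mult_left_mono) simp
    then show ?thesis by (simp add: P_def)
  qed
  then show ?thesis using that[of "pi\<^sup>2 / M ^ 3 * k"] k M_pos by simp
qed

text \<open>Taylor expansion of 1 / y^2 at \<open>M\<close>: the linear term, with the leading part
  of \<open>M - h\<close> inserted, is \<open>q\<close>. The error of the expansion has order
  \<open>m + 1\<close> by assumption, and the quadratic remainder has order 2 m, which is no worse
  as \<open>m \<ge> 1\<close>.\<close>

lemma P_close: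
  obtains D r where "D > 0" "r > 0" "r \<le> a" "r \<le> b"
    "\<And>x. \<bar>x\<bar> < r \<Longrightarrow> \<bar>P x - q x\<bar> \<le> D * \<bar>x\<bar> powr (m + 1)"
proof -
  obtain C r where C: "C > 0" and r: "r > 0" "r \<le> 1" "r \<le> a" "r \<le> b"
    and ex: "\<And>x. \<bar>x\<bar> < r \<Longrightarrow> \<bar>M - h x - c x * \<bar>x\<bar> powr m\<bar> \<le> C * \<bar>x\<bar> powr (m + 1)"
    using expansion by blast
  define E where "E = max cp cm + C"
  have E: "E > 0" "c x + C \<le> E" for x using C cp_pos by (auto simp: E_def c_def)
  \<comment> \<open>This radius keeps \<open>h\<close> above \<open>M / 2\<close>, so the remainder
    has a controlled denominator.\<close>
  define r0 where "r0 = min r (M / (2 * E))"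
  have r0: "r0 > 0" "r0 \<le> r" using r E M_pos by (auto simp: r0_def)
  define D where "D = pi\<^sup>2 * (12 * E\<^sup>2 / M ^ 4 + 2 * C / M ^ 3)"
  have "\<bar>P x - q x\<bar> \<le> D * \<bar>x\<bar> powr (m + 1)" if x: "\<bar>x\<bar> < r0" for x
  proof -
    have xab: "x \<in> {-a..b}" using x r0 r by auto
    have x1: "\<bar>x\<bar> \<le> 1" using x r0 r by auto
    define y where "y = h x"
    have y: "0 < y" "y \<le> M" using h_pos[OF xab] h_le[OF xab] by (auto simp: y_def)
    define z where "z = \<bar>x\<bar> powr m"
    define w where "w = \<bar>x\<bar> powr (m + 1)"
    have zw: "0 \<le> w" "w \<le> z" "z \<le> \<bar>x\<bar>" "z\<^sup>2 \<le> w"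
    proof -
      show "0 \<le> w" by (simp add: w_def)
      show "w \<le> z" unfolding w_def z_def using x1 by (intro powr_mono') auto
      have "z \<le> \<bar>x\<bar> powr 1" unfolding z_def using x1 m_ge by (intro powr_mono') auto
      then show "z \<le> \<bar>x\<bar>" by simp
      have "z\<^sup>2 = \<bar>x\<bar> powr (m + m)" unfolding z_def power2_eq_square by (rule powr_add[symmetric])
      also have "\<dots> \<le> w" unfolding w_def using x1 m_ge by (intro powr_mono') auto
      finally show "z\<^sup>2 \<le> w" .
    qed
    have exx: "\<bar>M - y - c x * z\<bar> \<le> C * w" using ex[of x] x r0 by (simp add: y_def z_def w_def)
    have "C * w \<le> C * z" using C zw by (intro mult_left_mono) auto
    then have "M - y \<le> (c x + C) * z" using exx by (simp add: distrib_right)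
    also have "\<dots> \<le> E * z" using zw E by (intro mult_right_mono) auto
    finally have Mz: "M - y \<le> E * z" .
    also have "E * z \<le> E * (M / (2 * E))" using zw x E by (intro mult_left_mono) (auto simp: r0_def)
    also have "\<dots> = M / 2" using E by simp
    finally have y2: "M / 2 \<le> y" by simp
    have "(M - y)\<^sup>2 \<le> (E * z)\<^sup>2" using Mz y by (intro power_mono) auto
    also have "\<dots> \<le> E\<^sup>2 * w" using zw by (simp add: power_mult_distrib mult_left_mono)
    finally have sqb: "(M - y)\<^sup>2 \<le> E\<^sup>2 * w" .
    \<comment> \<open>An exact algebraic Taylor remainder; for \<open>y\<close> between
      \<open>M / 2\<close> and \<open>M\<close> its coefficient is at most
      \<open>12 / M ^ 4\<close>.\<close>
    have id: "1 / y\<^sup>2 - 1 / M\<^sup>2 - 2 * (c x * z) / M ^ 3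
        = (M - y)\<^sup>2 * ((M + 2 * y) / (y\<^sup>2 * M ^ 3)) + 2 / M ^ 3 * (M - y - c x * z)"
      using y M_pos by (simp add: field_simps power2_eq_square power3_eq_cube)
    have fr: "(M + 2 * y) / (y\<^sup>2 * M ^ 3) \<le> 12 / M ^ 4"
    proof -
      have "(M / 2)\<^sup>2 \<le> y\<^sup>2" using y2 M_pos by (intro power_mono) auto
      then have "(M / 2)\<^sup>2 * M ^ 3 \<le> y\<^sup>2 * M ^ 3" using M_pos by (intro mult_right_mono) auto
      moreover have "M + 2 * y \<le> 3 * M" using y by simp
      ultimately have "(M + 2 * y) / (y\<^sup>2 * M ^ 3) \<le> 3 * M / ((M / 2)\<^sup>2 * M ^ 3)"
        using y M_pos by (intro frac_le) auto
      also have "\<dots> = 12 / M ^ 4" using M_pos by (simp add: field_simps power2_eq_square power3_eq_cube power4_eq_xxxx)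
      finally show ?thesis .
    qed
    have "\<bar>1 / y\<^sup>2 - 1 / M\<^sup>2 - 2 * (c x * z) / M ^ 3\<bar>
        \<le> \<bar>(M - y)\<^sup>2 * ((M + 2 * y) / (y\<^sup>2 * M ^ 3))\<bar> + \<bar>2 / M ^ 3 * (M - y - c x * z)\<bar>"
      unfolding id by (rule abs_triangle_ineq)
    also have "\<bar>(M - y)\<^sup>2 * ((M + 2 * y) / (y\<^sup>2 * M ^ 3))\<bar> = (M - y)\<^sup>2 * ((M + 2 * y) / (y\<^sup>2 * M ^ 3))"
      using y M_pos by (intro abs_of_nonneg) auto
    also have "\<dots> \<le> E\<^sup>2 * w * (12 / M ^ 4)" using zw y M_pos by (intro mult_mono sqb fr) auto
    also have "\<bar>2 / M ^ 3 * (M - y - c x * z)\<bar> = 2 / M ^ 3 * \<bar>M - y - c x * z\<bar>"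
      unfolding abs_mult using M_pos by simp
    also have "\<dots> \<le> 2 / M ^ 3 * (C * w)" using M_pos by (intro mult_left_mono exx) auto
    finally have "\<bar>1 / y\<^sup>2 - 1 / M\<^sup>2 - 2 * (c x * z) / M ^ 3\<bar> \<le> (12 * E\<^sup>2 / M ^ 4 + 2 * C / M ^ 3) * w"
      by (simp add: algebra_simps)
    then have "pi\<^sup>2 * \<bar>1 / y\<^sup>2 - 1 / M\<^sup>2 - 2 * (c x * z) / M ^ 3\<bar> \<le> D * w"
      unfolding D_def mult.assoc by (rule mult_left_mono) simp
    moreover have "P x - q x = pi\<^sup>2 * (1 / y\<^sup>2 - 1 / M\<^sup>2 - 2 * (c x * z) / M ^ 3)"
      unfolding P_def q_pot_eq y_def[symmetric] z_def[symmetric] by (simp add: right_diff_distrib)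
    ultimately show ?thesis by (simp add: abs_mult w_def)
  qed
  moreover have "D > 0" using E(1) C M_pos by (simp add: D_def add_pos_pos)
  ultimately show ?thesis using that[of D r0] r r0 by auto
qed

end

section \<open>Integrability and rescaling of the potentials\<close>

context width_profile
begin

lemma v_nonneg: "v x \<ge> 0" by (simp add: v_def)

lemma P_nonneg: "x \<in> {-a..b} \<Longrightarrow> P x \<ge> 0"
  using P_lower by (metis mult_nonneg_nonneg less_imp_le order_trans powr_ge_zero)

lemma P_continuous: "continuous_on {-a..b} P"
  unfolding P_def[abs_def] using h_cont h_pos M_pos
  by (intro continuous_intros) (auto simp: less_imp_neq[symmetric] dest: h_pos)

lemma v_continuous: "continuous_on ({-a..b} - {0}) v"
  unfolding v_def[abs_def]
proof (intro continuous_intros h'_cont)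
  show "continuous_on ({-a..b} - {0}) h" using h_cont by (rule continuous_on_subset) auto
  show "\<forall>x\<in>{-a..b} - {0}. (h x)\<^sup>2 \<noteq> 0" using h_pos by force
qed

abbreviation (input) v1 :: "real \<Rightarrow> real" where "v1 x \<equiv> indicator {-a..b} x * v x"

text \<open>Continuity of \<open>v\<close> is available only off the origin; the value at that one
  point is added as a separate measurable term.\<close>

lemma v1_measurable: "v1 \<in> borel_measurable borel"
proof -
  have "(\<lambda>x. indicator ({-a..b} - {0}) x *\<^sub>R v x) \<in> borel_measurable borel"
    by (rule borel_measurable_continuous_on_indicator[OF _ v_continuous]) simp
  then have "(\<lambda>x. indicator ({-a..b} - {0}) x *\<^sub>R v x + indicator {0} x * v 0) \<in> borel_measurable borel"
    by measurable
  also have "(\<lambda>x. indicator ({-a..b} - {0}) x *\<^sub>R v x + indicator {0} x * v 0) = v1"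
    using a_pos b_pos by (auto simp: fun_eq_iff split: split_indicator)
  finally show ?thesis .
qed

lemma P1_measurable: "(\<lambda>x. indicator {-a..b} x * P x) \<in> borel_measurable borel"
  using borel_measurable_continuous_on_indicator[OF _ P_continuous] by simp

text \<open>Finiteness of the form on the single function \<open>(x + a) (b - x)\<close>, which stays away from \<open>0\<close>
  near the origin, already forces \<open>v\<close> to be integrable.\<close>

lemma v1_integrable: "integrable lborel v1"
proof -
  note [measurable] = v1_measurable
  define p where "p x = (x + a) * (b - x)" for x
  define p' where "p' x = (b - x) - (x + a)" for x
  have der: "(p has_real_derivative p' x) (at x)" for x
    unfolding p_def[abs_def] p'_def by (auto intro!: derivative_eq_intros)
  have cont: "continuous_on S p" "continuous_on S p'" for S
    unfolding p_def[abs_def] p'_def[abs_def] by (auto intro!: continuous_intros)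
  have [measurable]: "p \<in> borel_measurable borel" "p' \<in> borel_measurable borel"
    using cont by (auto intro: borel_measurable_continuous_onI)
  have sq: "sq_int (\<lambda>x. indicator {-a..b} x * k x)" if k: "continuous_on UNIV k" for k :: "real \<Rightarrow> real"
  proof -
    have [measurable]: "k \<in> borel_measurable borel" using k by (rule borel_measurable_continuous_onI)
    have "continuous_on {-a..b} (\<lambda>x. (k x)\<^sup>2)" by (intro continuous_intros continuous_on_subset[OF k]) simp
    then have "set_integrable lborel {-a..b} (\<lambda>x. (k x)\<^sup>2)" by (rule borel_integrable_atLeastAtMost')
    moreover have "(indicator {-a..b} x * k x)\<^sup>2 = indicator {-a..b} x *\<^sub>R (k x)\<^sup>2" for x
      by (simp split: split_indicator)
    ultimately show ?thesis by (simp add: sq_int_def set_integrable_def)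
  qed
  define f g where "f x = indicator {-a..b} x * p x" and "g x = indicator {-a..b} x * p' x" for x
  have sqf: "sq_int f" "sq_int g" unfolding f_def[abs_def] g_def[abs_def] by (intro sq cont)+
  have ac: "ac_rep {-a..b} (abs_L2R f) (abs_L2R g) p"
    unfolding ac_rep_def
  proof (intro conjI ballI impI)
    show "abs_L2R f \<in> L2_on {-a..b}" by (rule L2_on_abs[OF sqf(1)]) (simp add: f_def)
    show "abs_L2R g \<in> L2_on {-a..b}" by (rule L2_on_abs[OF sqf(2)]) (simp add: g_def)
    show "AE x in lborel. x \<in> {-a..b} \<longrightarrow> rep_L2R (abs_L2R f) x = p x"
      using rep_abs_AE[OF sqf(1)] by eventually_elim (simp add: f_def)
    fix x y assume xy: "x \<in> {-a..b}" "y \<in> {-a..b}" "x \<le> y"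
    have "(LBINT t:{x..y}. rep_L2R (abs_L2R g) t) = (LBINT t:{x..y}. p' t)"
      by (rule set_lebesgue_integral_cong_AE)
        (use rep_abs_AE[OF sqf(2)] xy in \<open>auto elim!: eventually_mono simp: g_def\<close>)
    also have "\<dots> = p y - p x"
      using integral_FTC_Icc_real[OF xy(3), of p p'] der cont(2)[of UNIV]
      by (simp add: set_lebesgue_integral_def continuous_on_eq_continuous_at mult.commute)
    finally show "p y - p x = (LBINT t:{x..y}. rep_L2R (abs_L2R g) t)" by simp
  qed
  have ab: "-a < b" using a_pos b_pos by simp
  have "p (-a) = 0" "p b = 0" by (simp_all add: p_def)
  then have "abs_L2R f \<in> H10 (-a) b" unfolding H10_def using ac by blast
  moreover have wd: "weak_deriv {-a..b} (abs_L2R f) = abs_L2R g" by (rule weak_deriv_Icc[OF ab ac])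
  \<comment> \<open>One parameter value is enough, because \<open>v\<close> does not depend on
    \<epsilon>.\<close>
  ultimately have X: "integrable lborel (\<lambda>x. indicator {-a..b} x *\<^sub>R
      ((rep_L2R (abs_L2R g) x)\<^sup>2 + W_pot h h' M 1 x * (rep_L2R (abs_L2R f) x)\<^sup>2))"
    using Q_form[of 1] unfolding Q_form_defined_def set_integrable_def energy_density_def by force
  \<comment> \<open>Subtracting the squared derivative from the energy density isolates the
    potential term.\<close>
  have Y: "integrable lborel (\<lambda>x. (indicator {-a..b} x * rep_L2R (abs_L2R g) x)\<^sup>2)"
    by (intro sq_int_integrable sq_int_indicator) auto
  \<comment> \<open>A lower bound for \<open>p\<close> between \<open>-a/2\<close> and
    \<open>b/2\<close>, where each factor is at least half of its value at 0.\<close>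
  define c0 where "c0 = (a / 2) * (b / 2)"
  have c0: "c0 > 0" using a_pos b_pos by (simp add: c0_def)
  have mid: "integrable lborel (\<lambda>x. indicator {-a/2..b/2} x * v1 x)"
  proof (rule Bochner_Integration.integrable_bound[OF integrable_divide[OF Bochner_Integration.integrable_diff[OF X Y], of "c0\<^sup>2"]])
    show "AE x in lborel. norm (indicator {-a/2..b/2} x * v1 x) \<le> norm ((indicator {-a..b} x *\<^sub>R
      ((rep_L2R (abs_L2R g) x)\<^sup>2 + W_pot h h' M 1 x * (rep_L2R (abs_L2R f) x)\<^sup>2)
      - (indicator {-a..b} x * rep_L2R (abs_L2R g) x)\<^sup>2) / c0\<^sup>2)"
      using rep_abs_AE[OF sqf(1)]
    proof eventually_elim
      case (elim x)
      show ?case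
      proof (cases "x \<in> {-a/2..b/2}")
        case True
        then have x: "x \<in> {-a..b}" using a_pos b_pos by auto
        have "c0 \<le> p x" unfolding p_def c0_def using True a_pos b_pos by (intro mult_mono) auto
        then have "c0\<^sup>2 \<le> (p x)\<^sup>2" using c0 by (intro power_mono) auto
        then have "v x * c0\<^sup>2 \<le> W_pot h h' M 1 x * (p x)\<^sup>2"
          using P_nonneg[OF x] v_nonneg[of x] by (intro mult_mono) (auto simp: W_pot_eq)
        then have "v x \<le> W_pot h h' M 1 x * (p x)\<^sup>2 / c0\<^sup>2" using c0 by (simp add: field_simps)
        also have "\<dots> \<le> \<bar>W_pot h h' M 1 x * (p x)\<^sup>2\<bar> / c0\<^sup>2" by (intro divide_right_mono abs_ge_self) simp
        finally show ?thesis using True x elim v_nonneg[of x] by (simp add: f_def)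
      qed simp
    qed
  qed simp
  \<comment> \<open>Towards the ends \<open>p\<close> degenerates, but there \<open>v\<close> is
    continuous on compact intervals that avoid 0.\<close>
  have side: "integrable lborel (\<lambda>x. indicator {l..r} x *\<^sub>R v x)" if "{l..r} \<subseteq> {-a..b} - {0}" for l r
    using borel_integrable_atLeastAtMost'[OF continuous_on_subset[OF v_continuous that]]
    by (simp add: set_integrable_def)
  show ?thesis
  proof (rule Bochner_Integration.integrable_bound)
    show "integrable lborel (\<lambda>x. indicator {-a/2..b/2} x * v1 x + indicator {-a..-a/2} x *\<^sub>R v x + indicator {b/2..b} x *\<^sub>R v x)"
      using a_pos b_pos by (intro Bochner_Integration.integrable_add mid side) auto
    show "AE x in lborel. norm (v1 x) \<le> norm (indicator {-a/2..b/2} x * v1 x + indicator {-a..-a/2} x *\<^sub>R v x + indicator {b/2..b} x *\<^sub>R v x)"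
      using v_nonneg a_pos b_pos by (intro AE_I2) (auto split: split_indicator)
  qed simp
qed

lemma W_pot_integrable: "set_integrable lborel {-a..b} (W_pot h h' M \<epsilon>)"
proof -
  have "integrable lborel (\<lambda>x. (indicator {-a..b} x *\<^sub>R P x) / \<epsilon>\<^sup>2 + v1 x)"
    using borel_integrable_atLeastAtMost'[OF P_continuous] v1_integrable by (simp add: set_integrable_def)
  moreover have "(\<lambda>x. (indicator {-a..b} x *\<^sub>R P x) / \<epsilon>\<^sup>2 + v1 x) = (\<lambda>x. indicator {-a..b} x *\<^sub>R W_pot h h' M \<epsilon> x)"
    by (auto simp: W_pot_eq fun_eq_iff distrib_left)
  ultimately show ?thesis by (simp add: set_integrable_def)
qed

text \<open>The rescaled potential with \<open>s = \<epsilon>\<^sup>\<alpha>\<close>; outside the rescaled interval, where the form domain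
  vanishes, it is continued by the limit potential to keep the lower bound \<open>\<kappa> \<bar>t\<bar>\<^sup>m\<close>.\<close>

definition V :: "real \<Rightarrow> real \<Rightarrow> real" where
  "V s t = (if t * s \<in> {-a..b} then P (t * s) / s powr m + s\<^sup>2 * v (t * s) else q t)"

lemma V_eq_W_pot:
  assumes "\<epsilon> > 0" "t * \<epsilon> powr (2 * inverse (m + 2)) \<in> {-a..b}"
  shows "V (\<epsilon> powr (2 * inverse (m + 2))) t
    = (\<epsilon> powr (2 * inverse (m + 2)))\<^sup>2 * W_pot h h' M \<epsilon> (t * \<epsilon> powr (2 * inverse (m + 2)))"
proof -
  define s where "s = \<epsilon> powr (2 * inverse (m + 2))"
  have s: "s > 0" using assms by (simp add: s_def)
  have "s powr m * s\<^sup>2 = s powr (m + 2)" using s by (simp add: powr_add)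
  also have "\<dots> = \<epsilon> powr (2 * inverse (m + 2) * (m + 2))" by (simp only: s_def powr_powr)
  also have "\<dots> = \<epsilon>\<^sup>2"
  proof -
    have "2 * inverse (m + 2) * (m + 2) = 2" using m_ge by simp
    then show ?thesis using assms(1) by (simp only: powr_numeral)
  qed
  finally have "s\<^sup>2 / \<epsilon>\<^sup>2 = 1 / s powr m" using s assms(1) by (simp add: field_simps)
  then have "s\<^sup>2 * (P (t * s) / \<epsilon>\<^sup>2) = P (t * s) / s powr m" by (metis mult.left_commute mult.right_neutral times_divide_eq_right)
  then show ?thesis using assms(2) unfolding s_def[symmetric] by (simp add: V_def W_pot_eq distrib_left)
qed

lemma V_measurable: "V s \<in> borel_measurable borel"
proof -
  note [measurable] = v1_measurable P1_measurable
  have "(\<lambda>t. (\<lambda>x. indicator {-a..b} x * P x) (t * s) / s powr m + s\<^sup>2 * v1 (t * s)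
      + indicator (- {-a..b}) (t * s) * q t) \<in> borel_measurable borel"
    by measurable
  also have "(\<lambda>t. (\<lambda>x. indicator {-a..b} x * P x) (t * s) / s powr m + s\<^sup>2 * v1 (t * s)
      + indicator (- {-a..b}) (t * s) * q t) = V s"
    by (auto simp: V_def fun_eq_iff split: split_indicator)
  finally show ?thesis .
qed

text \<open>The weight is homogeneous of degree \<open>m\<close>, so rescaling \<open>P\<close> and
  dividing by \<open>s powr m\<close> reproduces its lower bound with the same constant for every
  \<open>s\<close>. The term with \<open>v\<close> is nonnegative, and the continuation by
  \<open>q\<close> has its own constant; \<kappa> is the minimum.\<close>

lemma confining_potentials:
  obtains \<kappa> where "confining (q) \<kappa> m" "\<And>s. s > 0 \<Longrightarrow> confining (V s) \<kappa> m"
proof -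
  obtain k where k: "k > 0" "\<And>x. x \<in> {-a..b} \<Longrightarrow> k * \<bar>x\<bar> powr m \<le> P x" using P_lower by blast
  define k1 where "k1 = 2 * pi\<^sup>2 / M ^ 3 * min cp cm"
  have k1: "k1 > 0" using cp_pos cm_pos M_pos by (simp add: k1_def)
  define \<kappa> where "\<kappa> = min 1 (min k k1)"
  have \<kappa>: "0 < \<kappa>" "\<kappa> \<le> 1" "\<kappa> \<le> k" "\<kappa> \<le> k1" using k k1 by (auto simp: \<kappa>_def)
  have q: "\<kappa> * \<bar>x\<bar> powr m \<le> q x" for x
  proof -
    have "min cp cm \<le> c x" by (auto simp: c_def)
    then have "k1 \<le> 2 * pi\<^sup>2 / M ^ 3 * c x" unfolding k1_def using M_pos by (intro mult_left_mono) auto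
    then have "\<kappa> * \<bar>x\<bar> powr m \<le> (2 * pi\<^sup>2 / M ^ 3 * c x) * \<bar>x\<bar> powr m" using \<kappa> by (intro mult_right_mono) auto
    then show ?thesis by (simp only: q_pot_eq mult.assoc)
  qed
  have "confining (q) \<kappa> m" using \<kappa> m_ge q by unfold_locales auto
  moreover have "confining (V s) \<kappa> m" if s: "s > 0" for s
  proof
    fix t
    show "\<kappa> * \<bar>t\<bar> powr m \<le> V s t"
    proof (cases "t * s \<in> {-a..b}")
      case True
      have "\<bar>t * s\<bar> powr m = \<bar>t\<bar> powr m * s powr m" using s by (simp add: abs_mult powr_mult)
      then have "k * \<bar>t\<bar> powr m * s powr m \<le> P (t * s)" using k(2)[OF True] by (simp add: mult.assoc)
      then have "k * \<bar>t\<bar> powr m \<le> P (t * s) / s powr m" using s by (simp add: field_simps)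
      moreover have "\<kappa> * \<bar>t\<bar> powr m \<le> k * \<bar>t\<bar> powr m" by (intro mult_right_mono \<kappa>) simp
      moreover have "0 \<le> s\<^sup>2 * v (t * s)" using v_nonneg by simp
      ultimately show ?thesis using True by (simp add: V_def)
    qed (auto simp: V_def q)
  qed (use \<kappa> m_ge V_measurable in auto)
  ultimately show ?thesis using that by blast
qed

lemma q_pot_le: "q x \<le> 2 * pi\<^sup>2 / M ^ 3 * max cp cm * \<bar>x\<bar> powr m"
proof -
  have "c x * \<bar>x\<bar> powr m \<le> max cp cm * \<bar>x\<bar> powr m" by (intro mult_right_mono) (auto simp: c_def)
  then have "2 * pi\<^sup>2 / M ^ 3 * (c x * \<bar>x\<bar> powr m) \<le> 2 * pi\<^sup>2 / M ^ 3 * (max cp cm * \<bar>x\<bar> powr m)"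
    using M_pos by (intro mult_left_mono) auto
  then show ?thesis by (simp add: q_pot_eq)
qed

lemma q_pot_nonneg: "q x \<ge> 0"
  using c_pos[of x] M_pos by (simp add: q_pot_eq)

lemma Icc_indicator_integrable: "integrable lborel (\<lambda>x. indicator {l..r::real} x * (k::real))"
  by (intro integrable_mult_left integrable_real_indicator) (auto simp: emeasure_lborel_Icc_eq)

lemma q_pot_integrable: "set_integrable lborel {-R..R} (q)"
proof -
  define K where "K = 2 * pi\<^sup>2 / M ^ 3 * max cp cm * R powr m"
  have le: "q x \<le> K" if "x \<in> {-R..R}" for x
  proof -
    have "2 * pi\<^sup>2 / M ^ 3 * max cp cm * \<bar>x\<bar> powr m \<le> K"
      unfolding K_def using that m_ge M_pos cp_pos by (intro mult_left_mono powr_mono2) auto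
    then show ?thesis using q_pot_le[of x] by linarith
  qed
  show ?thesis
    unfolding set_integrable_def
  proof (rule Bochner_Integration.integrable_bound[OF Icc_indicator_integrable[of "-R" R K]])
    show "AE x in lborel. norm (indicator {-R..R} x *\<^sub>R q x) \<le> norm (indicator {-R..R} x * K)"
      using q_pot_nonneg le by (intro AE_I2) (auto split: split_indicator intro: order_trans[OF _ abs_ge_self])
  qed simp
qed

text \<open>The difference of \<open>P\<close> and \<open>q\<close> has one more power of the
  distance to 0, which rescaling turns into a factor \<open>s\<close>. The other term carries
  \<open>s\<^sup>2\<close>, and substitution in its integral returns only one factor
  \<open>1 / s\<close>. The condition on \<open>R * s\<close> keeps all arguments where the
  expansion holds.\<close>

lemma potentials_close:
  obtains D r where "r > 0" "r \<le> a" "r \<le> b" "D \<ge> 0"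
    "\<And>s R. s > 0 \<Longrightarrow> R * s < r \<Longrightarrow> R \<ge> 1 \<Longrightarrow> set_integrable lborel {-R..R} (V s)"
    "\<And>s R. s > 0 \<Longrightarrow> R * s < r \<Longrightarrow> R \<ge> 1 \<Longrightarrow>
      (LBINT t:{-R..R}. \<bar>q t - V s t\<bar>) \<le> s * (2 * R * (D * R powr (m + 1)) + (LBINT x. v1 x))"
proof -
  obtain D r where D: "D > 0" and r: "r > 0" "r \<le> a" "r \<le> b"
    and cl: "\<And>x. \<bar>x\<bar> < r \<Longrightarrow> \<bar>P x - q x\<bar> \<le> D * \<bar>x\<bar> powr (m + 1)"
    using P_close by blast
  have *: "set_integrable lborel {-R..R} (V s) \<and>
      (LBINT t:{-R..R}. \<bar>q t - V s t\<bar>) \<le> s * (2 * R * (D * R powr (m + 1)) + (LBINT x. v1 x))"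
    if s: "s > 0" and Rs: "R * s < r" and R: "R \<ge> 1" for s R
  proof -
    note [measurable] = V_measurable
    define Bd where "Bd t = indicator {-R..R} t * (D * s * R powr (m + 1)) + s\<^sup>2 * v1 (t * s)" for t
    have v1s: "integrable lborel (\<lambda>t. v1 (t * s))" using integrable_dilation[OF s, of v1] v1_integrable by simp
    have Bd: "integrable lborel Bd"
      unfolding Bd_def[abs_def] by (intro Bochner_Integration.integrable_add Icc_indicator_integrable integrable_mult_right v1s)
    have pt: "indicator {-R..R} t *\<^sub>R \<bar>q t - V s t\<bar> \<le> Bd t" for t
    proof (cases "t \<in> {-R..R}")
      case True
      then have "\<bar>t\<bar> * s \<le> R * s" using s by (intro mult_right_mono) auto
      moreover have "\<bar>t * s\<bar> = \<bar>t\<bar> * s" using s by (simp add: abs_mult)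
      ultimately have ts: "\<bar>t * s\<bar> < r" using Rs by linarith
      then have tab: "t * s \<in> {-a..b}" using r by auto
      have sp: "s powr m > 0" using s by simp
      have ab: "\<bar>t * s\<bar> powr k = \<bar>t\<bar> powr k * s powr k" for k using s by (simp add: abs_mult powr_mult)
      \<comment> \<open>Multiplication by a positive \<open>s\<close> preserves the sign of
        \<open>t\<close>, so \<open>q\<close> is homogeneous although its two branches
        differ.\<close>
      have "c (t * s) = c t" using s by (simp add: c_def zero_less_mult_iff)
      then have "q (t * s) = q t * s powr m" by (simp add: q_pot_eq ab)
      then have "\<bar>P (t * s) - q t * s powr m\<bar> \<le> D * (\<bar>t\<bar> powr (m + 1) * s powr (m + 1))"
        using cl[OF ts] by (simp only: ab)
      also have "s powr (m + 1) = s * s powr m" using s by (simp add: powr_add)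
      finally have "\<bar>P (t * s) - q t * s powr m\<bar> / s powr m \<le> D * (\<bar>t\<bar> powr (m + 1) * (s * s powr m)) / s powr m"
        using sp by (intro divide_right_mono) auto
      moreover have "\<bar>P (t * s) - q t * s powr m\<bar> / s powr m = \<bar>P (t * s) / s powr m - q t\<bar>"
      proof -
        have "P (t * s) / s powr m - q t = (P (t * s) - q t * s powr m) / s powr m"
          using sp by (simp add: field_simps)
        then show ?thesis using sp by (simp add: abs_divide)
      qed
      moreover have "D * (\<bar>t\<bar> powr (m + 1) * (s * s powr m)) / s powr m = D * s * \<bar>t\<bar> powr (m + 1)" using sp by simp
      ultimately have 1: "\<bar>P (t * s) / s powr m - q t\<bar> \<le> D * s * \<bar>t\<bar> powr (m + 1)" by simp
      have "D * s * \<bar>t\<bar> powr (m + 1) \<le> D * s * R powr (m + 1)"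
        using True D s m_ge by (intro mult_left_mono powr_mono2) auto
      moreover have "0 \<le> s\<^sup>2 * v (t * s)" using v_nonneg by simp
      ultimately have "\<bar>q t - (P (t * s) / s powr m + s\<^sup>2 * v (t * s))\<bar> \<le> D * s * R powr (m + 1) + s\<^sup>2 * v (t * s)"
        using 1 by linarith
      then show ?thesis using True tab by (simp add: Bd_def V_def)
    next
      case False
      then show ?thesis using v_nonneg by (simp add: Bd_def)
    qed
    have dif: "integrable lborel (\<lambda>t. indicator {-R..R} t *\<^sub>R \<bar>q t - V s t\<bar>)"
    proof (rule Bochner_Integration.integrable_bound[OF Bd])
      show "AE t in lborel. norm (indicator {-R..R} t *\<^sub>R \<bar>q t - V s t\<bar>) \<le> norm (Bd t)"
        using pt by (intro AE_I2) (auto intro: order_trans[OF _ abs_ge_self])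
    qed simp
    have "set_integrable lborel {-R..R} (V s)"
      unfolding set_integrable_def
    proof (rule Bochner_Integration.integrable_bound)
      show "integrable lborel (\<lambda>t. indicator {-R..R} t *\<^sub>R q t + indicator {-R..R} t *\<^sub>R \<bar>q t - V s t\<bar>)"
        using q_pot_integrable[of R] dif by (simp add: set_integrable_def)
      show "AE t in lborel. norm (indicator {-R..R} t *\<^sub>R V s t)
          \<le> norm (indicator {-R..R} t *\<^sub>R q t + indicator {-R..R} t *\<^sub>R \<bar>q t - V s t\<bar>)"
      proof (rule AE_I2)
        fix t
        have "\<bar>V s t\<bar> \<le> \<bar>q t + \<bar>q t - V s t\<bar>\<bar>"
          using q_pot_nonneg[of t] by linarith
        then show "norm (indicator {-R..R} t *\<^sub>R V s t)
          \<le> norm (indicator {-R..R} t *\<^sub>R q t + indicator {-R..R} t *\<^sub>R \<bar>q t - V s t\<bar>)"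
          by (simp split: split_indicator)
      qed
    qed simp
    moreover have "(LBINT t:{-R..R}. \<bar>q t - V s t\<bar>) \<le> s * (2 * R * (D * R powr (m + 1)) + (LBINT x. v1 x))"
    proof -
      have "(LBINT t:{-R..R}. \<bar>q t - V s t\<bar>) \<le> (LBINT t. Bd t)"
        unfolding set_lebesgue_integral_def by (rule integral_mono[OF dif Bd pt])
      also have "\<dots> = (LBINT t. indicator {-R..R} t * (D * s * R powr (m + 1))) + (LBINT t. s\<^sup>2 * v1 (t * s))"
        unfolding Bd_def[abs_def]
        by (rule Bochner_Integration.integral_add[OF Icc_indicator_integrable integrable_mult_right[OF v1s]])
      also have "(LBINT t. indicator {-R..R} t * (D * s * R powr (m + 1))) = 2 * R * (D * s * R powr (m + 1))"
        using R by simp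
      also have "(LBINT t. s\<^sup>2 * v1 (t * s)) = s\<^sup>2 * (LBINT t. v1 (t * s))" by (rule integral_mult_right_zero)
      also have "(LBINT t. v1 (t * s)) = (LBINT x. v1 x) / s" by (rule integral_dilation[OF s])
      also have "s\<^sup>2 * ((LBINT x. v1 x) / s) = s * (LBINT x. v1 x)" using s by (simp add: power2_eq_square)
      also have "2 * R * (D * s * R powr (m + 1)) + s * (LBINT x. v1 x) = s * (2 * R * (D * R powr (m + 1)) + (LBINT x. v1 x))"
        by (simp only: distrib_left mult_ac)
      finally show ?thesis .
    qed
    ultimately show ?thesis ..
  qed
  show ?thesis by (rule that[of r D]) (use * r D in auto)
qed

end

section \<open>Norm convergence of the inverses\<close>

theorem theorem1p3:
  fixes a b M m cp cm \<alpha> :: real and h h' :: "real \<Rightarrow> real"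
  assumes "a > 0" and "b > 0"
    and "continuous_on {-a..b} h"
    and "\<And>x. x \<in> {-a..b} \<Longrightarrow> h x > 0"
    and "{x \<in> {-a..b}. \<forall>y\<in>{-a..b}. h y \<le> h x} = {0}"
    and "\<And>x. x \<in> {-a..b} - {0} \<Longrightarrow> (h has_real_derivative h' x) (at x within {-a..b})"
    and "continuous_on ({-a..b} - {0}) h'"
    and "M > 0" and "cp > 0" and "cm > 0" and "m \<ge> 1"
    and "(\<lambda>x. h x - (M - cp * x powr m)) \<in> O[at_right 0](\<lambda>x. x powr (m + 1))"
    and "(\<lambda>x. h x - (M - cm * \<bar>x\<bar> powr m)) \<in> O[at_left 0](\<lambda>x. \<bar>x\<bar> powr (m + 1))"
    and "\<And>\<epsilon>. \<epsilon> > 0 \<Longrightarrow> Q_form_defined a b h h' M \<epsilon>"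
    and "\<alpha> = 2 * inverse (m + 2)"
  shows "(\<forall>\<epsilon>>0. everywhere_bounded (inverse_plus_zero (I_scaled a b \<alpha> \<epsilon>) (Q_hat a b h h' M \<alpha> \<epsilon>))) \<and>
    everywhere_bounded ((H_op M m cp cm)\<inverse>) \<and>
    ((\<lambda>\<epsilon>. norm (the_blinfun (inverse_plus_zero (I_scaled a b \<alpha> \<epsilon>) (Q_hat a b h h' M \<alpha> \<epsilon>))
               - the_blinfun ((H_op M m cp cm)\<inverse>))) \<longlongrightarrow> 0) (at_right 0)"
proof -
  interpret width_profile a b M m cp cm h h'
    using assms by unfold_locales auto
  let ?q = "q_pot M m cp cm"
  obtain \<kappa> where q: "confining ?q \<kappa> m" and V: "\<And>s. s > 0 \<Longrightarrow> confining (V s) \<kappa> m"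
    using confining_potentials by blast
  interpret q: confining UNIV ?q \<kappa> m by (rule q)
  define S where "S \<epsilon> = \<epsilon> powr \<alpha>" for \<epsilon> :: real
  have S: "S \<epsilon> > 0" if "\<epsilon> > 0" for \<epsilon> using that by (simp add: S_def)
  define H where "H = (H_op M m cp cm)\<inverse>"
  define T where "T \<epsilon> = inverse_plus_zero (I_scaled a b \<alpha> \<epsilon>) (Q_hat a b h h' M \<alpha> \<epsilon>)" for \<epsilon>
  have H_sol: "solution_graph (form_domain UNIV ?q) (sform ?q) = H"
    unfolding H_def by (rule H_op_inverse[OF q, symmetric])
  have T_sol: "solution_graph (form_domain (I_scaled a b \<alpha> \<epsilon>) (V (S \<epsilon>))) (sform (V (S \<epsilon>))) = T \<epsilon>"
    if \<epsilon>: "\<epsilon> > 0" for \<epsilon>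
    unfolding T_def
  proof (rule inverse_plus_zero_Q_hat[OF a_pos b_pos \<epsilon> V[OF S[OF \<epsilon>]], symmetric])
    show "V (S \<epsilon>) t = (\<epsilon> powr \<alpha>)\<^sup>2 * W_pot h h' M \<epsilon> (t * \<epsilon> powr \<alpha>)"
      if "t * \<epsilon> powr \<alpha> \<in> {-a..b}" for t
      using V_eq_W_pot[OF \<epsilon>, of t] that by (simp add: S_def assms(15))
  qed (rule W_pot_integrable)
  obtain A where A: "solution_graph (form_domain UNIV ?q) (sform ?q) = blinfun_graph A"
    by (rule q.exists_solution_operator)
  have "\<exists>A'. T \<epsilon> = blinfun_graph A'" if \<epsilon>: "\<epsilon> > 0" for \<epsilon>
  proof -
    interpret v: confining "I_scaled a b \<alpha> \<epsilon>" "V (S \<epsilon>)" \<kappa> m by (rule V[OF S[OF \<epsilon>]])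
    show ?thesis using v.exists_solution_operator T_sol[OF \<epsilon>] by metis
  qed
  then obtain A' where A': "\<And>\<epsilon>. \<epsilon> > 0 \<Longrightarrow> T \<epsilon> = blinfun_graph (A' \<epsilon>)" by metis
  obtain D r where r: "r > 0" "r \<le> a" "r \<le> b" and D: "D \<ge> 0"
    and Vint: "\<And>s R. s > 0 \<Longrightarrow> R * s < r \<Longrightarrow> R \<ge> 1 \<Longrightarrow> set_integrable lborel {-R..R} (V s)"
    and close: "\<And>s R. s > 0 \<Longrightarrow> R * s < r \<Longrightarrow> R \<ge> 1 \<Longrightarrow>
      (LBINT t:{-R..R}. \<bar>?q t - V s t\<bar>) \<le> s * (2 * R * (D * R powr (m + 1)) + (LBINT x. v1 x))"
    by (rule potentials_close) (rule that)
  define K where "K = 2 * pi\<^sup>2 / M ^ 3 * max cp cm"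
  have K: "K \<ge> 0" using M_pos cp_pos by (simp add: K_def)
  \<comment> \<open>The estimate is separated into a part depending on \<open>R\<close> alone that
    tends to 0, and a part linear in \<open>S \<epsilon>\<close> whose coefficient may grow with
    \<open>R\<close>.\<close>
  define c1 where "c1 R = sqrt (1310 / \<kappa>\<^sup>2 / sqrt R * ((1 + K / \<kappa>) * (9 / \<kappa>))) + 14 / \<kappa> / sqrt R" for R
  define c2 where "c2 R = 36 / \<kappa>\<^sup>2 * (2 * R * (D * R powr (m + 1)) + (LBINT x. v1 x))" for R
  have bound: "norm (A' \<epsilon> - A) \<le> c1 R + c2 R * S \<epsilon>" if \<epsilon>: "\<epsilon> > 0" and R: "R \<ge> 1" and RS: "R * S \<epsilon> < r" for \<epsilon> R
  proof -
    have sub: "{-R<..<R} \<subseteq> I_scaled a b \<alpha> \<epsilon>"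
    proof
      fix x assume "x \<in> {-R<..<R}"
      moreover have "R < a / S \<epsilon>" "R < b / S \<epsilon>" using RS r S[OF \<epsilon>] by (auto simp: field_simps)
      ultimately show "x \<in> I_scaled a b \<alpha> \<epsilon>"
        unfolding I_scaled_def by (auto simp: S_def powr_minus divide_inverse)
    qed
    have "norm (A' \<epsilon> - A) \<le> sqrt (1310 / \<kappa>\<^sup>2 / sqrt R * ((1 + K / \<kappa>) * (9 / \<kappa>))) + 14 / \<kappa> / sqrt R
        + 36 / \<kappa>\<^sup>2 * (S \<epsilon> * (2 * R * (D * R powr (m + 1)) + (LBINT x. v1 x)))"
    proof (rule resolvent_difference[OF q V[OF S[OF \<epsilon>]] m_ge R _ K sub q_pot_integrable
          Vint[OF S[OF \<epsilon>] RS R] close[OF S[OF \<epsilon>] RS R] A])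
      show "?q x \<le> K * \<bar>x\<bar> powr m" for x using q_pot_le[of x] by (simp add: K_def)
      show "solution_graph (form_domain (I_scaled a b \<alpha> \<epsilon>) (V (S \<epsilon>))) (sform (V (S \<epsilon>))) = blinfun_graph (A' \<epsilon>)"
        using T_sol[OF \<epsilon>] A'[OF \<epsilon>] by simp
    qed
    then show ?thesis by (simp add: c1_def c2_def mult_ac)
  qed
  have \<alpha>: "\<alpha> > 0" using assms(11,15) by simp
  have S_lim: "(S \<longlongrightarrow> 0) (at_right 0)"
    unfolding S_def[abs_def]
    by (rule tendsto_zero_powrI[OF tendsto_ident_at tendsto_const _ \<alpha>]) (auto simp: eventually_at_filter)
  have c1_lim: "(c1 \<longlongrightarrow> 0) at_top"
  proof -
    have inv: "((\<lambda>R::real. inverse (sqrt R)) \<longlongrightarrow> 0) at_top"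
      by (intro tendsto_inverse_0_at_top sqrt_at_top)
    have "((\<lambda>R. sqrt (1310 / \<kappa>\<^sup>2 * inverse (sqrt R) * ((1 + K / \<kappa>) * (9 / \<kappa>))) + 14 / \<kappa> * inverse (sqrt R))
        \<longlongrightarrow> sqrt (1310 / \<kappa>\<^sup>2 * 0 * ((1 + K / \<kappa>) * (9 / \<kappa>))) + 14 / \<kappa> * 0) at_top"
      by (intro tendsto_intros inv)
    then show ?thesis by (simp add: c1_def[abs_def] divide_inverse)
  qed
  have lim: "((\<lambda>\<epsilon>. norm (the_blinfun (T \<epsilon>) - the_blinfun H)) \<longlongrightarrow> 0) (at_right 0)"
  proof (rule tendstoI)
    fix e :: real assume e: "e > 0"
    \<comment> \<open>The order of choices matters: \<open>R\<close> is fixed from \<open>e\<close>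
      alone, and only then is \<epsilon> made small enough to beat \<open>c2 R\<close> and to fit
      the cutoff into the region where the potentials are close.\<close>
    have "\<forall>\<^sub>F R in at_top. c1 R < e / 2 \<and> R \<ge> 1"
      using order_tendstoD(2)[OF c1_lim, of "e / 2"] e by (intro eventually_conj eventually_ge_at_top) auto
    then obtain R where R: "c1 R < e / 2" "R \<ge> 1"
      using eventually_happens trivial_limit_at_top_linorder by blast
    have l1: "((\<lambda>\<epsilon>. R * S \<epsilon>) \<longlongrightarrow> R * 0) (at_right 0)"
      and l2: "((\<lambda>\<epsilon>. c2 R * S \<epsilon>) \<longlongrightarrow> c2 R * 0) (at_right 0)"
      by (intro tendsto_intros S_lim)+
    have "\<forall>\<^sub>F \<epsilon> in at_right 0. R * S \<epsilon> < r" by (rule order_tendstoD(2)[OF l1]) (use r in simp)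
    moreover have "\<forall>\<^sub>F \<epsilon> in at_right 0. c2 R * S \<epsilon> < e / 2" by (rule order_tendstoD(2)[OF l2]) (use e in simp)
    moreover have "\<forall>\<^sub>F \<epsilon> in at_right (0::real). \<epsilon> > 0" by (rule eventually_at_right_less)
    ultimately show "\<forall>\<^sub>F \<epsilon> in at_right 0. dist (norm (the_blinfun (T \<epsilon>) - the_blinfun H)) 0 < e"
    proof eventually_elim
      case (elim \<epsilon>)
      have "the_blinfun (T \<epsilon>) = A' \<epsilon>" using A'[OF elim(3)] by simp
      moreover have "the_blinfun H = A" using A H_sol by simp
      ultimately show ?case using bound[OF elim(3) R(2) elim(1)] R(1) elim(2) by simp
    qed
  qed
  have "\<forall>\<epsilon>>0. everywhere_bounded (T \<epsilon>)" using A' by (auto simp: everywhere_bounded_def)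
  moreover have "everywhere_bounded H" using A H_sol by (auto simp: everywhere_bounded_def)
  ultimately show ?thesis using lim unfolding T_def H_def by blast
qed

end
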